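(* Let $\mathcal{N}=\mathcal{M}\otimes M_2$ be a $W^*$-algebra of type $I_2$, where $\mathcal{M}$ is a commutative $W^*$-algebra, and let $H$ be a complex Hilbert space. Then every $w^*$-continuous orthogonal vector field $F:\mathcal{N}\to H$ is stationary.
   Context: For a $W^*$-algebra $\mathcal{A}$, $\mathcal{A}^{\mathrm{pr}}$ denotes the set of orthogonal projections in $\mathcal{A}$, and $\mathcal{A}_*^+$ denotes the set of positive $w^*$-continuous (normal) linear functionals on $\mathcal{A}$, i.e. the positive elements of the predual $\mathcal{A}_*$. Inner products are linear in the first argument. A $w^*$-continuous orthogonal vector field (OVF) is a linear map $F:\mathcal{A}\to H$ into a complex Hilbert space $H$, continuous from the $w^*$-topology of $\mathcal{A}$ to the weak topology of $H$, such that for all $p,q\in\mathcal{A}^{\mathrm{pr}}$, $pq=0$ implies $\langle F(p),F(q)\rangle=0$. A $w^*$-continuous OVF $F:\mathcal{A}\to H$ is stationary if there exist $\varphi,\psi\in\mathcal{A}_*^+$ such that $\langle F(x),F(y)\rangle=\varphi(y^*x)+\psi(xy^* )$ for all $x,y\in\mathcal{A}$. $M_2$ is the algebra of $2\times2$ complex matrices, and elements of $\mathcal{M}\otimes M_2$ are $2\times 2$ matrices with entries in $\mathcal{M}$. *)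

theory Defs
  imports "HOL-Analysis.Analysis"
begin

class scaleC =
  fixes scaleC :: "complex \<Rightarrow> 'a \<Rightarrow> 'a" (infixr \<open>*\<^sub>C\<close> 75)

class complex_vector = scaleC + real_vector +
  assumes scaleR_scaleC: "r *\<^sub>R x = complex_of_real r *\<^sub>C x"
    and scaleC_add_right: "a *\<^sub>C (x + y) = a *\<^sub>C x + a *\<^sub>C y"
    and scaleC_add_left: "(a + b) *\<^sub>C x = a *\<^sub>C x + b *\<^sub>C x"
    and scaleC_scaleC: "a *\<^sub>C b *\<^sub>C x = (a * b) *\<^sub>C x"
    and scaleC_one: "1 *\<^sub>C x = x"

class complex_normed_vector = complex_vector + real_normed_vector +
  assumes norm_scaleC: "norm (a *\<^sub>C x) = cmod a * norm x"

global_interpretation complex_vector: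
  vector_space "scaleC :: complex \<Rightarrow> 'a \<Rightarrow> 'a::complex_vector"
  by unfold_locales
    (simp_all add: scaleC_add_right scaleC_add_left scaleC_scaleC scaleC_one)

instantiation complex :: complex_normed_vector
begin

definition scaleC_complex_def: "scaleC = ((*) :: complex \<Rightarrow> complex \<Rightarrow> complex)"

instance
  by standard (simp_all add: scaleC_complex_def scaleR_conv_of_real algebra_simps norm_mult)

end

instantiation vec :: (complex_vector, finite) complex_vector
begin

definition scaleC_vec_def: "a *\<^sub>C v = (\<chi> i. a *\<^sub>C (v $ i))"

instance
  by standard (simp_all add: scaleC_vec_def vec_eq_iff scaleR_scaleC
      scaleC_add_right scaleC_add_left scaleC_scaleC scaleC_one)

end

abbreviation clinear :: "('a::complex_vector \<Rightarrow> 'b::complex_vector) \<Rightarrow> bool" where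
  "clinear \<equiv> Vector_Spaces.linear scaleC scaleC"

text \<open>The norm on the dual is \<open>onorm\<close>.\<close>

definition cdual :: "('a::complex_normed_vector \<Rightarrow> complex) set" where
  "cdual = {f. clinear f \<and> bounded_linear f}"

definition initial_topology :: "('a \<Rightarrow> complex) set \<Rightarrow> 'a topology" where
  "initial_topology P = topology_generated_by {f -` U | f U. f \<in> P \<and> open U}"

definition weak_topology :: "'a::complex_normed_vector topology" where
  "weak_topology = initial_topology cdual"

text \<open>A predual of a Banach space \<open>X\<close>, realised inside the dual of \<open>X\<close>: a norm-closed
  subspace \<open>P\<close> of functionals such that the evaluation map is an isometric isomorphism of
  \<open>X\<close> onto the dual of \<open>P\<close>. The last two clauses say that this map is isometric and
  surjective.\<close>

definition is_predual :: "('a::complex_normed_vector \<Rightarrow> complex) set \<Rightarrow> bool" where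
  "is_predual P \<longleftrightarrow>
     P \<subseteq> cdual \<and>
     (\<lambda>_. 0) \<in> P \<and>
     (\<forall>f\<in>P. \<forall>g\<in>P. (\<lambda>x. f x + g x) \<in> P) \<and>
     (\<forall>c. \<forall>f\<in>P. (\<lambda>x. c * f x) \<in> P) \<and>
     (\<forall>f g. (\<forall>n::nat. f n \<in> P) \<and> g \<in> cdual \<and>
        (\<lambda>n. onorm (\<lambda>x. f n x - g x)) \<longlonglongrightarrow> 0 \<longrightarrow> g \<in> P) \<and>
     (\<forall>x. norm x = (SUP f\<in>{f \<in> P. onorm f \<le> 1}. cmod (f x))) \<and>
     (\<forall>L :: ('a \<Rightarrow> complex) \<Rightarrow> complex.
        (\<forall>f\<in>P. \<forall>g\<in>P. L (\<lambda>x. f x + g x) = L f + L g) \<and>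
        (\<forall>c. \<forall>f\<in>P. L (\<lambda>x. c * f x) = c * L f) \<and>
        (\<exists>C. \<forall>f\<in>P. cmod (L f) \<le> C * onorm f)
        \<longrightarrow> (\<exists>x. \<forall>f\<in>P. L f = f x))"

text \<open>The inner product is linear in the first argument.\<close>

class complex_hilbert_space = complex_normed_vector + banach +
  fixes cinner :: "'a \<Rightarrow> 'a \<Rightarrow> complex"
  assumes cinner_commute: "cinner x y = cnj (cinner y x)"
    and cinner_add_left: "cinner (x + y) z = cinner x z + cinner y z"
    and cinner_scaleC_left: "cinner (a *\<^sub>C x) y = a * cinner x y"
    and cinner_self: "cinner x x = complex_of_real ((norm x)\<^sup>2)"

class cstar_algebra = complex_normed_vector + real_normed_algebra_1 + banach +
  fixes star :: "'a \<Rightarrow> 'a"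
  assumes mult_scaleC_left: "(a *\<^sub>C x) * y = a *\<^sub>C (x * y)"
    and mult_scaleC_right: "x * (a *\<^sub>C y) = a *\<^sub>C (x * y)"
    and star_star: "star (star x) = x"
    and star_add: "star (x + y) = star x + star y"
    and star_scaleC: "star (a *\<^sub>C x) = cnj a *\<^sub>C star x"
    and star_mult: "star (x * y) = star y * star x"
    and cstar_identity: "norm (star x * x) = (norm x)\<^sup>2"

text \<open>A W*-algebra is a C*-algebra \<open>'a\<close> together with some \<open>P\<close> such that
  \<open>is_predual P\<close>. By a theorem of Sakai \<open>P\<close> is unique; here it is a parameter of the
  notions that depend on it.\<close>

definition wstar_topology :: "('a::cstar_algebra \<Rightarrow> complex) set \<Rightarrow> 'a topology" where
  "wstar_topology P = initial_topology P"

definition projections :: "'a::cstar_algebra set" where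
  "projections = {p. p * p = p \<and> star p = p}"

definition normal_positive ::
  "('a::cstar_algebra \<Rightarrow> complex) set \<Rightarrow> ('a \<Rightarrow> complex) set" where
  "normal_positive P = {f. clinear f \<and> continuous_map (wstar_topology P) euclidean f \<and>
     (\<forall>x. f (star x * x) \<in> \<real>\<^sub>\<ge>\<^sub>0)}"

definition wstar_continuous_ovf ::
  "('a::cstar_algebra \<Rightarrow> complex) set \<Rightarrow> ('a \<Rightarrow> 'h::complex_hilbert_space) \<Rightarrow> bool" where
  "wstar_continuous_ovf P F \<longleftrightarrow>
     clinear F \<and> continuous_map (wstar_topology P) weak_topology F \<and>
     (\<forall>p\<in>projections. \<forall>q\<in>projections. p * q = 0 \<longrightarrow> cinner (F p) (F q) = 0)"

definition stationary ::
  "('a::cstar_algebra \<Rightarrow> complex) set \<Rightarrow> ('a \<Rightarrow> 'h::complex_hilbert_space) \<Rightarrow> bool" where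
  "stationary P F \<longleftrightarrow>
     (\<exists>\<phi>\<in>normal_positive P. \<exists>\<psi>\<in>normal_positive P.
        \<forall>x y. cinner (F x) (F y) = \<phi> (star y * x) + \<psi> (x * star y))"

definition matrix_star :: "'a::cstar_algebra^'n^'n \<Rightarrow> 'a^'n^'n" where
  "matrix_star A = (\<chi> i j. star (A $ j $ i))"

text \<open>A *-isomorphism from the matrix algebra over \<open>'m\<close> onto \<open>'n\<close>. It fixes the norm of
  \<open>'n\<close>, because the norm of a C*-algebra is determined by its *-algebra structure; the norm
  that the type of matrices carries in the library plays no role.\<close>

definition matrix_star_iso ::
  "('m::cstar_algebra^'k^'k \<Rightarrow> 'n::cstar_algebra) \<Rightarrow> bool" where
  "matrix_star_iso \<Phi> \<longleftrightarrow>
     bij \<Phi> \<and> clinear \<Phi> \<and>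
     (\<forall>A B. \<Phi> (A ** B) = \<Phi> A * \<Phi> B) \<and>
     (\<forall>A. \<Phi> (matrix_star A) = star (\<Phi> A))"

end

theory Submission
  imports Defs
begin

text \<open>The form \<open>\<langle>F x, F y\<rangle>\<close> is local over the centre \<open>\<M>\<close>: orthogonality for central projections
  gives \<open>\<langle>F (a x), F y\<rangle> = \<langle>F x, F (a\<^sup>* y)\<rangle>\<close>, because the projections of a commutative W*-algebra
  span a norm dense subspace. Hence the form is given by the functionals
  \<open>\<omega> i j k l a = \<langle>F (a E\<^sub>i\<^sub>j), F E\<^sub>k\<^sub>l\<rangle>\<close> on \<open>\<M>\<close>. Orthogonality of the rank one projections of \<open>M\<^sub>2\<close>
  forces \<open>\<omega> i j k l = \<delta>\<^sub>i\<^sub>k A\<^sub>l\<^sub>j + \<delta>\<^sub>j\<^sub>l B\<^sub>i\<^sub>k\<close>, which is the asserted formula with \<open>A\<close> and \<open>B\<close> as the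
  matrices of \<open>\<phi>\<close> and \<open>\<psi>\<close>, but they need not be positive. Only the sum of the two lowest
  eigenvalues is nonnegative (evaluate the form at rank one matrices), so \<open>A - r\<close> and \<open>B + r\<close> are
  positive for a suitable scalar \<open>r\<close> at every projection. To choose the scalars additively, as a
  normal functional \<open>\<gamma> a = \<langle>F a, \<eta>\<rangle>\<close>, do so for the atoms of every finite family of projections and
  take a weak limit \<open>\<eta>\<close> in \<open>H\<close>. Normality on \<open>\<M> \<otimes> M\<^sub>2\<close> needs that multiplication by a projection
  is weak* continuous, which is derived from a norm inequality by a Hahn--Banach argument.\<close>

section \<open>Sublinear functionals\<close>

text \<open>Subtracting \<open>r\<close> from \<open>A\<close> and adding it to \<open>B\<close>
  does not change the form, and the scalars allowed at a projection fill the interval from minus the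
  lowest eigenvalue of \<open>B\<close> to the lowest eigenvalue of \<open>A\<close>. Taking an end
  point at each projection is not additive, since lowest eigenvalues are only superadditive.
  Compactness in the dual of the commutative algebra would give an additive choice, but possibly
  outside the predual. Searching among the functionals \<gamma> given by vectors \<eta> in a ball of
  \<open>H\<close> replaces it by weak compactness in \<open>H\<close>, and normality comes for free
  because \<open>F\<close> is weak* continuous. The price is a bound on \<eta>, hence the estimate
  of the scalar at each projection by the squared norm of \<open>F\<close> there. The other obstacle
  is that a predual is known only through duality: it comes with no order and no module structure.
  Support projections and weak* continuity of multiplication must therefore be extracted from norm
  inequalities that survive passage to a limit functional.\<close>

definition sublinear :: "('a::real_vector \<Rightarrow> real) \<Rightarrow> bool" where
  "sublinear p \<longleftrightarrow> (\<forall>x y. p (x + y) \<le> p x + p y) \<and> (\<forall>r x. 0 \<le> r \<longrightarrow> p (r *\<^sub>R x) = r * p x)"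

lemma sublinearI:
  assumes "\<And>x y. p (x + y) \<le> p x + p y"
    and "\<And>r x. 0 < r \<Longrightarrow> p (r *\<^sub>R x) \<le> r * p x"
    and "p 0 = 0"
  shows "sublinear p"
proof -
  have "p (r *\<^sub>R x) = r * p x" if "0 \<le> r" for r x
  proof (cases "r = 0")
    case False
    then have r: "0 < r" using that by simp
    have "p (inverse r *\<^sub>R (r *\<^sub>R x)) \<le> inverse r * p (r *\<^sub>R x)"
      using r by (intro assms(2)) simp
    then have "r * p x \<le> p (r *\<^sub>R x)"
      using r by (simp add: field_simps)
    then show ?thesis using assms(2)[OF r, of x] by simp
  qed (simp add: assms(3))
  then show ?thesis using assms(1) by (simp add: sublinear_def)
qed

lemma sublinear_add: "sublinear p \<Longrightarrow> p (x + y) \<le> p x + p y"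
  by (simp add: sublinear_def)

lemma sublinear_scale: "sublinear p \<Longrightarrow> 0 \<le> r \<Longrightarrow> p (r *\<^sub>R x) = r * p x"
  by (simp add: sublinear_def)

lemma sublinear_zero: "sublinear p \<Longrightarrow> p 0 = 0"
  using sublinear_scale[of p 0 0] by simp

lemma sublinear_minus: "sublinear p \<Longrightarrow> - p (- x) \<le> p x"
  using sublinear_add[of p x "- x"] sublinear_zero[of p] by simp

text \<open>The device that forces linearity: \<open>t = 0\<close> puts \<open>q\<close> below
  \<open>p\<close>, and \<open>t = 1\<close> at \<open>x = - v\<close> gives
  \<open>q (- v) \<le> - p v\<close>, so a linear functional below \<open>q\<close> is at least
  \<open>p v\<close> at \<open>v\<close>. The infimum over \<open>t\<close> is finite because
  \<open>t * p v\<close> is the value of \<open>p\<close> at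
  \<open>- x + (x + t *\<^sub>R v)\<close>.\<close>

lemma sublinear_tilt:
  fixes p :: "'a::real_vector \<Rightarrow> real"
  assumes p: "sublinear p"
  obtains q where "sublinear q" "\<And>x t. 0 \<le> t \<Longrightarrow> q x \<le> p (x + t *\<^sub>R v) - t * p v"
proof -
  define S where "S = (\<lambda>x. (\<lambda>t. p (x + t *\<^sub>R v) - t * p v) ` {0..})"
  define q where "q = (\<lambda>x. Inf (S x))"
  have bound: "- p (- x) \<le> s" if s: "s \<in> S x" for s x
  proof -
    obtain t where t: "0 \<le> t" "s = p (x + t *\<^sub>R v) - t * p v"
      using s by (auto simp: S_def)
    have "t * p v = p (- x + (x + t *\<^sub>R v))"
      using sublinear_scale[OF p t(1)] by simp
    also have "\<dots> \<le> p (- x) + p (x + t *\<^sub>R v)"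
      by (rule sublinear_add[OF p])
    finally show ?thesis using t by simp
  qed
  have bdd: "bdd_below (S x)" for x
    using bound by (auto simp: bdd_below_def)
  have ne: "S x \<noteq> {}" for x by (auto simp: S_def)
  have low: "q x \<le> p (x + t *\<^sub>R v) - t * p v" if "0 \<le> t" for x t
    unfolding q_def using that by (intro cInf_lower bdd) (auto simp: S_def)
  have near: "\<exists>t\<ge>0. p (x + t *\<^sub>R v) - t * p v < q x + e" if "0 < e" for x e
  proof -
    have "\<exists>s\<in>S x. s < q x + e"
      using cInf_lessD[OF ne, of x "q x + e"] that by (auto simp: q_def)
    then show ?thesis by (auto simp: S_def)
  qed
  have "sublinear q"
  proof (rule sublinearI)
    fix x y
    show "q (x + y) \<le> q x + q y"
    proof (rule field_le_epsilon)
      fix e :: real assume "0 < e"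
      then obtain s t where s: "0 \<le> s" "p (x + s *\<^sub>R v) - s * p v < q x + e / 2"
        and t: "0 \<le> t" "p (y + t *\<^sub>R v) - t * p v < q y + e / 2"
        using near[of "e / 2" x] near[of "e / 2" y] by auto
      have "q (x + y) \<le> p ((x + s *\<^sub>R v) + (y + t *\<^sub>R v)) - (s + t) * p v"
        using low[of "s + t" "x + y"] s(1) t(1) by (simp add: algebra_simps)
      also have "\<dots> \<le> p (x + s *\<^sub>R v) + p (y + t *\<^sub>R v) - (s + t) * p v"
        using sublinear_add[OF p] by simp
      finally show "q (x + y) \<le> q x + q y + e"
        using s(2) t(2) by (simp add: algebra_simps)
    qed
  next
    fix r :: real and x assume r: "0 < r"
    show "q (r *\<^sub>R x) \<le> r * q x"
    proof (rule field_le_epsilon)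
      fix e :: real assume "0 < e"
      then obtain t where t: "0 \<le> t" "p (x + t *\<^sub>R v) - t * p v < q x + e / r"
        using near[of "e / r" x] r by auto
      have "q (r *\<^sub>R x) \<le> p (r *\<^sub>R (x + t *\<^sub>R v)) - (r * t) * p v"
        using low[of "r * t" "r *\<^sub>R x"] r t(1) by (simp add: algebra_simps)
      also have "\<dots> = r * (p (x + t *\<^sub>R v) - t * p v)"
        using sublinear_scale[OF p, of r "x + t *\<^sub>R v"] r by (simp add: algebra_simps)
      also have "\<dots> \<le> r * (q x + e / r)"
        using t(2) r by (intro mult_left_mono) auto
      also have "\<dots> = r * q x + e" using r by (simp add: distrib_left)
      finally show "q (r *\<^sub>R x) \<le> r * q x + e" .
    qed
  next
    have "q 0 \<le> 0" using low[of 0 0] sublinear_zero[OF p] by simp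
    moreover have "0 \<le> q 0"
      unfolding q_def using bound[of _ 0] ne[of 0] sublinear_zero[OF p]
      by (intro cInf_greatest) auto
    ultimately show "q 0 = 0" by simp
  qed
  then show ?thesis using low that by blast
qed

text \<open>Zorn's lemma for the functionals below \<open>p\<close>. The pointwise infimum of a
  chain is bounded below by \<open>- p (- x)\<close>, and it is subadditive because the smaller of
  two members of a chain is nearly optimal at both points.\<close>

lemma minimal_sublinear:
  fixes p :: "'a::real_vector \<Rightarrow> real"
  assumes p: "sublinear p"
  obtains q where "sublinear q" "\<And>x. q x \<le> p x"
    "\<And>r. sublinear r \<Longrightarrow> (\<And>x. r x \<le> q x) \<Longrightarrow> r = q"
proof -
  define A where "A = {q. sublinear q \<and> q \<le> p}"
  have "\<exists>m\<in>A. \<forall>a\<in>A. m \<ge> a \<longrightarrow> a = m"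
  proof (rule predicate_Zorn)
    show "partial_order_on A (relation_of (\<ge>) A)"
      by (rule partial_order_on_relation_ofI) auto
    fix C assume "C \<in> Chains (relation_of (\<ge>) A)"
    then have CA: "C \<subseteq> A" and chain: "\<And>a b. a \<in> C \<Longrightarrow> b \<in> C \<Longrightarrow> a \<le> b \<or> b \<le> a"
      by (auto simp: Chains_def relation_of_def)
    show "\<exists>u\<in>A. \<forall>a\<in>C. a \<ge> u"
    proof (cases "C = {}")
      case True
      then show ?thesis using p by (auto simp: A_def)
    next
      case False
      define u where "u = (\<lambda>x. Inf ((\<lambda>q. q x) ` C))"
      have sub: "sublinear q" "q x \<le> p x" if "q \<in> C" for q x
        using CA that by (auto simp: A_def le_fun_def)
      have bound: "- p (- x) \<le> q x" if "q \<in> C" for q x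
        using sublinear_minus[OF sub(1)[OF that], of x] sub(2)[OF that, of "- x"] by simp
      have bdd: "bdd_below ((\<lambda>q. q x) ` C)" for x
        using bound by (auto simp: bdd_below_def)
      have low: "u x \<le> q x" if "q \<in> C" for q x
        unfolding u_def using that by (intro cInf_lower bdd) auto
      have near: "\<exists>q\<in>C. q x < u x + e" if "0 < e" for x e
        using cInf_lessD[of "(\<lambda>q. q x) ` C" "u x + e"] that False by (auto simp: u_def)
      have "sublinear u"
      proof (rule sublinearI)
        fix x y
        show "u (x + y) \<le> u x + u y"
        proof (rule field_le_epsilon)
          fix e :: real assume "0 < e"
          then obtain q r where qr: "q \<in> C" "q x < u x + e / 2" "r \<in> C" "r y < u y + e / 2"
            using near[of "e / 2"] by (meson half_gt_zero)
          obtain s where s: "s \<in> C" "s x \<le> q x" "s y \<le> r y"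
            using chain[OF qr(1,3)] qr(1,3) by (auto simp: le_fun_def)
          have "u (x + y) \<le> s x + s y"
            using low[OF s(1), of "x + y"] sublinear_add[OF sub(1)[OF s(1)], of x y] by simp
          then show "u (x + y) \<le> u x + u y + e" using qr s by simp
        qed
      next
        fix r :: real and x assume r: "0 < r"
        show "u (r *\<^sub>R x) \<le> r * u x"
        proof (rule field_le_epsilon)
          fix e :: real assume "0 < e"
          then obtain q where q: "q \<in> C" "q x < u x + e / r"
            using near[of "e / r"] r by (meson divide_pos_pos)
          have "u (r *\<^sub>R x) \<le> r * q x"
            using low[OF q(1), of "r *\<^sub>R x"] sublinear_scale[OF sub(1)[OF q(1)], of r x] r by simp
          also have "\<dots> \<le> r * (u x + e / r)"
            using q(2) r by (intro mult_left_mono) auto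
          also have "\<dots> = r * u x + e" using r by (simp add: distrib_left)
          finally show "u (r *\<^sub>R x) \<le> r * u x + e" .
        qed
      next
        have "(\<lambda>q. q 0) ` C = {0}"
          using False sublinear_zero[OF sub(1)] by (auto simp: image_def)
        then show "u 0 = 0" by (simp add: u_def)
      qed
      moreover have "u \<le> p"
        using False low sub(2) by (metis ex_in_conv le_funI order_trans)
      ultimately show ?thesis using low by (auto simp: A_def le_fun_def)
    qed
  qed
  then obtain m where m: "m \<in> A" "\<And>a. a \<in> A \<Longrightarrow> a \<le> m \<Longrightarrow> a = m" by blast
  show ?thesis
  proof (rule that[of m])
    fix r assume "sublinear r" "\<And>x. r x \<le> m x"
    moreover from this m(1) have "r \<in> A" by (auto simp: A_def le_fun_def intro: order_trans)
    ultimately show "r = m" by (intro m(2)) (auto simp: le_fun_def)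
  qed (use m(1) in \<open>auto simp: A_def le_fun_def\<close>)
qed

text \<open>Tilting \<open>p\<close> at \<open>g\<close> forces the value at \<open>g\<close>; a
  minimal functional below the tilt is invariant under further tilts, hence superadditive and so
  linear. Prescribing one value takes the place of extending from a subspace.\<close>

lemma hahn_banach_sublinear:
  fixes p :: "'a::real_vector \<Rightarrow> real"
  assumes p: "sublinear p"
  obtains L where "linear L" "\<And>x. L x \<le> p x" "L g = p g"
proof -
  obtain p' where p': "sublinear p'" "\<And>x t. 0 \<le> t \<Longrightarrow> p' x \<le> p (x + t *\<^sub>R g) - t * p g"
    using sublinear_tilt[OF p] by blast
  obtain L where L: "sublinear L" "\<And>x. L x \<le> p' x"
    and min: "\<And>r. sublinear r \<Longrightarrow> (\<And>x. r x \<le> L x) \<Longrightarrow> r = L"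
    using minimal_sublinear[OF p'(1)] by blast
  have super: "L x + L v \<le> L (x + v)" for x v
  proof -
    obtain q where q: "sublinear q" "\<And>x t. 0 \<le> t \<Longrightarrow> q x \<le> L (x + t *\<^sub>R v) - t * L v"
      using sublinear_tilt[OF L(1)] by blast
    have "q = L" using q(2)[of 0] by (intro min q(1)) simp
    then show ?thesis using q(2)[of 1 x] by simp
  qed
  have add: "L (x + v) = L x + L v" for x v
    using super[of x v] sublinear_add[OF L(1), of x v] by simp
  have neg: "L (- x) = - L x" for x
    using add[of x "- x"] sublinear_zero[OF L(1)] by simp
  have "L (r *\<^sub>R x) = r * L x" for r x
  proof (cases "0 \<le> r")
    case False
    then have "L ((- r) *\<^sub>R (- x)) = (- r) * L (- x)"
      by (intro sublinear_scale[OF L(1)]) simp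
    then show ?thesis by (simp add: neg)
  qed (rule sublinear_scale[OF L(1)])
  then have "linear L" by (intro linearI) (simp_all add: add)
  moreover have le: "L x \<le> p x" for x
    using L(2)[of x] p'(2)[of 0 x] by simp
  moreover have "L g = p g"
    using L(2)[of "- g"] p'(2)[of 1 "- g"] sublinear_zero[OF p] neg[of g] le[of g] by simp
  ultimately show ?thesis using that by blast
qed

section \<open>Preduals\<close>

lemma clinear_iff:
  "clinear f \<longleftrightarrow> (\<forall>x y. f (x + y) = f x + f y) \<and> (\<forall>a x. f (a *\<^sub>C x) = a *\<^sub>C f x)"
  unfolding Vector_Spaces.linear_def module_hom_def module_hom_axioms_def
  by (simp add: complex_vector.vector_space_axioms complex_vector.module_axioms)

lemma clinear_add: "clinear f \<Longrightarrow> f (x + y) = f x + f y"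
  by (simp add: clinear_iff)

lemma clinear_scaleC: "clinear f \<Longrightarrow> f (a *\<^sub>C x) = a *\<^sub>C f x"
  by (simp add: clinear_iff)

lemma clinear_linear: "clinear f \<Longrightarrow> linear f"
  by (simp add: clinear_iff linear_iff scaleR_scaleC)

lemma clinear_zero: "clinear f \<Longrightarrow> f 0 = 0"
  by (simp add: clinear_linear linear_0)

lemma clinear_diff: "clinear f \<Longrightarrow> f (x - y) = f x - f y"
  by (simp add: clinear_linear linear_diff)

lemma clinear_minus: "clinear f \<Longrightarrow> f (- x) = - f x"
  by (simp add: clinear_linear linear_neg)

lemma cdual_clinear: "f \<in> cdual \<Longrightarrow> clinear f"
  and cdual_bounded: "f \<in> cdual \<Longrightarrow> bounded_linear f"
  by (simp_all add: cdual_def)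

lemma cdual_scaleC: "f \<in> cdual \<Longrightarrow> f (a *\<^sub>C x) = a * f x"
  using clinear_scaleC[OF cdual_clinear] by (simp add: scaleC_complex_def)

lemma cdual_le_onorm: "f \<in> cdual \<Longrightarrow> cmod (f x) \<le> onorm f * norm x"
  by (intro onorm cdual_bounded)

lemma cdual_blinfun: "f \<in> cdual \<Longrightarrow> blinfun_apply (Blinfun f) = f"
  and norm_cdual_blinfun: "f \<in> cdual \<Longrightarrow> norm (Blinfun f) = onorm f"
  by (simp_all add: bounded_linear_Blinfun_apply cdual_bounded norm_blinfun.rep_eq)

lemma is_predualD:
  assumes "is_predual P"
  shows predual_cdual: "f \<in> P \<Longrightarrow> f \<in> cdual"
    and predual_zero: "(\<lambda>_. 0) \<in> P"
    and predual_add: "f \<in> P \<Longrightarrow> g \<in> P \<Longrightarrow> (\<lambda>x. f x + g x) \<in> P"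
    and predual_scale: "f \<in> P \<Longrightarrow> (\<lambda>x. c * f x) \<in> P"
    and predual_closed: "(\<And>n::nat. s n \<in> P) \<Longrightarrow> g \<in> cdual \<Longrightarrow>
      (\<lambda>n. onorm (\<lambda>x. s n x - g x)) \<longlonglongrightarrow> 0 \<Longrightarrow> g \<in> P"
    and predual_norm: "norm x = (SUP f\<in>{f \<in> P. onorm f \<le> 1}. cmod (f x))"
    and predual_surj: "(\<And>f g. f \<in> P \<Longrightarrow> g \<in> P \<Longrightarrow> L (\<lambda>x. f x + g x) = L f + L g) \<Longrightarrow>
      (\<And>c f. f \<in> P \<Longrightarrow> L (\<lambda>x. c * f x) = c * L f) \<Longrightarrow>
      (\<And>f. f \<in> P \<Longrightarrow> cmod (L f) \<le> C * onorm f) \<Longrightarrow> \<exists>x. \<forall>f\<in>P. L f = f x"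
proof -
  note d = assms[unfolded is_predual_def]
  show "f \<in> P \<Longrightarrow> f \<in> cdual" using d by blast
  show "(\<lambda>_. 0) \<in> P" using d by blast
  show "f \<in> P \<Longrightarrow> g \<in> P \<Longrightarrow> (\<lambda>x. f x + g x) \<in> P" using d by blast
  show "f \<in> P \<Longrightarrow> (\<lambda>x. c * f x) \<in> P" using d by blast
  show "(\<And>n::nat. s n \<in> P) \<Longrightarrow> g \<in> cdual \<Longrightarrow>
      (\<lambda>n. onorm (\<lambda>x. s n x - g x)) \<longlonglongrightarrow> 0 \<Longrightarrow> g \<in> P" using d by blast
  show "norm x = (SUP f\<in>{f \<in> P. onorm f \<le> 1}. cmod (f x))" using d by blast
  assume a: "\<And>f g. f \<in> P \<Longrightarrow> g \<in> P \<Longrightarrow> L (\<lambda>x. f x + g x) = L f + L g"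
    "\<And>c f. f \<in> P \<Longrightarrow> L (\<lambda>x. c * f x) = c * L f"
    "\<And>f. f \<in> P \<Longrightarrow> cmod (L f) \<le> C * onorm f"
  have "(\<forall>f\<in>P. \<forall>g\<in>P. L (\<lambda>x. f x + g x) = L f + L g) \<and>
        (\<forall>c. \<forall>f\<in>P. L (\<lambda>x. c * f x) = c * L f) \<and>
        (\<exists>C. \<forall>f\<in>P. cmod (L f) \<le> C * onorm f)"
    using a by blast
  then show "\<exists>x. \<forall>f\<in>P. L f = f x" using d by blast
qed

text \<open>Real parts suffice because the unit ball of \<open>P\<close> is closed under
  multiplication by phases.\<close>

lemma predual_norm_le:
  assumes P: "is_predual P" and le: "\<And>f. f \<in> P \<Longrightarrow> onorm f \<le> 1 \<Longrightarrow> Re (f x) \<le> C"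
  shows "norm x \<le> C"
proof -
  have "cmod (f x) \<le> C" if f: "f \<in> P" "onorm f \<le> 1" for f
  proof -
    define c where "c = cnj (sgn (f x))"
    have c: "cmod c \<le> 1" by (simp add: c_def norm_sgn)
    have "onorm (\<lambda>x. c * f x) \<le> 1"
    proof (rule onorm_bound)
      fix y
      have "cmod (c * f y) \<le> cmod (f y)"
        using c by (simp add: norm_mult mult_left_le_one_le)
      also have "\<dots> \<le> 1 * norm y"
        using cdual_le_onorm[OF predual_cdual[OF P f(1)], of y] f(2)
        by (meson mult_right_mono norm_ge_zero order_trans)
      finally show "cmod (c * f y) \<le> 1 * norm y" .
    qed simp
    then have "Re (c * f x) \<le> C"
      by (intro le predual_scale[OF P f(1)])
    moreover have "c * f x = of_real (cmod (f x))"
      by (simp add: c_def sgn_eq complex_norm_square[symmetric] power2_eq_square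
          mult.commute[of "cnj (f x)"])
    ultimately show ?thesis by simp
  qed
  moreover have "(\<lambda>_. 0) \<in> {f \<in> P. onorm f \<le> 1}"
    using predual_zero[OF P] by (simp add: onorm_zero)
  ultimately show ?thesis
    unfolding predual_norm[OF P, of x] by (intro cSUP_least) auto
qed

text \<open>Hahn--Banach produces real functionals, while duality speaks of complex linear ones; a
  complex linear functional is recovered from its real part, its imaginary part at \<open>f\<close>
  being minus the real part at \<open>\<i>\<close> times \<open>f\<close>.\<close>

lemma predual_represents_real:
  assumes P: "is_predual P"
    and add: "\<And>f g. f \<in> P \<Longrightarrow> g \<in> P \<Longrightarrow> L (\<lambda>x. f x + g x) = L f + L g"
    and scale: "\<And>r f. f \<in> P \<Longrightarrow> L (\<lambda>x. complex_of_real r * f x) = r * L f"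
    and bound: "\<And>f. f \<in> P \<Longrightarrow> \<bar>L f\<bar> \<le> C * onorm f"
  obtains x where "\<And>f. f \<in> P \<Longrightarrow> Re (f x) = L f"
proof -
  define K where "K = (\<lambda>f. Complex (L f) (- L (\<lambda>x. \<i> * f x)))"
  have ip: "(\<lambda>x. \<i> * f x) \<in> P" if "f \<in> P" for f
    using that by (rule predual_scale[OF P])
  have rp: "(\<lambda>x. complex_of_real r * f x) \<in> P" if "f \<in> P" for f r
    using that by (rule predual_scale[OF P])
  have C: "L (\<lambda>x. c * f x) = Re c * L f + Im c * L (\<lambda>x. \<i> * f x)" if f: "f \<in> P" for c f
  proof -
    have "c * f x = complex_of_real (Re c) * f x + complex_of_real (Im c) * (\<i> * f x)" for x
      by (simp add: complex_eq_iff)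
    then show ?thesis
      using add[OF rp[OF f, of "Re c"] rp[OF ip[OF f], of "Im c"]] scale[OF f] scale[OF ip[OF f]]
      by simp
  qed
  have "\<exists>x. \<forall>f\<in>P. K f = f x"
  proof (rule predual_surj[OF P])
    fix f g assume "f \<in> P" "g \<in> P"
    then show "K (\<lambda>x. f x + g x) = K f + K g"
      using add[OF ip[of f] ip[of g]] by (simp add: K_def add distrib_left complex_eq_iff)
  next
    fix c f assume f: "f \<in> P"
    have "L (\<lambda>x. \<i> * (c * f x)) = Re (\<i> * c) * L f + Im (\<i> * c) * L (\<lambda>x. \<i> * f x)"
      using C[OF f, of "\<i> * c"] by (simp add: mult.assoc)
    then show "K (\<lambda>x. c * f x) = c * K f"
      by (simp add: K_def C[OF f, of c] complex_eq_iff algebra_simps)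
  next
    fix f assume f: "f \<in> P"
    have "onorm (\<lambda>x. \<i> * f x) \<le> onorm f"
      using cdual_le_onorm[OF predual_cdual[OF P f]]
      by (intro onorm_bound onorm_pos_le cdual_bounded predual_cdual[OF P f])
         (simp add: norm_mult)
    moreover have nn: "0 \<le> onorm f"
      by (intro onorm_pos_le cdual_bounded predual_cdual[OF P f])
    ultimately have "\<bar>C\<bar> * onorm (\<lambda>x. \<i> * f x) \<le> \<bar>C\<bar> * onorm f"
      by (intro mult_left_mono) auto
    moreover have "C * onorm (\<lambda>x. \<i> * f x) \<le> \<bar>C\<bar> * onorm (\<lambda>x. \<i> * f x)"
      by (intro mult_right_mono onorm_pos_le cdual_bounded predual_cdual[OF P ip[OF f]]) auto
    moreover have "C * onorm f \<le> \<bar>C\<bar> * onorm f"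
      using nn by (intro mult_right_mono) auto
    moreover have "cmod (K f) \<le> \<bar>L f\<bar> + \<bar>L (\<lambda>x. \<i> * f x)\<bar>"
      using cmod_le[of "K f"] by (simp add: K_def)
    ultimately show "cmod (K f) \<le> (2 * \<bar>C\<bar>) * onorm f"
      using bound[OF f] bound[OF ip[OF f]] by linarith
  qed
  then obtain x where "\<And>f. f \<in> P \<Longrightarrow> f x = K f" by auto
  then have "Re (f x) = L f" if "f \<in> P" for f using that by (metis K_def complex.sel(1))
  then show ?thesis by (rule that)
qed

text \<open>A weak* cluster point of a bounded sequence, in the only form that is used: distances to
  it are controlled by those to the sequence. A Hahn--Banach functional below the upper limit
  replaces compactness.\<close>

lemma predual_sequence_limit:
  fixes P :: "('a::complex_normed_vector \<Rightarrow> complex) set" and u :: "nat \<Rightarrow> 'a"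
  assumes P: "is_predual P" and B: "\<And>n. norm (u n) \<le> B"
  obtains e where "\<And>z C. (\<And>\<epsilon>. 0 < \<epsilon> \<Longrightarrow> \<forall>\<^sub>F n in sequentially. norm (u n + z) \<le> C + \<epsilon>) \<Longrightarrow>
    norm (e + z) \<le> C"
proof -
  \<comment> \<open>Eventual upper bounds of the sequence \<open>Re (h (u n))\<close>, so that
    \<open>p h\<close> is its upper limit.\<close>
  define T where "T = (\<lambda>h :: 'a \<Rightarrow>\<^sub>L complex. {C. \<forall>\<^sub>F n in sequentially. Re (h (u n)) \<le> C})"
  define p where "p = (\<lambda>h. Inf (T h))"
  have B0: "0 \<le> B" using B[of 0] norm_ge_zero[of "u 0"] by linarith
  have abs: "\<bar>Re (blinfun_apply h (u n))\<bar> \<le> norm h * B" for h n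
    using abs_Re_le_cmod[of "h (u n)"] norm_blinfun[of h "u n"] B[of n]
    by (meson mult_left_mono norm_ge_zero order_trans)
  have mem: "norm h * B \<in> T h" for h
    using abs[of h] by (auto simp: T_def abs_le_iff)
  have bnd: "- (norm h * B) \<le> C" if C: "C \<in> T h" for h C
  proof -
    obtain n where "Re (h (u n)) \<le> C"
      using C by (auto simp: T_def eventually_sequentially)
    then show ?thesis using abs[of h n] by simp
  qed
  have bdd: "bdd_below (T h)" for h using bnd by (auto simp: bdd_below_def)
  have low: "p h \<le> C" if "C \<in> T h" for h C
    unfolding p_def using that by (intro cInf_lower bdd)
  have near: "\<exists>C\<in>T h. C < p h + e" if "0 < e" for h e
    using cInf_lessD[of "T h" "p h + e"] that mem by (auto simp: p_def)
  have "sublinear p"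
  proof (rule sublinearI)
    fix h k
    show "p (h + k) \<le> p h + p k"
    proof (rule field_le_epsilon)
      fix e :: real assume "0 < e"
      then obtain C D where CD: "C \<in> T h" "C < p h + e / 2" "D \<in> T k" "D < p k + e / 2"
        using near[of "e / 2"] by (meson half_gt_zero)
      have "\<forall>\<^sub>F n in sequentially. Re (h (u n)) \<le> C \<and> Re (k (u n)) \<le> D"
        using CD by (simp add: T_def eventually_conj)
      then have "C + D \<in> T (h + k)"
        unfolding T_def mem_Collect_eq
        by (rule eventually_mono) (simp add: blinfun.add_left)
      then show "p (h + k) \<le> p h + p k + e" using low[of "C + D"] CD by fastforce
    qed
  next
    fix r :: real and h assume r: "0 < r"
    show "p (r *\<^sub>R h) \<le> r * p h"
    proof (rule field_le_epsilon)
      fix e :: real assume "0 < e"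
      then obtain C where C: "C \<in> T h" "C < p h + e / r"
        using near[of "e / r"] r by (meson divide_pos_pos)
      have "r * C \<in> T (r *\<^sub>R h)"
        using C(1) r by (auto simp: T_def blinfun.scaleR_left elim!: eventually_mono)
      then have "p (r *\<^sub>R h) \<le> r * C" by (rule low)
      also have "\<dots> \<le> r * (p h + e / r)" using C(2) r by (intro mult_left_mono) auto
      also have "\<dots> = r * p h + e" using r by (simp add: distrib_left)
      finally show "p (r *\<^sub>R h) \<le> r * p h + e" .
    qed
  next
    have "p 0 \<le> 0" by (rule low) (simp add: T_def)
    moreover have "0 \<le> p 0"
      unfolding p_def using bnd[of _ 0] mem[of 0] by (intro cInf_greatest) auto
    ultimately show "p 0 = 0" by simp
  qed
  then obtain L where L: "linear L" "\<And>h. L h \<le> p h"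
    using hahn_banach_sublinear by metis
  have Lb: "\<bar>L h\<bar> \<le> B * norm h" for h
    using L(2)[of h] L(2)[of "- h"] low[OF mem[of h]] low[OF mem[of "- h"]] linear_neg[OF L(1), of h]
    by (simp add: abs_le_iff mult.commute)
  obtain e where e: "\<And>f. f \<in> P \<Longrightarrow> Re (f e) = L (Blinfun f)"
  proof (rule predual_represents_real[OF P, of "\<lambda>f. L (Blinfun f)" B])
    fix f g assume fg: "f \<in> P" "g \<in> P"
    have "Blinfun (\<lambda>x. f x + g x) = Blinfun f + Blinfun g"
      using fg predual_add[OF P fg]
      by (intro blinfun_eqI) (simp add: cdual_blinfun predual_cdual[OF P] blinfun.add_left)
    then show "L (Blinfun (\<lambda>x. f x + g x)) = L (Blinfun f) + L (Blinfun g)"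
      by (simp add: linear_add[OF L(1)])
  next
    fix r f assume f: "f \<in> P"
    have "Blinfun (\<lambda>x. complex_of_real r * f x) = r *\<^sub>R Blinfun f"
      using f predual_scale[OF P f]
      by (intro blinfun_eqI)
        (simp add: cdual_blinfun predual_cdual[OF P] blinfun.scaleR_left scaleR_conv_of_real)
    then show "L (Blinfun (\<lambda>x. complex_of_real r * f x)) = r * L (Blinfun f)"
      by (simp add: linear_scale[OF L(1)])
  next
    fix f assume "f \<in> P"
    then show "\<bar>L (Blinfun f)\<bar> \<le> B * onorm f"
      using Lb[of "Blinfun f"] by (simp add: norm_cdual_blinfun predual_cdual[OF P])
  qed blast
  show ?thesis
  proof (rule that)
    fix z C assume ev: "\<And>\<epsilon>. 0 < \<epsilon> \<Longrightarrow> \<forall>\<^sub>F n in sequentially. norm (u n + z) \<le> C + \<epsilon>"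
    show "norm (e + z) \<le> C"
    proof (rule predual_norm_le[OF P])
      fix f assume f: "f \<in> P" "onorm f \<le> 1"
      note fd = predual_cdual[OF P f(1)]
      have fle: "Re (f x) \<le> norm x" for x
        using complex_Re_le_cmod[of "f x"] cdual_le_onorm[OF fd, of x] f(2)
        by (meson mult_left_le_one_le norm_ge_zero order_trans onorm_pos_le cdual_bounded[OF fd])
      have "p (Blinfun f) \<le> C - Re (f z)"
      proof (rule field_le_epsilon)
        fix \<epsilon> :: real assume "0 < \<epsilon>"
        from ev[OF this] have "C - Re (f z) + \<epsilon> \<in> T (Blinfun f)"
          unfolding T_def mem_Collect_eq cdual_blinfun[OF fd]
        proof (rule eventually_mono)
          fix n assume "norm (u n + z) \<le> C + \<epsilon>"
          then show "Re (f (u n)) \<le> C - Re (f z) + \<epsilon>"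
            using fle[of "u n + z"] by (simp add: clinear_add[OF cdual_clinear[OF fd]])
        qed
        then show "p (Blinfun f) \<le> C - Re (f z) + \<epsilon>" by (rule low)
      qed
      then show "Re (f (e + z)) \<le> C"
        using e[OF f(1)] L(2)[of "Blinfun f"] by (simp add: clinear_add[OF cdual_clinear[OF fd]])
    qed
  qed
qed

lemma predual_sum:
  assumes P: "is_predual P" and "finite I" "\<And>i. i \<in> I \<Longrightarrow> f i \<in> P"
  shows "(\<lambda>x. \<Sum>i\<in>I. c i * f i x) \<in> P"
  using assms(2,3)
proof (induction I rule: finite_induct)
  case empty
  then show ?case by (simp add: predual_zero[OF P])
next
  case (insert i I)
  then have "(\<lambda>x. c i * f i x + (\<Sum>i\<in>I. c i * f i x)) \<in> P"
    by (intro predual_add[OF P] predual_scale[OF P]) auto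
  then show ?case using insert.hyps by simp
qed

text \<open>An idempotent that is contractive in the sense of \<open>\<ell>\<^sup>2\<close>-sums, such as multiplication by
  a projection, is weak* continuous. Suppose that \<open>f \<circ> E\<close> is not in the predual, and let \<open>L\<close> be
  a functional on the dual that vanishes on the predual but not at \<open>f \<circ> E\<close>. Then \<open>h \<mapsto> L (h \<circ> E)\<close>
  and \<open>h \<mapsto> L (h \<circ> (1 - E))\<close> are, up to sign, the same point \<open>x \<noteq> 0\<close> of the space. If its part \<open>y\<close>
  outside of the range of \<open>E\<close> does not vanish, then adding large multiples of \<open>y\<close> to the first
  functional contradicts the norm hypothesis; otherwise exchange \<open>E\<close> and \<open>1 - E\<close>.\<close>

lemma predual_comp_idempotent:
  fixes P :: "('a::complex_normed_vector \<Rightarrow> complex) set" and E :: "'a \<Rightarrow> 'a"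
  assumes P: "is_predual P"
    and E: "clinear E" "\<And>x. E (E x) = E x" "\<And>x. norm (E x) \<le> norm x"
      "\<And>x. norm (x - E x) \<le> norm x"
      "\<And>x y. (norm (E x + (y - E y)))\<^sup>2 \<le> (norm (E x))\<^sup>2 + (norm (y - E y))\<^sup>2"
    and f: "f \<in> P"
  shows "(\<lambda>x. f (E x)) \<in> P"
proof (rule ccontr)
  assume not: "(\<lambda>x. f (E x)) \<notin> P"
  define D where "D = (\<lambda>x. x - E x)"
  have Dlin: "clinear D"
    using E(1) by (simp add: D_def clinear_iff algebra_simps complex_vector.scale_right_diff_distrib)
  have ED: "E (D x) = 0" "D (E x) = 0" "D (D x) = D x" "E x + D x = x" for x
    by (simp_all add: D_def clinear_diff[OF E(1)] E(2))
  have norms: "norm (E x) \<le> norm x" "norm (D x) \<le> norm x"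
      "(norm (E x + D y))\<^sup>2 \<le> (norm (E x))\<^sup>2 + (norm (D y))\<^sup>2" for x y
    using E(3-5) by (simp_all add: D_def)
  have compc: "(\<lambda>x. h (T x)) \<in> cdual"
    if h: "h \<in> cdual" and T: "clinear T" "\<And>x. norm (T x) \<le> norm x" for h T
  proof -
    have "bounded_linear T"
      using clinear_linear[OF T(1)] T(2)
      by (intro bounded_linear_intro[where K=1]) (auto simp: linear_add linear_scale)
    then have "bounded_linear (\<lambda>x. h (T x))"
      by (rule bounded_linear_compose[OF cdual_bounded[OF h]])
    then show ?thesis
      using cdual_clinear[OF h] T(1) by (simp add: cdual_def clinear_iff)
  qed
  note hE = compc[OF _ E(1,3)] and hD = compc[OF _ Dlin norms(2)]
  define Q where "Q = Blinfun ` P"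
  define g where "g = Blinfun (\<lambda>x. f (E x))"
  note Pc = predual_cdual[OF P]
  have gapp: "blinfun_apply g = (\<lambda>x. f (E x))"
    unfolding g_def by (rule cdual_blinfun[OF hE[OF Pc[OF f]]])
  have Badd: "Blinfun (\<lambda>x. h x + k x) = Blinfun h + Blinfun k"
    if "h \<in> cdual" "k \<in> cdual" for h k :: "'a \<Rightarrow> complex"
    using that bounded_linear_add[of h k]
    by (intro blinfun_eqI) (simp add: cdual_def bounded_linear_Blinfun_apply blinfun.add_left)
  have Bscale: "Blinfun (\<lambda>x. complex_of_real r * h x) = r *\<^sub>R Blinfun h"
    if "h \<in> cdual" for h :: "'a \<Rightarrow> complex" and r
    using that bounded_linear_const_mult[of h "complex_of_real r"]
    by (intro blinfun_eqI)
      (simp add: cdual_def bounded_linear_Blinfun_apply blinfun.scaleR_left scaleR_conv_of_real)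
  have Q0: "0 \<in> Q"
    unfolding Q_def
  proof (rule image_eqI)
    show "0 = Blinfun (\<lambda>_::'a. 0::complex)"
      by (intro blinfun_eqI) (simp add: bounded_linear_Blinfun_apply)
  qed (rule predual_zero[OF P])
  have Qadd: "h + k \<in> Q" if hk: "h \<in> Q" "k \<in> Q" for h k
  proof -
    obtain a b where ab: "a \<in> P" "b \<in> P" "h = Blinfun a" "k = Blinfun b"
      using hk unfolding Q_def by blast
    then have "h + k = Blinfun (\<lambda>x. a x + b x)" by (simp add: Badd Pc)
    then show ?thesis unfolding Q_def using predual_add[OF P ab(1,2)] by blast
  qed
  have Qscale: "r *\<^sub>R h \<in> Q" if h: "h \<in> Q" for r h
  proof -
    obtain a where a: "a \<in> P" "h = Blinfun a" using h unfolding Q_def by blast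
    then have "r *\<^sub>R h = Blinfun (\<lambda>x. complex_of_real r * a x)" by (simp add: Bscale Pc)
    then show ?thesis unfolding Q_def using predual_scale[OF P a(1)] by blast
  qed
  have "g \<notin> closure Q"
  proof
    assume "g \<in> closure Q"
    then obtain s where s: "\<And>n. s n \<in> Q" "s \<longlonglongrightarrow> g"
      by (auto simp: closure_sequential)
    then obtain t where t: "\<And>n. t n \<in> P" "\<And>n. s n = Blinfun (t n)"
      unfolding Q_def image_iff by metis
    have "blinfun_apply (s n - g) = (\<lambda>x. t n x - f (E x))" for n
      by (auto simp: blinfun.diff_left t(2) gapp cdual_blinfun[OF Pc[OF t(1)]])
    then have "onorm (\<lambda>x. t n x - f (E x)) = norm (s n - g)" for n
      by (simp add: norm_blinfun.rep_eq)
    moreover have "(\<lambda>n. norm (s n - g)) \<longlonglongrightarrow> 0"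
      using s(2) by (simp add: LIM_zero tendsto_norm_zero)
    ultimately have "(\<lambda>x. f (E x)) \<in> P"
      by (intro predual_closed[OF P t(1) hE[OF Pc[OF f]]]) simp
    then show False using not by simp
  qed
  then have pos: "0 < infdist g Q"
    using Q0 in_closure_iff_infdist_zero[of Q g] infdist_nonneg[of g Q] by fastforce
  have near: "\<exists>q\<in>Q. norm (h - q) < infdist h Q + e" if "0 < e" for h e
    using cInf_lessD[of "dist h ` Q" "infdist h Q + e"] that Q0
    by (auto simp: dist_norm infdist_def split: if_splits)
  have low: "infdist h Q \<le> norm (h - q)" if "q \<in> Q" for h q
    using infdist_le[OF that, of h] by (simp add: dist_norm)
  \<comment> \<open>A linear functional below the distance to the subspace \<open>Q\<close> vanishes
    on \<open>Q\<close> and has norm at most one; prescribing its value at \<open>g\<close> makes it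
    positive there.\<close>
  have "sublinear (\<lambda>h. infdist h Q)"
  proof (rule sublinearI)
    fix h k
    show "infdist (h + k) Q \<le> infdist h Q + infdist k Q"
    proof (rule field_le_epsilon)
      fix e :: real assume "0 < e"
      then obtain q r where qr: "q \<in> Q" "norm (h - q) < infdist h Q + e / 2"
          "r \<in> Q" "norm (k - r) < infdist k Q + e / 2"
        using near[of "e / 2"] by (meson half_gt_zero)
      have "infdist (h + k) Q \<le> norm ((h - q) + (k - r))"
        using low[OF Qadd[OF qr(1,3)], of "h + k"] by (simp add: algebra_simps)
      then show "infdist (h + k) Q \<le> infdist h Q + infdist k Q + e"
        using norm_triangle_ineq[of "h - q" "k - r"] qr by simp
    qed
  next
    fix r :: real and h assume r: "0 < r"
    show "infdist (r *\<^sub>R h) Q \<le> r * infdist h Q"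
    proof (rule field_le_epsilon)
      fix e :: real assume "0 < e"
      then obtain q where q: "q \<in> Q" "norm (h - q) < infdist h Q + e / r"
        using near[of "e / r"] r by (meson divide_pos_pos)
      have "infdist (r *\<^sub>R h) Q \<le> norm (r *\<^sub>R (h - q))"
        using low[OF Qscale[OF q(1), of r], of "r *\<^sub>R h"] by (simp add: scaleR_diff_right)
      also have "\<dots> \<le> r * (infdist h Q + e / r)" using q(2) r by simp
      also have "\<dots> = r * infdist h Q + e" using r by (simp add: distrib_left)
      finally show "infdist (r *\<^sub>R h) Q \<le> r * infdist h Q + e" .
    qed
  qed (simp add: Q0)
  then obtain L where L: "linear L" "\<And>h. L h \<le> infdist h Q" "L g = infdist g Q"
    using hahn_banach_sublinear by metis
  have LQ: "L q = 0" if "q \<in> Q" for q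
    using L(2)[of q] L(2)[of "- q"] Qscale[OF that, of "- 1"] that linear_neg[OF L(1), of q] by simp
  have Lnorm: "L h \<le> norm h" for h
    using L(2)[of h] low[OF Q0, of h] by simp
  have Labs: "\<bar>L h\<bar> \<le> norm h" for h
    using Lnorm[of h] Lnorm[of "- h"] linear_neg[OF L(1), of h] by simp
  obtain x where x: "\<And>h. h \<in> P \<Longrightarrow> Re (h x) = L (Blinfun (\<lambda>z. h (E z)))"
  proof (rule predual_represents_real[OF P, of "\<lambda>h. L (Blinfun (\<lambda>z. h (E z)))" 1])
    fix h k assume "h \<in> P" "k \<in> P"
    then show "L (Blinfun (\<lambda>z. h (E z) + k (E z))) = L (Blinfun (\<lambda>z. h (E z))) + L (Blinfun (\<lambda>z. k (E z)))"
      by (simp add: Badd hE Pc linear_add[OF L(1)])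
  next
    fix r h assume "h \<in> P"
    then show "L (Blinfun (\<lambda>z. complex_of_real r * h (E z))) = r * L (Blinfun (\<lambda>z. h (E z)))"
      by (simp add: Bscale hE Pc linear_scale[OF L(1)])
  next
    fix h assume h: "h \<in> P"
    have "onorm (\<lambda>z. h (E z)) \<le> onorm h"
    proof (rule onorm_bound[OF onorm_pos_le[OF cdual_bounded[OF Pc[OF h]]]])
      fix z
      show "cmod (h (E z)) \<le> onorm h * norm z"
        using cdual_le_onorm[OF Pc[OF h], of "E z"] E(3)[of z]
          onorm_pos_le[OF cdual_bounded[OF Pc[OF h]]]
        by (meson mult_left_mono order_trans)
    qed
    then show "\<bar>L (Blinfun (\<lambda>z. h (E z)))\<bar> \<le> 1 * onorm h"
      using Labs[of "Blinfun (\<lambda>z. h (E z))"] by (simp add: norm_cdual_blinfun[OF hE[OF Pc[OF h]]])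
  qed blast
  have xD: "Re (h (- x)) = L (Blinfun (\<lambda>z. h (D z)))" if h: "h \<in> P" for h
  proof -
    have "Blinfun (\<lambda>z. h (E z)) + Blinfun (\<lambda>z. h (D z)) = Blinfun h"
      using Badd[OF hE[OF Pc[OF h]] hD[OF Pc[OF h]]]
      by (simp add: clinear_add[OF cdual_clinear[OF Pc[OF h]], symmetric] ED)
    then have "L (Blinfun (\<lambda>z. h (E z))) + L (Blinfun (\<lambda>z. h (D z))) = 0"
      using LQ[of "Blinfun h"] h by (simp add: linear_add[OF L(1), symmetric] Q_def)
    then show ?thesis
      using x[OF h] by (simp add: clinear_minus[OF cdual_clinear[OF Pc[OF h]]])
  qed
  \<comment> \<open>Stated for a pair of maps because it is applied to \<open>D\<close>,
    \<open>E\<close>, \<open>x\<close> and then, with the roles exchanged, to \<open>E\<close>,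
    \<open>D\<close>, \<open>- x\<close>.\<close>
  have vanish: "S x' = 0"
    if S: "clinear S" "clinear T" "\<And>z. norm (S z) \<le> norm z" "\<And>z. norm (T z) \<le> norm z"
        "\<And>z. S (S z) = S z"
        "\<And>z w. (norm (T z + S w))\<^sup>2 \<le> (norm (T z))\<^sup>2 + (norm (S w))\<^sup>2"
      and x': "\<And>h. h \<in> P \<Longrightarrow> Re (h x') = L (Blinfun (\<lambda>z. h (T z)))" for S T x'
  proof (rule ccontr)
    assume "S x' \<noteq> 0"
    define y where "y = S x'"
    then have y: "0 < norm y" "S y = y" using \<open>S x' \<noteq> 0\<close> S(5) by auto
    \<comment> \<open>This size gives \<open>l * (norm y)\<^sup>2 = 1\<close>, and comparing the
      upper and the lower estimate of the norm of \<open>x' + l *\<^sub>R y\<close> leaves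
      \<open>(norm y)\<^sup>2 + 2 \<le> 1\<close>.\<close>
    define l where "l = 1 / (norm y)\<^sup>2"
    have "norm (x' + l *\<^sub>R y) \<le> sqrt (1 + (l * norm y)\<^sup>2)"
    proof (rule predual_norm_le[OF P])
      fix h assume h: "h \<in> P" "onorm h \<le> 1"
      note hc = Pc[OF h(1)]
      have h1: "cmod (h z) \<le> norm z" for z
        using cdual_le_onorm[OF hc, of z] h(2)
        by (meson mult_left_le_one_le norm_ge_zero order_trans onorm_pos_le cdual_bounded[OF hc])
      define c where "c = cmod (h (l *\<^sub>R y))"
      \<comment> \<open>For a unit vector \<open>z\<close>, the values of \<open>h\<close> at
        \<open>T z\<close> and at \<open>l *\<^sub>R y\<close> can be turned to the same phase;
        their sum is then the value of \<open>h\<close> at a vector whose two parts obey the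
        Pythagorean bound. The coefficient \<open>a\<close> below also normalises
        \<open>z\<close>.\<close>
      have "onorm (\<lambda>z. h (T z)) \<le> sqrt (1 + (l * norm y)\<^sup>2) - c"
      proof (rule onorm_bound)
        have "c \<le> l * norm y" using h1[of "l *\<^sub>R y"] by (simp add: c_def l_def)
        also have "\<dots> \<le> sqrt (1 + (l * norm y)\<^sup>2)" by (rule real_le_rsqrt) simp
        finally show "0 \<le> sqrt (1 + (l * norm y)\<^sup>2) - c" by simp
      next
        fix z
        show "cmod (h (T z)) \<le> (sqrt (1 + (l * norm y)\<^sup>2) - c) * norm z"
        proof (cases "z = 0")
          case True
          then show ?thesis using S(4)[of 0] h1[of "T 0"] by simp
        next
          case False
          define a b where "a = cnj (sgn (h (T z))) / complex_of_real (norm z)"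
            and "b = cnj (sgn (h (l *\<^sub>R y)))"
          have a: "cmod a \<le> 1 / norm z" and b: "cmod b \<le> 1"
            by (simp_all add: a_def b_def norm_divide norm_sgn)
          have rot: "cnj (sgn w) * w = complex_of_real (cmod w)" for w
            by (simp add: sgn_eq complex_norm_square[symmetric] power2_eq_square
                mult.commute[of "cnj w"])
          have "S (l *\<^sub>R y) = l *\<^sub>R y"
            using linear_scale[OF clinear_linear[OF S(1)], of l y] y(2) by simp
          then have "h (T (a *\<^sub>C z) + S (b *\<^sub>C l *\<^sub>R y)) = a * h (T z) + b * h (l *\<^sub>R y)"
            by (simp only: clinear_add[OF cdual_clinear[OF hc]] clinear_scaleC[OF S(1)]
                clinear_scaleC[OF S(2)] cdual_scaleC[OF hc])
          also have "\<dots> = complex_of_real (cmod (h (T z)) / norm z + c)"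
            using rot[of "h (T z)"] rot[of "h (l *\<^sub>R y)"] by (simp add: a_def b_def c_def)
          finally have "cmod (h (T (a *\<^sub>C z) + S (b *\<^sub>C l *\<^sub>R y))) = cmod (h (T z)) / norm z + c"
            by (simp only: norm_of_real) (simp add: c_def)
          then have "cmod (h (T z)) / norm z + c = cmod (h (T (a *\<^sub>C z) + S (b *\<^sub>C l *\<^sub>R y)))" ..
          also have "\<dots> \<le> norm (T (a *\<^sub>C z) + S (b *\<^sub>C l *\<^sub>R y))" by (rule h1)
          also have "\<dots> \<le> sqrt ((norm (T (a *\<^sub>C z)))\<^sup>2 + (norm (S (b *\<^sub>C l *\<^sub>R y)))\<^sup>2)"
            using S(6) by (intro real_le_rsqrt)
          also have "\<dots> \<le> sqrt (1 + (l * norm y)\<^sup>2)"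
          proof (intro real_sqrt_le_mono add_mono)
            have "norm (T (a *\<^sub>C z)) \<le> cmod a * norm z"
              using S(4)[of "a *\<^sub>C z"] by (simp add: norm_scaleC)
            also have "\<dots> \<le> 1"
              using mult_right_mono[OF a, of "norm z"] False by simp
            finally show "(norm (T (a *\<^sub>C z)))\<^sup>2 \<le> 1" by (simp add: power_le_one)
            have "norm (S (b *\<^sub>C l *\<^sub>R y)) \<le> cmod b * norm (l *\<^sub>R y)"
              using S(3)[of "b *\<^sub>C l *\<^sub>R y"] by (simp add: norm_scaleC)
            also have "\<dots> \<le> 1 * norm (l *\<^sub>R y)" using b by (intro mult_right_mono) auto
            finally have "norm (S (b *\<^sub>C l *\<^sub>R y)) \<le> l * norm y" by (simp add: l_def)
            then show "(norm (S (b *\<^sub>C l *\<^sub>R y)))\<^sup>2 \<le> (l * norm y)\<^sup>2" by (intro power_mono) auto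
          qed
          finally show ?thesis using False by (simp add: field_simps)
        qed
      qed
      moreover have "Re (h x') \<le> onorm (\<lambda>z. h (T z))"
        using Lnorm[of "Blinfun (\<lambda>z. h (T z))"] x'[OF h(1)] compc[OF hc S(2,4)]
        by (simp add: norm_cdual_blinfun)
      moreover have "Re (h (l *\<^sub>R y)) \<le> c" by (simp add: c_def complex_Re_le_cmod)
      ultimately show "Re (h (x' + l *\<^sub>R y)) \<le> sqrt (1 + (l * norm y)\<^sup>2)"
        by (simp add: clinear_add[OF cdual_clinear[OF hc]])
    qed
    moreover have "(1 + l) * norm y \<le> norm (x' + l *\<^sub>R y)"
    proof -
      have "S (x' + l *\<^sub>R y) = (1 + l) *\<^sub>R y"
        using clinear_linear[OF S(1)] y(2) by (simp add: linear_add linear_scale y_def scaleR_add_left)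
      moreover have "0 \<le> l" by (simp add: l_def)
      ultimately show ?thesis using S(3)[of "x' + l *\<^sub>R y"] by simp
    qed
    ultimately have "(1 + l) * norm y \<le> sqrt (1 + (l * norm y)\<^sup>2)" by linarith
    then have "((1 + l) * norm y)\<^sup>2 \<le> 1 + (l * norm y)\<^sup>2"
      using power_mono[of "(1 + l) * norm y" "sqrt (1 + (l * norm y)\<^sup>2)" 2] by (simp add: l_def)
    then have "(norm y)\<^sup>2 + 2 * (l * (norm y)\<^sup>2) \<le> 1"
      by (simp add: power2_eq_square algebra_simps)
    moreover have "l * (norm y)\<^sup>2 = 1" using y(1) by (simp add: l_def)
    ultimately show False using zero_le_power2[of "norm y"] by linarith
  qed
  have "D x = 0"
    by (rule vanish[of D E x]) (erule x | rule Dlin E(1) norms ED(3))+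
  moreover have "E (- x) = 0"
  proof (rule vanish[of E D "- x"])
    show "(norm (D z + E w))\<^sup>2 \<le> (norm (D z))\<^sup>2 + (norm (E w))\<^sup>2" for z w
      using norms(3)[of w z] by (simp only: add.commute)
  qed (erule xD | rule Dlin E(1) norms(1,2) E(2))+
  ultimately have "x = 0" using ED(4)[of x] by (simp add: clinear_minus[OF E(1)])
  then have "L g = 0" using x[OF f] clinear_zero[OF cdual_clinear[OF Pc[OF f]]] by (simp add: g_def)
  then show False using pos L(3) by simp
qed

section \<open>The weak* continuous linear functionals are the elements of the predual\<close>

lemma initial_topology_basic_nbhd:
  assumes "openin (initial_topology P) U" "x \<in> U"
  obtains G \<delta> where "finite G" "G \<subseteq> P" "0 < \<delta>"
    "\<And>y. (\<And>g. g \<in> G \<Longrightarrow> cmod (g y - g x) < \<delta>) \<Longrightarrow> y \<in> U"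
proof -
  have "generate_topology_on {f -` U | f U. f \<in> P \<and> open U} U"
    using assms(1) by (simp add: initial_topology_def openin_topology_generated_by_iff)
  then have "\<exists>G \<delta>. finite G \<and> G \<subseteq> P \<and> 0 < \<delta> \<and> (\<forall>y. (\<forall>g\<in>G. cmod (g y - g x) < \<delta>) \<longrightarrow> y \<in> U)"
    if "x \<in> U" using that
  proof (induction U)
    case Empty
    then show ?case by simp
  next
    case (Int a b)
    then have "x \<in> a" "x \<in> b" by auto
    from Int.IH(1)[OF this(1)] Int.IH(2)[OF this(2)] obtain G \<delta> H \<epsilon> where
      "finite G" "G \<subseteq> P" "0 < \<delta>" "\<forall>y. (\<forall>g\<in>G. cmod (g y - g x) < \<delta>) \<longrightarrow> y \<in> a"
      "finite H" "H \<subseteq> P" "0 < \<epsilon>" "\<forall>y. (\<forall>g\<in>H. cmod (g y - g x) < \<epsilon>) \<longrightarrow> y \<in> b"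
      by blast
    then show ?case
      by (intro exI[of _ "G \<union> H"] exI[of _ "min \<delta> \<epsilon>"]) simp
  next
    case (UN K)
    then obtain k where k: "k \<in> K" "x \<in> k" by blast
    from UN.IH[OF k] obtain G \<delta> where
      "finite G" "G \<subseteq> P" "0 < \<delta>" "\<forall>y. (\<forall>g\<in>G. cmod (g y - g x) < \<delta>) \<longrightarrow> y \<in> k"
      by blast
    then show ?case
      using k by (intro exI[of _ G] exI[of _ \<delta>]) blast
  next
    case (Basis s)
    then obtain f V where f: "f \<in> P" "open V" "s = f -` V" by blast
    then have "f x \<in> V" using Basis by simp
    then obtain e where "0 < e" "\<And>z. dist z (f x) < e \<Longrightarrow> z \<in> V"
      using f(2) by (meson open_dist)
    then show ?case
      using f by (intro exI[of _ "{f}"] exI[of _ e]) (simp add: dist_norm)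
  qed
  from this[OF assms(2)] obtain G \<delta> where G: "finite G" "G \<subseteq> P" "0 < \<delta>"
    "\<forall>y. (\<forall>g\<in>G. cmod (g y - g x) < \<delta>) \<longrightarrow> y \<in> U" by blast
  show ?thesis by (rule that[OF G(1-3)]) (use G(4) in simp)
qed

text \<open>Induction on the family. If the new \<open>g\<close> already vanishes on the common
  kernel of the others, it gets the coefficient 0; otherwise a vector \<open>v\<close> that only
  \<open>g\<close> detects determines its coefficient.\<close>

lemma clinear_combination_of_kernels:
  fixes f :: "'a::complex_normed_vector \<Rightarrow> complex"
  assumes "finite G" "\<And>g. g \<in> G \<Longrightarrow> clinear g" "clinear f"
    and "\<And>x. (\<And>g. g \<in> G \<Longrightarrow> g x = 0) \<Longrightarrow> f x = 0"
  shows "\<exists>c. \<forall>x. f x = (\<Sum>g\<in>G. c g * g x)"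
  using assms
proof (induction G arbitrary: f rule: finite_induct)
  case empty
  then show ?case by simp
next
  case (insert g G)
  show ?case
  proof (cases "\<exists>v. (\<forall>k\<in>G. k v = 0) \<and> g v \<noteq> 0")
    case False
    then have "\<exists>c. \<forall>x. f x = (\<Sum>k\<in>G. c k * k x)"
      using insert.prems by (intro insert.IH) auto
    then obtain c where "\<And>x. f x = (\<Sum>k\<in>G. c k * k x)" by blast
    moreover have "(\<Sum>k\<in>G. (c(g := 0)) k * k x) = (\<Sum>k\<in>G. c k * k x)" for x
      using insert.hyps by (intro sum.cong) auto
    ultimately show ?thesis
      using insert.hyps by (intro exI[of _ "c(g := 0)"]) simp
  next
    case True
    then obtain v where v: "\<And>k. k \<in> G \<Longrightarrow> k v = 0" "g v \<noteq> 0" by blast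
    define a where "a = f v / g v"
    have lin: "clinear k" if "k \<in> insert g G" for k using insert.prems(1) that by blast
    have "\<exists>c. \<forall>x. f x - a * g x = (\<Sum>k\<in>G. c k * k x)"
    proof (rule insert.IH)
      show "clinear (\<lambda>x. f x - a * g x)"
        using insert.prems(2) lin[of g] unfolding clinear_iff
        by (simp add: scaleC_complex_def algebra_simps)
      fix x assume x: "\<And>k. k \<in> G \<Longrightarrow> k x = 0"
      define w where "w = x - (g x / g v) *\<^sub>C v"
      have "k w = 0" if k: "k \<in> insert g G" for k
      proof -
        have "k w = k x - g x / g v * k v"
          by (simp add: w_def clinear_diff[OF lin[OF k]] clinear_scaleC[OF lin[OF k]] scaleC_complex_def)
        then show ?thesis using k x[of k] v(1)[of k] v(2) by (cases "k = g") auto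
      qed
      then have "f w = 0" by (rule insert.prems(3))
      then show "f x - a * g x = 0"
        using insert.prems(2)
        by (simp add: w_def a_def clinear_diff clinear_scaleC scaleC_complex_def field_simps)
    qed (use lin in blast)
    then obtain c where c: "\<And>x. f x - a * g x = (\<Sum>k\<in>G. c k * k x)" by blast
    have "(\<Sum>k\<in>G. (c(g := a)) k * k x) = (\<Sum>k\<in>G. c k * k x)" for x
      using insert.hyps by (intro sum.cong) auto
    then show ?thesis
      using insert.hyps c by (intro exI[of _ "c(g := a)"]) (simp add: algebra_simps)
  qed
qed

text \<open>Continuity at 0 bounds \<open>f\<close> by 1 on a neighbourhood given by finitely many
  elements of \<open>P\<close>. The neighbourhood contains their common kernel, a subspace, so
  \<open>f\<close> vanishes there and is a combination of these elements.\<close>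

lemma continuous_clinear_in_predual:
  assumes P: "is_predual P" and f: "clinear f"
    and cont: "continuous_map (initial_topology P) euclidean f"
  shows "f \<in> P"
proof -
  have "openin (initial_topology P) {x \<in> topspace (initial_topology P). f x \<in> ball 0 1}"
    using openin_continuous_map_preimage[OF cont, of "ball 0 1"] by simp
  moreover have "0 \<in> topspace (initial_topology P)"
  proof -
    have "(\<lambda>_. 0) -` UNIV \<in> {f -` U | f U. f \<in> P \<and> open U}"
      using predual_zero[OF P] open_UNIV by blast
    then show ?thesis
      unfolding initial_topology_def topology_generated_by_topspace by blast
  qed
  ultimately obtain G \<delta> where G: "finite G" "G \<subseteq> P" "0 < \<delta>"
    "\<And>y. (\<And>g. g \<in> G \<Longrightarrow> cmod (g y - g 0) < \<delta>) \<Longrightarrow>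
      y \<in> {x \<in> topspace (initial_topology P). f x \<in> ball 0 1}"
    by (elim initial_topology_basic_nbhd[where x=0]) (auto simp: clinear_zero[OF f])
  have lin: "clinear g" if "g \<in> G" for g
    using that G(2) cdual_clinear[OF predual_cdual[OF P]] by blast
  have "f x = 0" if x: "\<And>g. g \<in> G \<Longrightarrow> g x = 0" for x
  proof (rule ccontr)
    assume nz: "f x \<noteq> 0"
    have "cmod (g ((1 / f x) *\<^sub>C x) - g 0) < \<delta>" if "g \<in> G" for g
      using x[OF that] lin[OF that] G(3) by (simp add: clinear_scaleC clinear_zero scaleC_complex_def)
    then have "f ((1 / f x) *\<^sub>C x) \<in> ball 0 1" using G(4)[of "(1 / f x) *\<^sub>C x"] by blast
    then show False using nz by (simp add: clinear_scaleC[OF f] scaleC_complex_def)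
  qed
  then obtain c where "\<And>x. f x = (\<Sum>g\<in>G. c g * g x)"
    using clinear_combination_of_kernels[OF G(1) lin f] by blast
  then have eq: "f = (\<lambda>x. \<Sum>g\<in>G. c g * g x)" by auto
  have "g \<in> P" if "g \<in> G" for g using that G(2) by blast
  then show ?thesis unfolding eq by (rule predual_sum[OF P G(1)])
qed

lemma in_predual_continuous:
  assumes "f \<in> P"
  shows "continuous_map (initial_topology P) euclidean f"
proof -
  have op: "openin (initial_topology P) (f -` U)" if U: "open U" for U
  proof -
    have "f -` U \<in> {f -` U | f U. f \<in> P \<and> open U}"
      by (rule CollectI, rule exI[of _ f], rule exI[of _ U]) (simp add: assms U)
    then show ?thesis
      unfolding initial_topology_def by (rule topology_generated_by_Basis)
  qed
  have "{x \<in> topspace (initial_topology P). f x \<in> U} = f -` U" if "open U" for U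
    using openin_subset[OF op[OF that]] by blast
  with op show ?thesis by (simp add: continuous_map)
qed

section \<open>Commutative W*-algebras\<close>

lemma star_zero [simp]: "star (0 :: 'a::cstar_algebra) = 0"
  using star_add[of "0::'a" 0] by simp

lemma star_minus: "star (- x) = - star (x :: 'a::cstar_algebra)"
  using star_add[of x "- x"] by (simp add: eq_neg_iff_add_eq_0 add.commute)

lemma star_diff: "star (x - y) = star x - star (y :: 'a::cstar_algebra)"
  using star_add[of x "- y"] by (simp add: star_minus)

lemma star_scaleR: "star (r *\<^sub>R x) = r *\<^sub>R star (x :: 'a::cstar_algebra)"
  by (simp add: scaleR_scaleC star_scaleC)

lemma star_one [simp]: "star (1 :: 'a::cstar_algebra) = 1"
  by (metis mult.right_neutral star_mult star_star mult.left_neutral)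

lemma norm_star: "norm (star x) = norm (x :: 'a::cstar_algebra)"
proof -
  have "norm y \<le> norm (star y)" for y :: 'a
  proof (cases "norm y = 0")
    case False
    have "norm y * norm y \<le> norm (star y) * norm y"
      using norm_mult_ineq[of "star y" y] by (simp add: cstar_identity power2_eq_square)
    then show ?thesis using False by simp
  qed simp
  from this[of x] this[of "star x"] show ?thesis by (simp add: star_star)
qed

lemma tendsto_star: "(f \<longlongrightarrow> l) F \<Longrightarrow> ((\<lambda>x. star (f x :: 'a::cstar_algebra)) \<longlongrightarrow> star l) F"
  by (rule bounded_linear.tendsto[where f=star])
    (auto intro!: bounded_linear_intro[where K=1] simp: star_add star_scaleR norm_star)

lemma norm_square_selfadjoint: "star x = x \<Longrightarrow> norm (x * x) = (norm (x :: 'a::cstar_algebra))\<^sup>2"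
  using cstar_identity[of x] by simp

text \<open>The element \<open>x + \<i> *\<^sub>C y\<close> is normal, the sum of squares is its
  absolute square, and \<open>x\<close> is its real part. This is the source of all order estimates
  for the norm below.\<close>

lemma norm_square_le_sum_squares:
  fixes x y :: "'a::cstar_algebra"
  assumes "star x = x" "star y = y" "x * y = y * x"
  shows "norm (x * x) \<le> norm (x * x + y * y)"
proof -
  define z where "z = x + \<i> *\<^sub>C y"
  have sz: "star z = x + (- \<i>) *\<^sub>C y" by (simp add: z_def star_add star_scaleC assms)
  have "star z * z = x * x + y * y"
    using assms(3) unfolding sz
    by (simp add: z_def distrib_left distrib_right left_diff_distrib mult_scaleC_left mult_scaleC_right
        scaleC_add_right complex_vector.scale_right_diff_distrib)
  moreover have "x = (1/2) *\<^sub>R (z + star z)"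
    unfolding sz by (simp add: z_def scaleR_2[symmetric])
  then have "norm x = norm (z + star z) / 2" by (metis norm_scaleR abs_divide abs_numeral abs_one
        mult.commute times_divide_eq_right mult_1_right)
  then have "norm x \<le> norm z"
    using norm_triangle_ineq[of z "star z"] by (simp add: norm_star)
  then have "(norm x)\<^sup>2 \<le> (norm z)\<^sup>2" by (simp add: power_mono)
  ultimately show ?thesis
    using cstar_identity[of z] by (simp add: norm_square_selfadjoint assms(1))
qed

lemma real_imaginary_parts:
  fixes x :: "'a::cstar_algebra"
  obtains a b where "star a = a" "star b = b" "x = a + \<i> *\<^sub>C b" "norm a \<le> norm x" "norm b \<le> norm x"
proof
  define a where "a = (1/2) *\<^sub>R (x + star x)"
  define b where "b = (- \<i> / 2) *\<^sub>C (x - star x)"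
  show "star a = a" by (simp add: a_def star_scaleR star_add star_star add.commute)
  have "star b = (\<i> / 2) *\<^sub>C (star x - x)" by (simp add: b_def star_scaleC star_diff star_star star_minus)
  then show "star b = b" by (simp add: b_def complex_vector.scale_right_diff_distrib)
  have "\<i> *\<^sub>C b = (1/2) *\<^sub>R (x - star x)" by (simp add: b_def scaleR_scaleC)
  then have "a + \<i> *\<^sub>C b = (1/2) *\<^sub>R (x + x)" by (simp add: a_def scaleR_right_distrib[symmetric])
  then show "x = a + \<i> *\<^sub>C b" by (simp add: scaleR_2[symmetric])
  show "norm a \<le> norm x"
    using norm_triangle_ineq[of x "star x"] by (simp add: a_def norm_star)
  show "norm b \<le> norm x"
    using norm_triangle_ineq4[of x "star x"]
    by (simp add: b_def norm_scaleC norm_star norm_divide)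
qed

lemma projection_complement: "e \<in> projections \<Longrightarrow> 1 - e \<in> (projections :: 'a::cstar_algebra set)"
  by (simp add: projections_def algebra_simps star_diff)

lemma norm_projection_le: "p \<in> projections \<Longrightarrow> norm (p :: 'a::cstar_algebra) \<le> 1"
proof -
  assume "p \<in> projections"
  then have "norm p = (norm p)\<^sup>2" using cstar_identity[of p] by (simp add: projections_def)
  then show ?thesis by (metis power2_eq_square mult_cancel_right1 norm_zero zero_le_one order_refl)
qed

text \<open>Visser's iteration for the square root of \<open>1 - x\<close>: the limit \<open>y\<close> satisfies
  \<open>2 y = x + y\<^sup>2\<close>. The real iteration at \<open>1\<close> majorises it.\<close>

primrec visser :: "'a::real_normed_algebra \<Rightarrow> nat \<Rightarrow> 'a" where
  "visser x 0 = 0"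
| "visser x (Suc n) = (1/2) *\<^sub>R (x + visser x n * visser x n)"

lemma visser_one: "0 \<le> visser (1::real) n" "visser (1::real) n \<le> 1"
  "visser (1::real) n \<le> visser (1::real) (Suc n)"
proof -
  show nn: "0 \<le> visser (1::real) n" for n by (induction n) auto
  show "visser (1::real) n \<le> 1" using nn by (induction n) (auto simp: mult_le_one)
  have eq: "visser (1::real) (Suc n) = (1 + visser 1 n * visser 1 n) / 2" for n by simp
  show "visser (1::real) n \<le> visser (1::real) (Suc n)"
  proof (induction n)
    case (Suc n)
    then have "visser (1::real) n * visser 1 n \<le> visser 1 (Suc n) * visser 1 (Suc n)"
      using nn by (intro mult_mono)
    then show ?case unfolding eq[of n] eq[of "Suc n"] by (simp add: eq del: visser.simps)
  qed simp
qed

lemma norm_visser: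
  fixes x :: "'a::real_normed_algebra_1"
  assumes "norm x \<le> 1"
  shows "norm (visser x n) \<le> visser (1::real) n"
proof (induction n)
  case (Suc n)
  have "norm (x + visser x n * visser x n) \<le> norm x + norm (visser x n) * norm (visser x n)"
    by (meson add_left_mono norm_mult_ineq norm_triangle_ineq order_trans)
  also have "\<dots> \<le> 1 + visser (1::real) n * visser (1::real) n"
    using assms Suc visser_one(1) by (intro add_mono mult_mono) auto
  finally show ?case by simp
qed simp

section \<open>Positive cone, support projections and density of the span of projections in a
  commutative W*-algebra\<close>

locale commutative_wstar =
  fixes P :: "('a::cstar_algebra \<Rightarrow> complex) set"
  assumes predual: "is_predual P" and commute: "(a :: 'a) * b = b * a"
begin

lemma left_commute: "(a :: 'a) * (b * c) = b * (a * c)"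
  by (metis commute mult.assoc)

lemmas ac = mult.assoc commute left_commute

text \<open>By commutativity a difference of squares factors, so each increment of the iteration is
  half the previous increment times the sum of the two iterates. It is therefore dominated by the
  increment of the real iteration, which is monotone and bounded.\<close>

lemma sqrt_exists:
  fixes x :: 'a
  assumes x: "star x = x" "norm x \<le> 1"
  obtains y where "star y = y" "norm y \<le> 1" "(1 - y) * (1 - y) = 1 - x"
proof -
  let ?y = "visser x" and ?s = "visser (1::real)"
  have step: "norm (?y (Suc n) - ?y n) \<le> ?s (Suc n) - ?s n" for n
  proof (induction n)
    case 0
    then show ?case using x by simp
  next
    case (Suc n)
    have "norm (?y (Suc n) + ?y n) \<le> norm (?y (Suc n)) + norm (?y n)"
      by (rule norm_triangle_ineq)
    also have "\<dots> \<le> ?s (Suc n) + ?s n"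
      by (intro add_mono norm_visser x(2))
    finally have s: "norm (?y (Suc n) + ?y n) \<le> ?s (Suc n) + ?s n" .
    have "?y (Suc (Suc n)) - ?y (Suc n) = (1/2) *\<^sub>R (?y (Suc n) * ?y (Suc n) - ?y n * ?y n)"
      unfolding visser.simps(2)[of x "Suc n"] visser.simps(2)[of x n, symmetric]
      by (subst (3) visser.simps(2)) (simp only: scaleR_diff_right[symmetric] add_diff_cancel_left)
    also have "?y (Suc n) * ?y (Suc n) - ?y n * ?y n = (?y (Suc n) - ?y n) * (?y (Suc n) + ?y n)"
      by (simp only: algebra_simps commute[of "?y n" "?y (Suc n)"])
    finally have "norm (?y (Suc (Suc n)) - ?y (Suc n))
        \<le> (1/2) * (norm (?y (Suc n) - ?y n) * norm (?y (Suc n) + ?y n))"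
      using norm_mult_ineq[of "?y (Suc n) - ?y n" "?y (Suc n) + ?y n"]
      by (simp del: visser.simps)
    also have "\<dots> \<le> (1/2) * ((?s (Suc n) - ?s n) * (?s (Suc n) + ?s n))"
      using Suc s by (intro mult_left_mono mult_mono) (auto simp del: visser.simps simp: visser_one(3))
    also have "\<dots> = ?s (Suc (Suc n)) - ?s (Suc n)"
      unfolding visser.simps(2)[of "1::real" "Suc n"]
      by (subst (5) visser.simps(2)) (simp del: visser.simps add: algebra_simps)
    finally show ?case .
  qed
  have dist: "norm (?y (n + k) - ?y n) \<le> ?s (n + k) - ?s n" for n k
  proof (induction k)
    case (Suc k)
    have "norm (?y (Suc (n + k)) - ?y n) \<le> norm (?y (Suc (n + k)) - ?y (n + k)) + norm (?y (n + k) - ?y n)"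
      using norm_triangle_ineq[of "?y (Suc (n + k)) - ?y (n + k)" "?y (n + k) - ?y n"]
      by (simp del: visser.simps)
    then show ?case using Suc step[of "n + k"] by (simp del: visser.simps)
  qed simp
  have "incseq ?s" using visser_one(3) by (rule incseq_SucI)
  then have "Cauchy ?s"
    using visser_one(2) by (metis incseq_convergent convergent_Cauchy convergent_def)
  then have "Cauchy ?y"
  proof (intro CauchyI')
    fix e :: real assume "0 < e"
    then obtain N where N: "\<And>m n. m \<ge> N \<Longrightarrow> n \<ge> N \<Longrightarrow> norm (?s m - ?s n) < e"
      using \<open>Cauchy ?s\<close> by (meson CauchyD)
    have "norm (?y m - ?y n) < e" if "N \<le> m" "m < n" for m n
      using dist[of m "n - m"] N[of n m] that by (simp add: norm_minus_commute)
    then show "\<exists>M. \<forall>m\<ge>M. \<forall>n>m. dist (?y m) (?y n) < e" unfolding dist_norm by blast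
  qed
  then obtain y where lim: "?y \<longlonglongrightarrow> y" by (auto simp: Cauchy_convergent_iff convergent_def)
  have sa: "star (?y n) = ?y n" for n
    by (induction n) (simp_all add: star_scaleR star_add star_mult x)
  show ?thesis
  proof
    show "star y = y"
      using tendsto_star[OF lim] lim unfolding sa by (rule LIMSEQ_unique)
    show "norm y \<le> 1"
      using norm_visser[OF x(2)] visser_one(2) order_trans
      by (intro LIMSEQ_le_const2[OF tendsto_norm[OF lim]]) blast
    have "(\<lambda>n. ?y (Suc n)) \<longlonglongrightarrow> (1/2) *\<^sub>R (x + y * y)"
      unfolding visser.simps by (intro tendsto_intros lim)
    then have "y = (1/2) *\<^sub>R (x + y * y)"
      using LIMSEQ_Suc[OF lim] LIMSEQ_unique by blast
    then have "y + y = x + y * y"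
      by (metis scaleR_half_double scaleR_right_distrib)
    then show "(1 - y) * (1 - y) = 1 - x" by (simp add: algebra_simps)
  qed
qed

text \<open>Squares replace the spectrum. Products are then immediate, and
  \<open>norm_square_le_sum_squares\<close> applies directly; only sums need an argument, which uses
  a norm criterion.\<close>

definition pos :: "'a \<Rightarrow> bool" where
  "pos a \<longleftrightarrow> (\<exists>k. star k = k \<and> a = k * k)"

lemma pos_selfadjoint: "pos a \<Longrightarrow> star a = a"
  by (auto simp: pos_def star_mult)

lemma pos_square: "star k = k \<Longrightarrow> pos (k * k)"
  by (auto simp: pos_def)

lemma pos_zero: "pos 0" and pos_one: "pos 1"
  using pos_square[of 0] pos_square[of 1] by simp_all

lemma pos_mult: "pos a \<Longrightarrow> pos b \<Longrightarrow> pos (a * b)"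
proof -
  assume "pos a" "pos b"
  then obtain k l where "star k = k" "a = k * k" "star l = l" "b = l * l" by (auto simp: pos_def)
  then show ?thesis using pos_square[of "k * l"] by (simp add: star_mult ac)
qed

lemma pos_power: "pos a \<Longrightarrow> pos (a ^ n)"
  by (induction n) (simp_all add: pos_one pos_mult)

lemma pos_scaleR: "0 \<le> r \<Longrightarrow> pos a \<Longrightarrow> pos (r *\<^sub>R a)"
proof -
  assume r: "0 \<le> r" and "pos a"
  then obtain k where "star k = k" "a = k * k" by (auto simp: pos_def)
  then show ?thesis using r pos_square[of "sqrt r *\<^sub>R k"] by (simp add: star_scaleR)
qed

lemma pos_one_minus: "star x = x \<Longrightarrow> norm x \<le> 1 \<Longrightarrow> pos (1 - x)"
  using sqrt_exists[of x] pos_square by (metis star_diff star_one)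

text \<open>The complement of \<open>h * h\<close> is itself a square \<open>k * k\<close>, and the
  two squares add up to 1.\<close>

lemma norm_one_minus_square:
  assumes "star h = h" "norm (h :: 'a) \<le> 1"
  shows "norm (1 - h * h) \<le> 1"
proof -
  have "norm (h * h) \<le> 1" using assms by (simp add: norm_square_selfadjoint power_le_one)
  then obtain k where k: "star k = k" "1 - h * h = k * k"
    using pos_one_minus[of "h * h"] assms by (auto simp: pos_def star_mult)
  then have "k * k + h * h = 1" by (metis diff_add_cancel)
  then show ?thesis
    using norm_square_le_sum_squares[OF k(1) assms(1) commute] k(2) by simp
qed

text \<open>Together with \<open>pos_if_norm_diff_le\<close> this describes positivity by distance
  from a multiple of 1, a condition that the triangle inequality passes on to sums.\<close>

lemma pos_norm_diff_le:
  assumes "pos a" "norm a \<le> r"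
  shows "norm (r *\<^sub>R 1 - a) \<le> r"
proof (cases "r = 0")
  case False
  then have r: "0 < r" using assms(2) norm_ge_zero[of a] by linarith
  obtain k where k: "star k = k" "a = k * k" using assms(1) by (auto simp: pos_def)
  have "(norm k)\<^sup>2 \<le> r" using assms(2) k by (simp add: norm_square_selfadjoint)
  then have "norm ((1 / sqrt r) *\<^sub>R k) \<le> 1"
    using r by (simp add: divide_le_eq real_le_rsqrt)
  from norm_one_minus_square[OF _ this] k r
  have "norm (1 - (1/r) *\<^sub>R a) \<le> 1" by (simp add: star_scaleR)
  then have "norm (r *\<^sub>R (1 - (1/r) *\<^sub>R a)) \<le> r" using r by simp
  then show ?thesis using r by (simp add: scaleR_diff_right)
qed (use assms in simp)

lemma pos_if_norm_diff_le:
  assumes "star a = a" "norm (r *\<^sub>R 1 - a) \<le> r"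
  shows "pos a"
proof (cases "r = 0")
  case False
  then have r: "0 < r" using assms(2) norm_ge_zero[of "r *\<^sub>R 1 - a"] by linarith
  have "norm ((1/r) *\<^sub>R (r *\<^sub>R 1 - a)) \<le> 1" using assms(2) r by simp
  then have "pos (1 - (1/r) *\<^sub>R (r *\<^sub>R 1 - a))"
    using assms(1) by (intro pos_one_minus) (simp_all add: star_scaleR star_diff)
  moreover have "1 - (1/r) *\<^sub>R (r *\<^sub>R 1 - a) = (1/r) *\<^sub>R a"
    using r by (simp add: scaleR_diff_right)
  ultimately show ?thesis using pos_scaleR[of r "(1/r) *\<^sub>R a"] r by simp
qed (use assms pos_zero in simp)

lemma pos_add:
  assumes "pos a" "pos b"
  shows "pos (a + b)"
proof (rule pos_if_norm_diff_le)
  show "star (a + b) = a + b" using assms by (simp add: star_add pos_selfadjoint)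
  have "norm ((norm a *\<^sub>R 1 - a) + (norm b *\<^sub>R 1 - b)) \<le> norm a + norm b"
    using norm_triangle_le add_mono pos_norm_diff_le assms by blast
  then show "norm ((norm a + norm b) *\<^sub>R 1 - (a + b)) \<le> norm a + norm b"
    by (simp add: algebra_simps)
qed

lemma norm_mono:
  assumes "pos a" "pos (b - a)"
  shows "norm a \<le> norm b"
proof -
  obtain k l where kl: "star k = k" "a = k * k" "star l = l" "b - a = l * l"
    using assms by (auto simp: pos_def)
  then have "b = k * k + l * l" by (metis add.commute diff_add_cancel)
  then show ?thesis using norm_square_le_sum_squares[OF kl(1,3) commute] kl(2) by simp
qed

lemma pos_star_mult: "pos (star x * x)"
proof -
  obtain a b where ab: "star a = a" "star b = b" "x = a + \<i> *\<^sub>C b"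
    using real_imaginary_parts by metis
  have "star x * x = a * a + b * b"
    using commute[of a b]
    by (simp add: ab(3) star_add star_scaleC ab(1,2) distrib_left distrib_right left_diff_distrib
        mult_scaleC_left mult_scaleC_right scaleC_add_right complex_vector.scale_right_diff_distrib)
  then show ?thesis using pos_add[OF pos_square[OF ab(1)] pos_square[OF ab(2)]] by simp
qed

text \<open>Quantitative form of the fact that disjointly supported functions do not add up in norm.
  Positivity of the product of \<open>1 - V\<close> and \<open>1 - Z\<close> bounds
  \<open>V + Z\<close> by \<open>1 + V * Z\<close>, and each cross term of the square has norm
  \<open>\<delta>\<close>, so that the total is \<open>(1 + \<delta>)\<^sup>2\<close>.\<close>

lemma norm_add_le_one_plus:
  assumes "norm (v :: 'a) \<le> 1" "norm z \<le> 1"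
  shows "norm (v + z) \<le> 1 + norm (v * z)"
proof -
  define V Z \<delta> where "V = star v * v" and "Z = star z * z" and "\<delta> = norm (v * z)"
  have VZ: "pos V" "pos Z" "norm V \<le> 1" "norm Z \<le> 1"
    using assms by (simp_all add: V_def Z_def pos_star_mult cstar_identity power_le_one)
  have "pos ((1 - V) * (1 - Z))"
    using VZ by (intro pos_mult pos_one_minus pos_selfadjoint)
  then have "pos ((1 + V * Z) - (V + Z))" by (simp add: algebra_simps)
  with pos_add[OF VZ(1,2)] have "norm (V + Z) \<le> norm (1 + V * Z)" by (rule norm_mono)
  also have "\<dots> \<le> 1 + norm (V * Z)" using norm_triangle_ineq[of 1 "V * Z"] by simp
  also have "norm (V * Z) = \<delta>\<^sup>2"
    unfolding \<delta>_def cstar_identity[symmetric] by (simp add: V_def Z_def star_mult ac)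
  finally have "norm (V + Z) \<le> 1 + \<delta>\<^sup>2" .
  moreover have "norm (star v * z) = \<delta>"
  proof -
    have "(norm (star v * z))\<^sup>2 = \<delta>\<^sup>2"
      unfolding \<delta>_def cstar_identity[symmetric] by (simp add: star_mult star_star ac)
    then show ?thesis by (simp add: \<delta>_def power2_eq_iff_nonneg)
  qed
  moreover have "norm (star z * v) = norm (star v * z)"
    using norm_star[of "star v * z"] by (simp add: star_mult star_star)
  moreover have "(norm (v + z))\<^sup>2 \<le> norm (V + Z) + (norm (star v * z) + norm (star z * v))"
  proof -
    have "star (v + z) * (v + z) = (V + Z) + (star v * z + star z * v)"
      by (simp add: V_def Z_def star_add algebra_simps)
    then have "(norm (v + z))\<^sup>2 = norm ((V + Z) + (star v * z + star z * v))"
      using cstar_identity[of "v + z"] by simp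
    then show ?thesis
      using norm_triangle_ineq[of "V + Z" "star v * z + star z * v"]
        norm_triangle_ineq[of "star v * z" "star z * v"] by linarith
  qed
  ultimately have "(norm (v + z))\<^sup>2 \<le> (1 + \<delta>)\<^sup>2" by (simp add: power2_eq_square algebra_simps)
  then show ?thesis unfolding \<delta>_def by (rule power2_le_imp_le) simp
qed

text \<open>If the unit ball has room for \<open>x\<close> plus a normalised multiple of
  \<open>w * x\<close>, then \<open>w * x\<close> must vanish: the perturbation enlarges
  \<open>x\<close> just where \<open>w\<close> is large. Since the hypothesis is a norm bound, it
  can be checked for weak* cluster points.\<close>

lemma annihilates_if_norm_le:
  assumes w: "pos w" and le: "\<And>m. m = norm (w * x) \<Longrightarrow> 0 < m \<Longrightarrow> norm (x + (1/m) *\<^sub>R (w * x)) \<le> 1"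
  shows "w * x = 0"
proof (rule ccontr)
  assume nz: "w * x \<noteq> 0"
  define m where "m = norm (w * x)"
  define R where "R = norm w"
  have pr: "0 < m" "0 < R" using nz by (auto simp: m_def R_def)
  \<comment> \<open>Chosen such that \<open>?d - c *\<^sub>R w\<close> is
    \<open>1 - (1/R) *\<^sub>R w\<close>, which is positive; hence \<open>c *\<^sub>R w\<close> is
    dominated by \<open>?d\<close>, although \<open>c * m\<close> is \<open>m / R + 1\<close> and
    exceeds one.\<close>
  define c where "c = 1/R + 1/m"
  let ?d = "1 + (1/m) *\<^sub>R w"
  have "pos (1 - (1/R) *\<^sub>R w)"
    using w pr by (intro pos_one_minus) (auto simp: star_scaleR pos_selfadjoint R_def)
  moreover have "pos (?d + c *\<^sub>R w)"
    using pr w by (intro pos_add pos_one pos_scaleR) (auto simp: c_def)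
  ultimately have "pos ((1 - (1/R) *\<^sub>R w) * (?d + c *\<^sub>R w) * (star x * x))"
    by (intro pos_mult pos_star_mult)
  moreover have "(1 - (1/R) *\<^sub>R w) = ?d - c *\<^sub>R w" by (simp add: c_def algebra_simps)
  moreover have "(A - B) * (A + B) = A * A - B * B" for A B :: 'a
    by (simp add: algebra_simps commute[of B A])
  ultimately have "pos ((?d * ?d - (c *\<^sub>R w) * (c *\<^sub>R w)) * (star x * x))" by metis
  moreover have "star (?d * x) * (?d * x) = ?d * ?d * (star x * x)"
    using pos_selfadjoint[OF w] by (simp add: star_mult star_add star_scaleR ac del: mult_scaleR_left mult_scaleR_right)
  moreover have "star (c *\<^sub>R (w * x)) * (c *\<^sub>R (w * x)) = (c *\<^sub>R w) * (c *\<^sub>R w) * (star x * x)"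
    using pos_selfadjoint[OF w] by (simp add: star_mult star_scaleR ac)
  ultimately have "pos (star (?d * x) * (?d * x) - star (c *\<^sub>R (w * x)) * (c *\<^sub>R (w * x)))"
    by (simp only: left_diff_distrib)
  from norm_mono[OF pos_star_mult this] have "(norm (c *\<^sub>R (w * x)))\<^sup>2 \<le> (norm (?d * x))\<^sup>2"
    by (simp only: cstar_identity)
  then have "norm (c *\<^sub>R (w * x)) \<le> norm (?d * x)" by (rule power2_le_imp_le) simp
  also have "\<dots> \<le> 1" using le[OF m_def pr(1)] by (simp add: distrib_right)
  finally have "m / R + 1 \<le> 1" using pr by (simp add: m_def[symmetric] c_def distrib_right)
  then show False using divide_pos_pos[OF pr] by simp
qed

text \<open>The support is the limit of \<open>1 - (1 - t) ^ n\<close>. Only a cluster point in the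
  sense of norm bounds is at hand, so both properties are obtained by feeding such bounds into
  \<open>annihilates_if_norm_le\<close>; idempotence follows from the two properties.\<close>

lemma support_projection:
  assumes t: "pos t" "norm t \<le> 1"
  obtains e where "e \<in> projections" "t * e = t" "\<And>w. t * w = 0 \<Longrightarrow> e * w = 0"
proof -
  define k where "k = 1 - t"
  define u where "u = (\<lambda>n. 1 - k ^ n)"
  have k: "pos k" using t by (simp add: k_def pos_one_minus pos_selfadjoint)
  have k1: "norm k \<le> 1"
    using norm_mono[OF k, of 1] t(1) by (simp add: k_def)
  have kn: "norm (k ^ n) \<le> 1" "pos (k ^ n)" "pos (u n)" "norm (u n) \<le> 1" for n
  proof -
    show 1: "norm (k ^ n) \<le> 1"
      using norm_power_ineq[of k n] power_le_one[OF norm_ge_zero k1, of n] by simp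
    show 2: "pos (k ^ n)" by (rule pos_power[OF k])
    show 3: "pos (u n)" unfolding u_def using 1 2 by (intro pos_one_minus pos_selfadjoint)
    show "norm (u n) \<le> 1" using norm_mono[OF 3, of 1] 2 by (simp add: u_def)
  qed
  \<comment> \<open>Bernoulli's inequality: \<open>k ^ n * (1 + real n *\<^sub>R t)\<close> stays
    below 1, because \<open>k * (1 + real (Suc n) *\<^sub>R t)\<close> falls short of
    \<open>1 + real n *\<^sub>R t\<close> by a multiple of \<open>t * t\<close>.\<close>
  have decay: "norm (k ^ n * t) \<le> 1 / real n" if "0 < n" for n
  proof -
    have "pos (1 - k ^ n * (1 + real n *\<^sub>R t))" for n
    proof (induction n)
      case (Suc n)
      have "k * (1 + real (Suc n) *\<^sub>R t) = (1 + real n *\<^sub>R t) - real (Suc n) *\<^sub>R (t * t)"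
        by (simp add: k_def algebra_simps)
      then have "1 - k ^ Suc n * (1 + real (Suc n) *\<^sub>R t) =
          (1 - k ^ n * (1 + real n *\<^sub>R t)) + real (Suc n) *\<^sub>R (k ^ n * (t * t))"
        by (simp add: power_Suc2 mult.assoc right_diff_distrib del: of_nat_Suc power_Suc)
      moreover have "pos (real (Suc n) *\<^sub>R (k ^ n * (t * t)))"
        by (intro pos_scaleR pos_mult t kn) simp
      ultimately show ?case using pos_add[OF Suc] by metis
    qed (simp add: pos_zero)
    then have "pos ((1 - k ^ n * (1 + real n *\<^sub>R t)) + k ^ n)" by (rule pos_add) (rule kn)
    then have "pos (1 - real n *\<^sub>R (k ^ n * t))" by (simp add: algebra_simps)
    then have "norm (real n *\<^sub>R (k ^ n * t)) \<le> norm (1::'a)"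
      by (intro norm_mono pos_scaleR pos_mult kn t) auto
    then show ?thesis using that by (simp add: field_simps)
  qed
  obtain e where e: "\<And>z C. (\<And>\<epsilon>. 0 < \<epsilon> \<Longrightarrow> \<forall>\<^sub>F n in sequentially. norm (u n + z) \<le> C + \<epsilon>) \<Longrightarrow>
      norm (e + z) \<le> C"
    by (rule predual_sequence_limit[OF predual kn(4)]) (erule that)
  \<comment> \<open>The powers of \<open>k\<close> act as the identity on \<open>W\<close>, so every
    \<open>u n\<close> annihilates it. Adding an element of norm one of the form \<open>W\<close>
    times something then keeps the norm of \<open>u n\<close> at most one, and this passes to
    \<open>e\<close>.\<close>
  have kill: "e * w = 0" if w: "t * w = 0" for w
  proof -
    define W where "W = star w * w"
    have "k * W = W" using w by (simp add: k_def W_def algebra_simps left_commute[of t])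
    then have "k ^ n * W = W" for n by (induction n) (simp_all add: mult.assoc)
    then have uW: "u n * W = 0" for n by (simp add: u_def algebra_simps)
    have "W * e = 0"
    proof (rule annihilates_if_norm_le)
      show "pos W" by (simp add: W_def pos_star_mult)
      fix m assume m: "m = norm (W * e)" "0 < m"
      have "norm (u n + (1/m) *\<^sub>R (W * e)) \<le> 1" for n
      proof -
        have "u n * ((1/m) *\<^sub>R (W * e)) = 0"
          using uW[of n] by (simp add: mult.assoc[symmetric])
        then show ?thesis using norm_add_le_one_plus[OF kn(4)[of n], of "(1/m) *\<^sub>R (W * e)"] m by simp
      qed
      then show "norm (e + (1/m) *\<^sub>R (W * e)) \<le> 1"
        by (intro e always_eventually allI) (simp add: add_increasing2)
    qed
    then have "star (w * e) * (w * e) = 0" by (simp add: W_def star_mult mult.assoc)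
    then have "w * e = 0" using cstar_identity[of "w * e"] by simp
    then show ?thesis by (simp add: commute)
  qed
  \<comment> \<open>The elements to be bounded are now \<open>k ^ n + z\<close>, written with the
    opposite sign since the cluster property concerns \<open>u n\<close> plus a fixed vector. Their
    norms are at most one in the limit because \<open>decay\<close> makes \<open>k ^ n * z\<close>
    small.\<close>
  have keep: "t * (1 - e) = 0"
  proof (rule annihilates_if_norm_le[OF t(1)])
    fix m assume m: "m = norm (t * (1 - e))" "0 < m"
    define z where "z = (1/m) *\<^sub>R (t * (1 - e))"
    have z: "norm z \<le> 1" using m by (simp add: z_def)
    define B where "B = (1/m) * norm (1 - e)"
    have "norm (e + (- 1 - z)) \<le> 1"
    proof (rule e)
      fix \<epsilon> :: real assume \<epsilon>: "0 < \<epsilon>"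
      have bound: "norm (u n + (- 1 - z)) \<le> 1 + B / real n" if "0 < n" for n
      proof -
        have "k ^ n * z = (1/m) *\<^sub>R ((k ^ n * t) * (1 - e))" by (simp add: z_def mult.assoc)
        then have "norm (k ^ n * z) \<le> (1/m) * (norm (k ^ n * t) * norm (1 - e))"
          using m(2) norm_mult_ineq[of "k ^ n * t" "1 - e"] by (simp add: divide_right_mono)
        also have "\<dots> \<le> (1/m) * (1 / real n * norm (1 - e))"
          using decay[OF that] m(2) by (intro mult_left_mono mult_right_mono) auto
        also have "\<dots> = B / real n" by (simp add: B_def)
        finally have "norm (k ^ n + z) \<le> 1 + B / real n"
          using norm_add_le_one_plus[OF kn(1)[of n] z] by linarith
        moreover have "u n + (- 1 - z) = - (k ^ n + z)" by (simp add: u_def)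
        ultimately show ?thesis by (simp only: norm_minus_cancel)
      qed
      have "(\<lambda>n. B / real n) \<longlonglongrightarrow> 0" by (rule lim_const_over_n)
      then have "\<forall>\<^sub>F n in sequentially. B / real n < \<epsilon>" using \<epsilon> by (rule order_tendstoD)
      with eventually_gt_at_top[of "0::nat"]
      show "\<forall>\<^sub>F n in sequentially. norm (u n + (- 1 - z)) \<le> 1 + \<epsilon>"
      proof eventually_elim
        case (elim n)
        then show ?case using bound[of n] by linarith
      qed
    qed
    moreover have "e + (- 1 - z) = - ((1 - e) + z)" by simp
    ultimately have "norm ((1 - e) + z) \<le> 1" by (simp only: norm_minus_cancel)
    then show "norm (1 - e + (1/m) *\<^sub>R (t * (1 - e))) \<le> 1" by (simp add: z_def)
  qed
  have idem: "e * e = e" using kill[OF keep] by (simp add: algebra_simps)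
  \<comment> \<open>Self-adjointness comes from idempotence: commutativity collects the factor
    \<open>e * (1 - e)\<close> in the square of \<open>e * (1 - star e)\<close>, whence
    \<open>e = e * star e\<close>.\<close>
  have "star (e * (1 - star e)) * (e * (1 - star e)) = (star e * (1 - star e)) * (e * (1 - e))"
    by (simp add: star_mult star_diff star_star ac)
  also have "\<dots> = 0" using idem by (simp add: right_diff_distrib)
  finally have "e * (1 - star e) = 0" using cstar_identity[of "e * (1 - star e)"] by simp
  then have "e = e * star e" by (simp add: right_diff_distrib)
  then have "star e = e" by (metis star_mult star_star)
  then have "e \<in> projections" using idem by (simp add: projections_def)
  moreover have "t * e = t" using keep by (simp add: right_diff_distrib)
  ultimately show ?thesis using kill that by blast
qed

text \<open>Polar decomposition: \<open>a = s * b\<close> with \<open>b\<close> the absolute value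
  and \<open>s = 2e - 1\<close> a symmetry. Half of \<open>s\<close> misses \<open>a\<close> by
  \<open>s\<close> times \<open>b - 1/2\<close>, of norm at most 1/2 since \<open>b\<close> lies
  between 0 and 1.\<close>

lemma approximate_by_symmetry:
  assumes a: "star a = a" "norm (a :: 'a) \<le> 1"
  obtains e where "e \<in> projections" "norm (a - (e - (1/2) *\<^sub>R 1)) \<le> 1/2"
proof -
  have "star (1 - a * a) = 1 - a * a" by (simp add: star_diff star_mult a)
  from sqrt_exists[OF this norm_one_minus_square[OF a]]
  obtain y where y: "star y = y" "norm y \<le> 1" "(1 - y) * (1 - y) = 1 - (1 - a * a)" by blast
  define b where "b = 1 - y"
  have b: "pos b" "b * b = a * a" "star b = b"
    using y pos_one_minus[of y] by (simp_all add: b_def star_diff)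
  have "(norm b)\<^sup>2 = (norm a)\<^sup>2"
    using norm_square_selfadjoint[OF b(3)] norm_square_selfadjoint[OF a(1)] b(2) by simp
  then have b1: "norm b \<le> 1" using a(2) by (simp add: power2_eq_iff_nonneg)
  \<comment> \<open>The positive and the negative part of \<open>a\<close>; their product vanishes
    because \<open>b * b = a * a\<close>. The projection \<open>e\<close> will be the support of the
    former, and it annihilates the latter.\<close>
  define c d where "c = (1/2) *\<^sub>R (b + a)" and "d = (1/2) *\<^sub>R (b - a)"
  have half: "(1/2) *\<^sub>R x + (1/2) *\<^sub>R x = x" for x :: 'a
    by (simp flip: scaleR_left_distrib)
  have "(b + a) * (b - a) = 0" using b(2) by (simp add: algebra_simps commute[of a b])
  then have "c * d = 0"
    unfolding c_def d_def mult_scaleR_left mult_scaleR_right by simp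
  moreover have "c - d = a" "c + d = b"
    unfolding c_def d_def scaleR_right_distrib scaleR_right_diff_distrib
    using half[of a] half[of b] by (simp_all add: algebra_simps)
  moreover have "star c = c" by (simp add: c_def star_scaleR star_add a b(3))
  ultimately have cd: "star c = c" "c * d = 0" "c - d = a" "c + d = b" by simp_all
  have c1: "norm c \<le> 1"
    using norm_triangle_ineq[of b a] b1 a(2) by (simp add: c_def)
  have "norm (c * c) \<le> 1" using c1 by (simp add: norm_square_selfadjoint cd(1) power_le_one)
  then obtain e where e: "e \<in> projections" "c * c * e = c * c"
      "\<And>w. c * c * w = 0 \<Longrightarrow> e * w = 0"
    using support_projection[OF pos_square[OF cd(1)]] by metis
  have ep: "e * e = e" "star e = e" using e(1) by (auto simp: projections_def)
  have ed: "e * d = 0" by (rule e(3)) (simp add: mult.assoc cd(2))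
  have "star (c - c * e) * (c - c * e) = c * c - c * c * e - (c * c * e - c * c * (e * e))"
    by (simp add: star_diff star_mult cd(1) ep algebra_simps ac)
  then have "star (c - c * e) * (c - c * e) = 0" using e(2) by (simp add: ep)
  then have ce: "c * e = c" using cstar_identity[of "c - c * e"] by simp
  define s where "s = e + e - 1"
  have ss: "star s = s" "s * s = 1"
    by (simp_all add: s_def star_diff star_add ep algebra_simps)
  then have "(norm s)\<^sup>2 = 1" using norm_square_selfadjoint[of s] by simp
  then have s1: "norm s = 1" using norm_ge_zero[of s] by (auto simp: power2_eq_1_iff)
  have sb: "s * b = a"
    using ce ed unfolding s_def cd(4)[symmetric] cd(3)[symmetric]
    by (simp add: algebra_simps commute[of e c])
  have "norm (1 - 2 *\<^sub>R b) \<le> 1"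
  proof -
    have sa: "star (1 - 2 *\<^sub>R b) = 1 - 2 *\<^sub>R b" by (simp add: star_diff star_scaleR b)
    have "pos (4 *\<^sub>R (b * (1 - b)))"
      using b b1 by (intro pos_scaleR pos_mult pos_one_minus) auto
    moreover have "4 *\<^sub>R (b * (1 - b)) = 1 - (1 - 2 *\<^sub>R b) * (1 - 2 *\<^sub>R b)"
      by (simp add: algebra_simps flip: scaleR_left_distrib)
    ultimately have "norm ((1 - 2 *\<^sub>R b) * (1 - 2 *\<^sub>R b)) \<le> norm (1::'a)"
      by (intro norm_mono pos_square sa) simp
    then show ?thesis by (simp add: norm_square_selfadjoint[OF sa] power_le_one_iff abs_square_le_1)
  qed
  moreover have "a - (e - (1/2) *\<^sub>R 1) = (-(1/2)) *\<^sub>R (s * (1 - 2 *\<^sub>R b))"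
  proof -
    have "(1/2) *\<^sub>R s = e - (1/2) *\<^sub>R 1"
      using half[of e] unfolding s_def scaleR_right_distrib scaleR_right_diff_distrib by simp
    moreover have "s * (1 - 2 *\<^sub>R b) = s - 2 *\<^sub>R a"
      unfolding right_diff_distrib mult_scaleR_right sb by simp
    ultimately show ?thesis
      by (simp only: scaleR_minus_left scaleR_right_diff_distrib scaleR_scaleR) simp
  qed
  then have "norm (a - (e - (1/2) *\<^sub>R 1)) \<le> 1/2 * (norm s * norm (1 - 2 *\<^sub>R b))"
    using norm_mult_ineq[of s "1 - 2 *\<^sub>R b"] by simp
  ultimately have "norm (a - (e - (1/2) *\<^sub>R 1)) \<le> 1/2" using s1 by simp
  then show ?thesis using that e(1) by blast
qed

text \<open>A binary expansion: one approximation by a symmetry halves the error, and the remainder,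
  rescaled to the unit ball, is approximated again.\<close>

lemma closure_span_projections: "closure (complex_vector.span (projections :: 'a set)) = UNIV"
proof -
  let ?S = "complex_vector.span (projections :: 'a set)"
  have one: "1 \<in> (projections :: 'a set)" by (simp add: projections_def)
  have scaleR: "r *\<^sub>R x \<in> ?S" if "x \<in> ?S" for r x
    unfolding scaleR_scaleC using that by (rule complex_vector.span_scale)
  have approx: "\<exists>p\<in>?S. star p = p \<and> norm (a - p) \<le> (1/2) ^ n"
    if a: "star a = a" "norm a \<le> 1" for a n
  proof (induction n)
    case 0
    show ?case by (rule bexI[of _ 0]) (use a in \<open>auto simp: complex_vector.span_zero\<close>)
  next
    case (Suc n)
    then obtain p where p: "p \<in> ?S" "star p = p" "norm (a - p) \<le> (1/2) ^ n" by blast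
    define q where "q = (2 ^ n) *\<^sub>R (a - p)"
    have "star q = q" by (simp add: q_def star_scaleR star_diff a p)
    moreover have "norm q \<le> 1"
      using p(3) unfolding q_def norm_scaleR by (simp add: field_simps)
    ultimately obtain e where e: "e \<in> projections" "norm (q - (e - (1/2) *\<^sub>R 1)) \<le> 1/2"
      using approximate_by_symmetry by blast
    define r where "r = p + ((1/2) ^ n) *\<^sub>R (e - (1/2) *\<^sub>R 1)"
    have "r \<in> ?S"
      unfolding r_def
      using p(1) complex_vector.span_base[OF e(1)] complex_vector.span_base[OF one]
      by (intro complex_vector.span_add complex_vector.span_diff scaleR)
    moreover have "star r = r"
      using e(1) by (simp add: r_def star_add star_scaleR star_diff p(2) projections_def)
    moreover have "a - r = ((1/2) ^ n) *\<^sub>R (q - (e - (1/2) *\<^sub>R 1))"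
      by (simp add: r_def q_def scaleR_diff_right power_mult_distrib[symmetric])
    then have "norm (a - r) \<le> (1/2) ^ n * (1/2)"
      using e(2) by (simp add: mult_left_mono)
    ultimately show ?case by auto
  qed
  have sa: "a \<in> closure ?S" if a: "star a = a" for a
    unfolding closure_approachable
  proof (intro allI impI)
    fix e :: real assume e: "0 < e"
    define r where "r = norm a + 1"
    have r: "0 < r" by (simp add: r_def add_nonneg_pos)
    obtain n where n: "(1/2) ^ n < e / r"
      using real_arch_pow_inv[of "e / r" "1/2"] e r by auto
    have "star ((1/r) *\<^sub>R a) = (1/r) *\<^sub>R a" "norm ((1/r) *\<^sub>R a) \<le> 1"
      using r by (auto simp: star_scaleR a r_def)
    then obtain p where p: "p \<in> ?S" "norm ((1/r) *\<^sub>R a - p) \<le> (1/2) ^ n"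
      using approx by blast
    have "dist (r *\<^sub>R p) a = norm (r *\<^sub>R ((1/r) *\<^sub>R a - p))"
      using r by (simp add: dist_norm norm_minus_commute scaleR_diff_right)
    also have "\<dots> \<le> r * (1/2) ^ n" using p(2) r by simp
    also have "\<dots> < e" using n r by (simp add: field_simps)
    finally show "\<exists>y\<in>?S. dist y a < e" using scaleR[OF p(1)] by blast
  qed
  have add: "x + c *\<^sub>C y \<in> closure ?S" if xy: "x \<in> closure ?S" "y \<in> closure ?S" for x y c
  proof -
    obtain s t where st: "\<And>n. s n \<in> ?S" "s \<longlonglongrightarrow> x" "\<And>n. t n \<in> ?S" "t \<longlonglongrightarrow> y"
      using xy by (meson closure_sequential)
    have "bounded_linear ((*\<^sub>C) c :: 'a \<Rightarrow> 'a)"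
      by (rule bounded_linear_intro[where K="cmod c"])
        (simp_all add: scaleC_add_right scaleR_scaleC norm_scaleC mult.commute)
    then have "(\<lambda>n. s n + c *\<^sub>C t n) \<longlonglongrightarrow> x + c *\<^sub>C y"
      by (rule tendsto_add[OF st(2) bounded_linear.tendsto[OF _ st(4)]])
    moreover have "s n + c *\<^sub>C t n \<in> ?S" for n
      by (intro complex_vector.span_add complex_vector.span_scale st)
    ultimately show ?thesis
      unfolding closure_sequential by (intro exI[of _ "\<lambda>n. s n + c *\<^sub>C t n"]) simp
  qed
  have "x \<in> closure ?S" for x
  proof -
    obtain a b where ab: "star a = a" "star b = b" "x = a + \<i> *\<^sub>C b"
      by (rule real_imaginary_parts[of x])
    show ?thesis unfolding ab(3) by (rule add[OF sa[OF ab(1)] sa[OF ab(2)]])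
  qed
  then show ?thesis by blast
qed

lemma functional_zero_if_zero_on_projections:
  fixes f :: "'a \<Rightarrow> complex"
  assumes f: "f \<in> cdual" "\<And>e. e \<in> projections \<Longrightarrow> f e = 0"
  shows "f x = 0"
proof -
  have lin: "clinear f" and bl: "bounded_linear f" using f(1) by (simp_all add: cdual_def)
  have "f s = 0" if "s \<in> complex_vector.span projections" for s
    using that
    by (induction rule: complex_vector.span_induct_alt)
      (simp_all add: clinear_zero[OF lin] clinear_add[OF lin] clinear_scaleC[OF lin] f(2) scaleC_complex_def)
  moreover obtain s where s: "\<And>n. s n \<in> complex_vector.span projections" "s \<longlonglongrightarrow> x"
    using closure_span_projections by (metis UNIV_I closure_sequential)
  ultimately have "(\<lambda>_. 0) \<longlonglongrightarrow> f x"
    using bounded_linear.tendsto[OF bl s(2)] by simp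
  then show ?thesis by (simp add: LIMSEQ_const_iff)
qed

lemma projection_mult: "e \<in> projections \<Longrightarrow> f \<in> projections \<Longrightarrow> e * (f :: 'a) \<in> projections"
proof -
  assume "e \<in> projections" "f \<in> projections"
  then have e: "e * e = e" "star e = e" and f: "f * f = f" "star f = f"
    by (auto simp: projections_def)
  have "e * f * (e * f) = (e * e) * (f * f)" by (simp only: ac)
  moreover have "star (e * f) = e * f" by (simp add: star_mult e f commute)
  ultimately show ?thesis by (simp add: projections_def e f)
qed

text \<open>A form given by a matrix of functionals is positive as soon as it is positive on every
  projection. The induction runs over vectors \<open>w\<close> with entries in the span of the projections,
  simultaneously over all corners \<open>f\<close>: adding a multiple of \<open>e\<close> to \<open>w\<close> changes it by a constant
  on \<open>f e\<close> and not at all on \<open>f (1 - e)\<close>.\<close>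

lemma positive_form_if_positive_on_projections:
  fixes T :: "'k::finite \<Rightarrow> 'k \<Rightarrow> 'a \<Rightarrow> complex"
  assumes T: "\<And>l j. T l j \<in> cdual"
    and pos: "\<And>e c. e \<in> projections \<Longrightarrow> (\<Sum>l\<in>UNIV. \<Sum>j\<in>UNIV. cnj (c l) * c j * T l j e) \<in> \<real>\<^sub>\<ge>\<^sub>0"
  shows "(\<Sum>l\<in>UNIV. \<Sum>j\<in>UNIV. T l j (star (w l) * w j)) \<in> \<real>\<^sub>\<ge>\<^sub>0"
proof -
  define S where "S = (\<lambda>w. \<Sum>l\<in>UNIV. \<Sum>j\<in>UNIV. T l j (star (w l) * w j))"
  note Tl = clinear_add[OF cdual_clinear[OF T]] cdual_scaleC[OF T] clinear_zero[OF cdual_clinear[OF T]]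
  \<comment> \<open>Quantifying over all constant shifts \<open>c\<close> makes the induction work:
    adding a multiple of \<open>e\<close> is absorbed into the shift on the corner
    \<open>f * e\<close>.\<close>
  define \<T> where "\<T> = {w. \<forall>f\<in>projections. \<forall>c. S (\<lambda>l. f * (w l + c l *\<^sub>C 1)) \<in> \<real>\<^sub>\<ge>\<^sub>0}"
  have orth: "S (\<lambda>l. p * u l + q * v l) = S (\<lambda>l. p * u l) + S (\<lambda>l. q * v l)"
    if p: "star p = p" and q: "star q = q" and pq: "p * q = 0" for p q u v
  proof -
    have "star (u l) * (p * (q * v j)) = 0" "star (v l) * (q * (p * u j)) = 0" for l j
      using pq commute[of p q] by (simp_all flip: mult.assoc)
    then have "star (p * u l + q * v l) * (p * u j + q * v j)
        = star (p * u l) * (p * u j) + star (q * v l) * (q * v j)" for l j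
      by (simp add: star_add star_mult p q distrib_left distrib_right mult.assoc)
    then show ?thesis by (simp add: S_def Tl sum.distrib)
  qed
  have zero: "(\<lambda>_. 0) \<in> \<T>"
  proof -
    have "S (\<lambda>l. f * (0 + c l *\<^sub>C 1)) \<in> \<real>\<^sub>\<ge>\<^sub>0" if f: "f \<in> projections" for f c
    proof -
      have "star (f * (0 + c l *\<^sub>C 1)) * (f * (0 + c j *\<^sub>C 1)) = (cnj (c l) * c j) *\<^sub>C f" for l j
        using f by (simp add: projections_def star_mult star_scaleC mult_scaleC_left mult_scaleC_right mult.commute)
      then show ?thesis using pos[OF f, of c] by (simp add: S_def Tl)
    qed
    then show ?thesis by (simp add: \<T>_def)
  qed
  have step: "(\<lambda>l. w l + d l *\<^sub>C e) \<in> \<T>" if w: "w \<in> \<T>" and e: "e \<in> projections" for w d e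
    unfolding \<T>_def
  proof (intro CollectI ballI allI)
    fix f :: 'a and c assume f: "f \<in> projections"
    define p q where "p = f * e" and "q = f * (1 - e)"
    have pq: "p \<in> projections" "q \<in> projections"
      unfolding p_def q_def by (intro projection_mult projection_complement e f)+
    have ee: "e * e = e" using e by (simp add: projections_def)
    have "p * q = f * f * (e * (1 - e))" by (simp add: p_def q_def ac)
    then have 0: "p * q = 0" using ee by (simp add: right_diff_distrib)
    have "f * (w l + d l *\<^sub>C e + c l *\<^sub>C 1) = p * (w l + (c l + d l) *\<^sub>C 1) + q * (w l + c l *\<^sub>C 1)" for l
    proof -
      have "f = p + q" by (simp add: p_def q_def right_diff_distrib)
      moreover have "p * e = p" by (simp add: p_def mult.assoc ee)
      moreover have "q * e = 0" by (simp add: q_def mult.assoc left_diff_distrib ee)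
      ultimately show ?thesis
        by (simp add: distrib_left distrib_right mult_scaleC_right scaleC_add_left scaleC_add_right add_ac)
    qed
    then have "S (\<lambda>l. f * (w l + d l *\<^sub>C e + c l *\<^sub>C 1))
        = S (\<lambda>l. p * (w l + (c l + d l) *\<^sub>C 1)) + S (\<lambda>l. q * (w l + c l *\<^sub>C 1))"
      using orth[OF _ _ 0, of "\<lambda>l. w l + (c l + d l) *\<^sub>C 1" "\<lambda>l. w l + c l *\<^sub>C 1"] pq
      by (simp add: projections_def)
    moreover have "S (\<lambda>l. p * (w l + (c l + d l) *\<^sub>C 1)) \<in> \<real>\<^sub>\<ge>\<^sub>0"
      using w pq(1) unfolding \<T>_def by fast
    moreover have "S (\<lambda>l. q * (w l + c l *\<^sub>C 1)) \<in> \<real>\<^sub>\<ge>\<^sub>0" using w pq(2) unfolding \<T>_def by fast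
    ultimately show "S (\<lambda>l. f * (w l + d l *\<^sub>C e + c l *\<^sub>C 1)) \<in> \<real>\<^sub>\<ge>\<^sub>0"
      by (simp add: nonneg_Reals_add_I)
  qed
  have coord: "w(k := w k + s) \<in> \<T>" if w: "w \<in> \<T>" and s: "s \<in> complex_vector.span projections" for w k s
    using s w
  proof (induction arbitrary: w rule: complex_vector.span_induct_alt)
    case base
    then show ?case by simp
  next
    case (step c e s)
    define v where "v = (\<lambda>l. w l + (if l = k then c else 0) *\<^sub>C e)"
    have "v \<in> \<T>"
      unfolding v_def
      by (rule \<open>\<And>w d e. w \<in> \<T> \<Longrightarrow> e \<in> projections \<Longrightarrow> (\<lambda>l. w l + d l *\<^sub>C e) \<in> \<T>\<close>[OF step.prems step.hyps(1)])
    from step.IH[OF this] have "v(k := v k + s) \<in> \<T>" .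
    moreover have "v(k := v k + s) = w(k := w k + (c *\<^sub>C e + s))"
      by (rule ext) (simp add: v_def add.assoc)
    ultimately show ?case by (simp only:)
  qed
  have span: "w \<in> \<T>" if w: "\<And>l. w l \<in> complex_vector.span projections" for w
  proof -
    have "(\<lambda>l. if l \<in> L then w l else 0) \<in> \<T>" if "finite L" for L
      using that
    proof (induction L rule: finite_induct)
      case empty
      then show ?case using zero by simp
    next
      case (insert k L)
      from coord[OF insert.IH w[of k], of k] insert.hyps
      have "(\<lambda>l. if l \<in> L then w l else 0)(k := w k) \<in> \<T>" by simp
      moreover have "(\<lambda>l. if l \<in> L then w l else 0)(k := w k) = (\<lambda>l. if l \<in> insert k L then w l else 0)"
        by auto
      ultimately show ?case by simp
    qed
    from this[of UNIV] show ?thesis by simp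
  qed
  have "S v \<in> \<real>\<^sub>\<ge>\<^sub>0" if v: "\<And>l. v l \<in> complex_vector.span projections" for v
  proof -
    have "1 \<in> (projections :: 'a set)" by (simp add: projections_def)
    then have "S (\<lambda>l. 1 * (v l + (\<lambda>_. 0) l *\<^sub>C 1)) \<in> \<real>\<^sub>\<ge>\<^sub>0"
      using span[OF v] unfolding \<T>_def by fast
    then show ?thesis by simp
  qed
  moreover have "\<exists>s. (\<forall>n. s n \<in> complex_vector.span projections) \<and> s \<longlonglongrightarrow> w l" for l
    using closure_span_projections by (metis UNIV_I closure_sequential)
  then obtain s where s: "\<And>l n. s l n \<in> complex_vector.span projections" "\<And>l. s l \<longlonglongrightarrow> w l"
    by metis
  ultimately have "S (\<lambda>l. s l n) \<in> \<real>\<^sub>\<ge>\<^sub>0" for n by simp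
  moreover have "(\<lambda>n. S (\<lambda>l. s l n)) \<longlonglongrightarrow> S w"
    unfolding S_def
    by (intro tendsto_sum bounded_linear.tendsto[OF cdual_bounded[OF T]] tendsto_mult tendsto_star s)
  ultimately have "S w \<in> \<real>\<^sub>\<ge>\<^sub>0"
    by (rule closed_sequentially[OF closed_nonneg_Reals_complex])
  then show ?thesis by (simp add: S_def)
qed

end

section \<open>Hilbert spaces\<close>

lemma cinner_add_right: "cinner (x :: 'h::complex_hilbert_space) (y + z) = cinner x y + cinner x z"
  by (metis cinner_add_left cinner_commute complex_cnj_add)

lemma cinner_scaleC_right: "cinner (x :: 'h::complex_hilbert_space) (a *\<^sub>C y) = cnj a * cinner x y"
  by (metis cinner_commute cinner_scaleC_left complex_cnj_mult)

lemma cinner_zero [simp]: "cinner (0 :: 'h::complex_hilbert_space) x = 0" "cinner x (0 :: 'h) = 0"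
  using cinner_scaleC_left[of 0 x x] cinner_scaleC_right[of x 0 x] by simp_all

lemma cinner_minus:
  "cinner (- x) (y :: 'h::complex_hilbert_space) = - cinner x y" "cinner x (- y) = - cinner x y"
  using cinner_scaleC_left[of "- 1" x y] cinner_scaleC_right[of x "- 1" y] by simp_all

lemma cinner_diff:
  "cinner (x - y) (z :: 'h::complex_hilbert_space) = cinner x z - cinner y z"
  "cinner z (x - y) = cinner z x - cinner z y"
  using cinner_add_left[of x "- y" z] cinner_add_right[of z x "- y"] by (simp_all add: cinner_minus)

lemma cinner_self_Re: "Re (cinner x x) = (norm (x :: 'h::complex_hilbert_space))\<^sup>2"
  by (simp add: cinner_self)

lemma norm_add_orthogonal:
  fixes x y :: "'h::complex_hilbert_space"
  assumes "cinner x y = 0"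
  shows "(norm (x + y))\<^sup>2 = (norm x)\<^sup>2 + (norm y)\<^sup>2"
proof -
  have "cinner y x = 0" using cinner_commute[of y x] assms by simp
  then show ?thesis
    using assms by (simp add: cinner_self_Re[symmetric] cinner_add_left cinner_add_right)
qed

lemma parallelogram:
  fixes x y :: "'h::complex_hilbert_space"
  shows "(norm (x + y))\<^sup>2 + (norm (x - y))\<^sup>2 = 2 * (norm x)\<^sup>2 + 2 * (norm y)\<^sup>2"
  by (simp add: cinner_self_Re[symmetric] cinner_add_left cinner_add_right cinner_diff)

lemma cinner_norm_le:
  fixes x y :: "'h::complex_hilbert_space"
  shows "cmod (cinner x y) \<le> norm x * norm y"
proof (cases "y = 0")
  case False
  define c where "c = cinner x y"
  define n where "n = (norm y)\<^sup>2"
  have n: "0 < n" using False by (simp add: n_def)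
  define z where "z = x - (c / of_real n) *\<^sub>C y"
  have "cinner z ((c / of_real n) *\<^sub>C y) = 0"
    using n by (simp add: z_def cinner_diff cinner_scaleC_left cinner_scaleC_right cinner_self
        c_def[symmetric] n_def[symmetric])
  from norm_add_orthogonal[OF this]
  have "(norm x)\<^sup>2 = (norm z)\<^sup>2 + (cmod c / n)\<^sup>2 * n"
    by (simp add: z_def norm_scaleC norm_divide norm_power power_mult_distrib power_divide n_def)
  then have "(cmod c / n)\<^sup>2 * n \<le> (norm x)\<^sup>2" by simp
  then have "(cmod c)\<^sup>2 \<le> (norm x)\<^sup>2 * n"
    using n by (simp add: power_divide power2_eq_square field_simps)
  then have "(cmod c)\<^sup>2 \<le> (norm x * norm y)\<^sup>2" by (simp add: n_def power_mult_distrib)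
  then show ?thesis unfolding c_def by (rule power2_le_imp_le) simp
qed simp

lemma cinner_left_cdual: "(\<lambda>x. cinner x (y :: 'h::complex_hilbert_space)) \<in> cdual"
  unfolding cdual_def mem_Collect_eq clinear_iff
  by (intro conjI allI bounded_linear_intro[where K="norm y"])
    (simp_all add: cinner_add_left cinner_scaleC_left scaleC_complex_def scaleR_scaleC cinner_norm_le)

lemma tendsto_cinner_right:
  fixes x :: "'h::complex_hilbert_space"
  assumes "(f \<longlongrightarrow> l) G"
  shows "((\<lambda>n. cinner x (f n)) \<longlongrightarrow> cinner x l) G"
proof -
  have "bounded_linear (\<lambda>y. cinner y x)" by (rule cdual_bounded[OF cinner_left_cdual])
  then have "((\<lambda>n. cnj (cinner (f n) x)) \<longlongrightarrow> cnj (cinner l x)) G"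
    by (intro tendsto_cnj bounded_linear.tendsto[OF _ assms])
  then show ?thesis by (simp flip: cinner_commute)
qed

text \<open>Weak compactness of bounded closed convex sets, by minimising the norm.\<close>

lemma closed_convex_family_has_common_point:
  fixes K :: "'i \<Rightarrow> 'h::complex_hilbert_space set"
  assumes closed: "\<And>i. i \<in> I \<Longrightarrow> closed (K i)"
    and mid: "\<And>i x y. i \<in> I \<Longrightarrow> x \<in> K i \<Longrightarrow> y \<in> K i \<Longrightarrow> (1/2) *\<^sub>R (x + y) \<in> K i"
    and fip: "\<And>J. finite J \<Longrightarrow> J \<subseteq> I \<Longrightarrow> \<exists>x. norm x \<le> C \<and> (\<forall>i\<in>J. x \<in> K i)"
  obtains x where "\<And>i. i \<in> I \<Longrightarrow> x \<in> K i"
proof -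
  define \<J> where "\<J> = {J. finite J \<and> J \<subseteq> I}"
  define D where "D = (\<lambda>J. {x. \<forall>i\<in>J. x \<in> K i})"
  define d where "d = (\<lambda>J. Inf (norm ` D J))"
  define s where "s = Sup (d ` \<J>)"
  have bdd: "bdd_below (norm ` D J)" for J by (rule bdd_belowI[of _ 0]) auto
  have ne: "D J \<noteq> {}" if "J \<in> \<J>" for J
    using fip[of J] that by (auto simp: \<J>_def D_def)
  have low: "d J \<le> norm x" if "x \<in> D J" for J x
    unfolding d_def using that by (intro cInf_lower bdd) auto
  have d0: "0 \<le> d J" if "J \<in> \<J>" for J
    unfolding d_def using ne[OF that] by (intro cInf_greatest) auto
  have dC: "d J \<le> C" if J: "J \<in> \<J>" for J
  proof -
    obtain x where "norm x \<le> C" "x \<in> D J" using fip[of J] J by (auto simp: \<J>_def D_def)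
    then show ?thesis using low[of x J] by simp
  qed
  have empty: "{} \<in> \<J>" by (simp add: \<J>_def)
  have ds: "d J \<le> s" if "J \<in> \<J>" for J
    unfolding s_def using that dC by (intro cSup_upper bdd_aboveI[of _ C]) auto
  have s0: "0 \<le> s" using d0[OF empty] ds[OF empty] by simp
  have near: "\<exists>x\<in>D J. norm x \<le> s + e" if "J \<in> \<J>" "0 < e" for J e
  proof -
    have "Inf (norm ` D J) < s + e" using ds[OF that(1)] that(2) by (simp add: d_def)
    from cInf_lessD[OF _ this] show ?thesis using ne[OF that(1)] by force
  qed
  \<comment> \<open>The midpoint of \<open>x\<close> and \<open>y\<close> stays in
    \<open>D J\<close>, so the parallelogram law bounds the square by
    \<open>4 * ((s + \<delta>)\<^sup>2 - (d J)\<^sup>2)\<close>. Since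
    \<open>s - \<delta> \<le> d J \<le> s\<close>, its factors are at most
    \<open>2 * \<delta>\<close> and \<open>2 * (s + \<delta>)\<close>, which gives 16.\<close>
  have close: "(norm (x - y))\<^sup>2 \<le> 16 * \<delta> * (s + \<delta>)"
    if J: "J \<in> \<J>" "s - \<delta> \<le> d J" and xy: "x \<in> D J" "y \<in> D J" "norm x \<le> s + \<delta>" "norm y \<le> s + \<delta>"
      and \<delta>: "0 < \<delta>" for J x y \<delta>
  proof -
    have "(1/2) *\<^sub>R (x + y) \<in> D J"
      using xy(1,2) J(1) mid by (auto simp: D_def \<J>_def)
    then have "2 * d J \<le> norm (x + y)" using low by fastforce
    then have "(2 * d J)\<^sup>2 \<le> (norm (x + y))\<^sup>2" using d0[OF J(1)] by (intro power_mono) auto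
    moreover have "(norm x)\<^sup>2 \<le> (s + \<delta>)\<^sup>2" "(norm y)\<^sup>2 \<le> (s + \<delta>)\<^sup>2"
      using xy by (auto intro: power_mono)
    ultimately have "(norm (x - y))\<^sup>2 \<le> 4 * (s + \<delta>)\<^sup>2 - 4 * (d J)\<^sup>2"
      using parallelogram[of x y] by (simp add: power_mult_distrib)
    also have "\<dots> = 4 * ((s + \<delta> - d J) * (s + \<delta> + d J))"
      by (simp add: power2_eq_square algebra_simps)
    also have "\<dots> \<le> 4 * ((2 * \<delta>) * (2 * (s + \<delta>)))"
      using J(2) ds[OF J(1)] d0[OF J(1)] \<delta> s0 by (intro mult_left_mono mult_mono) auto
    finally show ?thesis by (simp add: algebra_simps)
  qed
  define \<delta> where "\<delta> = (\<lambda>n. 1 / real (Suc n))"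
  have \<delta>: "0 < \<delta> n" for n by (simp add: \<delta>_def)
  have \<delta>mono: "\<delta> m \<le> \<delta> n" if "n \<le> m" for m n using that by (simp add: \<delta>_def frac_le)
  have \<delta>lim: "(\<lambda>n. 16 * \<delta> n * (s + \<delta> n)) \<longlonglongrightarrow> 0"
  proof -
    have "\<delta> \<longlonglongrightarrow> 0" unfolding \<delta>_def by (rule LIMSEQ_Suc[OF lim_const_over_n])
    then have "(\<lambda>n. 16 * \<delta> n * (s + \<delta> n)) \<longlonglongrightarrow> 16 * 0 * (s + 0)"
      by (intro tendsto_mult tendsto_add tendsto_const)
    then show ?thesis by simp
  qed
  have "\<exists>J\<in>\<J>. s - \<delta> n \<le> d J" for n
  proof -
    have "s - \<delta> n < Sup (d ` \<J>)" using \<delta>[of n] by (simp add: s_def)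
    from less_cSupD[OF _ this] show ?thesis using empty by force
  qed
  then obtain J0 where J0: "\<And>n. J0 n \<in> \<J>" "\<And>n. s - \<delta> n \<le> d (J0 n)" by metis
  \<comment> \<open>Unions make the families increase, so later near-minimisers lie in all earlier
    intersections and can be compared there.\<close>
  define J where "J = (\<lambda>n. \<Union>k\<le>n. J0 k)"
  have J: "J n \<in> \<J>" for n using J0(1) by (auto simp: J_def \<J>_def)
  have Dmono: "D B \<subseteq> D A" if "A \<subseteq> B" for A B using that by (auto simp: D_def)
  have dmono: "d A \<le> d B" if "A \<subseteq> B" "B \<in> \<J>" for A B
    unfolding d_def using Dmono[OF that(1)] ne[OF that(2)] by (intro cInf_superset_mono bdd) auto
  have Jd: "s - \<delta> n \<le> d (J n)" for n
    using J0(2)[of n] dmono[OF _ J[of n], of "J0 n"] by (force simp: J_def)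
  have "\<exists>x. x \<in> D (J n) \<and> norm x \<le> s + \<delta> n" for n
    using near[OF J \<delta>, of n n] by blast
  then obtain x where x: "\<And>n. x n \<in> D (J n)" "\<And>n. norm (x n) \<le> s + \<delta> n" by metis
  have "Cauchy x"
  proof (rule CauchyI')
    fix e :: real assume e: "0 < e"
    then have "\<forall>\<^sub>F n in sequentially. 16 * \<delta> n * (s + \<delta> n) < e\<^sup>2"
      by (intro order_tendstoD(2)[OF \<delta>lim]) simp
    then obtain M where M: "\<And>n. n \<ge> M \<Longrightarrow> 16 * \<delta> n * (s + \<delta> n) < e\<^sup>2"
      by (auto simp: eventually_sequentially)
    have "dist (x m) (x n) < e" if "M \<le> m" "m < n" for m n
    proof -
      have "x n \<in> D (J m)" using x(1)[of n] Dmono[of "J m" "J n"] that by (force simp: J_def)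
      moreover have "norm (x n) \<le> s + \<delta> m" using x(2)[of n] \<delta>mono[of m n] that by simp
      ultimately have "(norm (x m - x n))\<^sup>2 \<le> 16 * \<delta> m * (s + \<delta> m)"
        by (intro close[OF J Jd] x \<delta>)
      also have "\<dots> < e\<^sup>2" by (rule M[OF that(1)])
      finally show ?thesis using e by (simp add: dist_norm power2_less_imp_less)
    qed
    then show "\<exists>M. \<forall>m\<ge>M. \<forall>n>m. dist (x m) (x n) < e" by blast
  qed
  then obtain y where y: "x \<longlonglongrightarrow> y" by (auto simp: Cauchy_convergent_iff convergent_def)
  have "y \<in> K i" if i: "i \<in> I" for i
  proof -
    \<comment> \<open>Near-minimisers for the families enlarged by \<open>i\<close> also lie in
      \<open>D (J n)\<close>; hence they are close to \<open>x n\<close> and converge to the same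
      \<open>y\<close>.\<close>
    have Ji: "insert i (J n) \<in> \<J>" for n using J[of n] i by (auto simp: \<J>_def)
    have "\<exists>x. x \<in> D (insert i (J n)) \<and> norm x \<le> s + \<delta> n" for n
      using near[OF Ji \<delta>, of n n] by blast
    then obtain z where z: "\<And>n. z n \<in> D (insert i (J n))" "\<And>n. norm (z n) \<le> s + \<delta> n"
      by metis
    have "(norm (z n - x n))\<^sup>2 \<le> 16 * \<delta> n * (s + \<delta> n)" for n
      using z(1)[of n] by (intro close[OF J Jd] x z \<delta>) (auto simp: D_def)
    then have "(\<lambda>n. (norm (z n - x n))\<^sup>2) \<longlonglongrightarrow> 0"
      by (intro tendsto_sandwich[OF _ _ tendsto_const \<delta>lim]) auto
    then have "(\<lambda>n. sqrt ((norm (z n - x n))\<^sup>2)) \<longlonglongrightarrow> sqrt 0" by (rule tendsto_real_sqrt)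
    then have "(\<lambda>n. z n - x n) \<longlonglongrightarrow> 0" by (simp add: tendsto_norm_zero_iff)
    from tendsto_add[OF this y] have "z \<longlonglongrightarrow> y" by simp
    moreover have "z n \<in> K i" for n using z(1)[of n] by (simp add: D_def)
    ultimately show ?thesis using closed[OF i] by (meson closed_sequentially)
  qed
  then show ?thesis by (rule that)
qed

section \<open>Two by two matrices over a commutative W*-algebra\<close>

text \<open>The Pythagorean hypothesis holds because \<open>e * x\<close> and
  \<open>(1 - e) * y\<close> have orthogonal ranges: the cross terms of the square drop out, and the
  triangle inequality bounds the rest.\<close>

lemma predual_comp_left_mult:
  fixes P :: "('a::cstar_algebra \<Rightarrow> complex) set"
  assumes P: "is_predual P" and e: "e \<in> projections" and f: "f \<in> P"
  shows "(\<lambda>x. f (e * x)) \<in> P"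
proof (rule predual_comp_idempotent[OF P _ _ _ _ _ f])
  have ep: "e * e = e" "star e = e" using e by (auto simp: projections_def)
  show "clinear (\<lambda>x. e * x)" by (simp add: clinear_iff distrib_left mult_scaleC_right)
  show "e * (e * x) = e * x" for x using ep by (simp flip: mult.assoc)
  have le: "norm (p * x) \<le> norm x" if "p \<in> projections" for p x :: 'a
    using norm_mult_ineq[of p x] mult_right_mono[OF norm_projection_le[OF that], of "norm x"] by simp
  show "norm (e * x) \<le> norm x" for x by (rule le[OF e])
  have D: "x - e * x = (1 - e) * x" for x by (simp add: left_diff_distrib)
  show "norm (x - e * x) \<le> norm x" for x
    unfolding D by (rule le[OF projection_complement[OF e]])
  show "(norm (e * x + (y - e * y)))\<^sup>2 \<le> (norm (e * x))\<^sup>2 + (norm (y - e * y))\<^sup>2" for x y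
  proof -
    have cross: "e * ((1 - e) * z) = 0" "(1 - e) * (e * z) = 0" for z
      using ep by (simp_all add: left_diff_distrib right_diff_distrib flip: mult.assoc)
    have "star (e * x) * ((1 - e) * y) = 0" "star ((1 - e) * y) * (e * x) = 0"
      by (simp_all add: star_mult star_diff star_star ep mult.assoc cross)
    then have "star (e * x + (1 - e) * y) * (e * x + (1 - e) * y)
        = star (e * x) * (e * x) + star ((1 - e) * y) * ((1 - e) * y)"
      by (simp add: star_add distrib_left distrib_right)
    then show ?thesis
      unfolding D using norm_triangle_ineq[of "star (e * x) * (e * x)" "star ((1 - e) * y) * ((1 - e) * y)"]
      by (simp add: cstar_identity[symmetric])
  qed
qed

lemma predual_comp_right_mult:
  fixes P :: "('a::cstar_algebra \<Rightarrow> complex) set"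
  assumes P: "is_predual P" and e: "e \<in> projections" and f: "f \<in> P"
  shows "(\<lambda>x. f (x * e)) \<in> P"
proof (rule predual_comp_idempotent[OF P _ _ _ _ _ f])
  have ep: "e * e = e" "star e = e" using e by (auto simp: projections_def)
  show "clinear (\<lambda>x. x * e)" by (simp add: clinear_iff distrib_right mult_scaleC_left)
  show "x * e * e = x * e" for x using ep by (simp add: mult.assoc)
  have le: "norm (x * p) \<le> norm x" if "p \<in> projections" for p x :: 'a
    using norm_mult_ineq[of x p] mult_left_mono[OF norm_projection_le[OF that], of "norm x"] by simp
  show "norm (x * e) \<le> norm x" for x by (rule le[OF e])
  have D: "x - x * e = x * (1 - e)" for x by (simp add: right_diff_distrib)
  show "norm (x - x * e) \<le> norm x" for x
    unfolding D by (rule le[OF projection_complement[OF e]])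
  show "(norm (x * e + (y - y * e)))\<^sup>2 \<le> (norm (x * e))\<^sup>2 + (norm (y - y * e))\<^sup>2" for x y
  proof -
    \<comment> \<open>For multiplication on the right the cross terms vanish in
      \<open>z * star z\<close> rather than in \<open>star z * z\<close>.\<close>
    have sq: "(norm z)\<^sup>2 = norm (z * star z)" for z :: 'a
      using cstar_identity[of "star z"] by (simp add: norm_star star_star)
    have cross: "e * ((1 - e) * z) = 0" "(1 - e) * (e * z) = 0" for z
      using ep by (simp_all add: left_diff_distrib right_diff_distrib flip: mult.assoc)
    have "(x * e) * star (y * (1 - e)) = 0" "(y * (1 - e)) * star (x * e) = 0"
      by (simp_all add: star_mult star_diff star_star ep mult.assoc cross)
    then have "(x * e + y * (1 - e)) * star (x * e + y * (1 - e))
        = (x * e) * star (x * e) + (y * (1 - e)) * star (y * (1 - e))"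
      by (simp add: star_add distrib_left distrib_right)
    then show ?thesis
      unfolding D sq
      using norm_triangle_ineq[of "(x * e) * star (x * e)" "(y * (1 - e)) * star (y * (1 - e))"]
      by simp
  qed
qed

section \<open>Matrix units, the central copy of the commutative algebra, and weak* continuity of
  taking entries\<close>

locale matrix_wstar = commutative_wstar P
  for P :: "('m::cstar_algebra \<Rightarrow> complex) set" +
  fixes Q :: "('n::cstar_algebra \<Rightarrow> complex) set" and \<Phi> :: "'m^2^2 \<Rightarrow> 'n"
  assumes predual_Q: "is_predual Q" and iso: "matrix_star_iso \<Phi>"
begin

definition U :: "2 \<Rightarrow> 2 \<Rightarrow> 'm \<Rightarrow> 'n" where
  "U i j a = \<Phi> (\<chi> k l. if k = i \<and> l = j then a else 0)"

definition coef :: "'n \<Rightarrow> 2 \<Rightarrow> 2 \<Rightarrow> 'm" where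
  "coef x i j = inv \<Phi> x $ i $ j"

lemma bij: "bij \<Phi>" and \<Phi>_clinear: "clinear \<Phi>" and \<Phi>_mult: "\<Phi> (A ** B) = \<Phi> A * \<Phi> B"
  and \<Phi>_star: "\<Phi> (matrix_star A) = star (\<Phi> A)"
  using iso by (auto simp: matrix_star_iso_def)

lemma U_add: "U i j (a + b) = U i j a + U i j b"
  unfolding U_def clinear_add[OF \<Phi>_clinear, symmetric]
  by (rule arg_cong[of _ _ \<Phi>]) (simp add: vec_eq_iff)

lemma U_scaleC: "U i j (c *\<^sub>C a) = c *\<^sub>C U i j a"
  unfolding U_def clinear_scaleC[OF \<Phi>_clinear, symmetric]
  by (rule arg_cong[of _ _ \<Phi>]) (simp add: vec_eq_iff scaleC_vec_def)

lemma U_clinear: "clinear (U i j)"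
  by (simp add: clinear_iff U_add U_scaleC)

lemma U_zero [simp]: "U i j 0 = 0"
  by (rule clinear_zero[OF U_clinear])

lemma U_mult: "U i j a * U k l b = (if j = k then U i l (a * b) else 0)"
proof -
  have "(\<chi> p q. if p = i \<and> q = j then a else 0) ** (\<chi> p q. if p = k \<and> q = l then b else 0)
      = (if j = k then \<chi> p q. if p = i \<and> q = l then a * b else 0 else 0)"
    by (simp add: vec_eq_iff matrix_matrix_mult_def if_distrib[of "\<lambda>x. x * _"] if_distrib[of "\<lambda>x. _ * x"]
        forall_2 sum_2 cong: if_cong) (use exhaust_2[of i] exhaust_2[of j] exhaust_2[of k] exhaust_2[of l] in auto)
  then show ?thesis
    unfolding U_def \<Phi>_mult[symmetric] by (simp add: clinear_zero[OF \<Phi>_clinear])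
qed

lemma U_star: "star (U i j a) = U j i (star a)"
  unfolding U_def \<Phi>_star[symmetric]
  by (rule arg_cong[of _ _ \<Phi>]) (auto simp: vec_eq_iff matrix_star_def)

lemma decompose: "x = (\<Sum>i\<in>UNIV. \<Sum>j\<in>UNIV. U i j (coef x i j))"
proof -
  have "x = \<Phi> (inv \<Phi> x)" using bij by (simp add: bij_is_surj surj_f_inv_f)
  also have "inv \<Phi> x = (\<Sum>i\<in>UNIV. \<Sum>j\<in>UNIV. \<chi> k l. if k = i \<and> l = j then coef x i j else 0)"
    by (simp add: vec_eq_iff forall_2 sum_2 coef_def)
  also have "\<Phi> \<dots> = (\<Sum>i\<in>UNIV. \<Sum>j\<in>UNIV. U i j (coef x i j))"
    by (simp add: U_def linear_sum[OF clinear_linear[OF \<Phi>_clinear]])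
  finally show ?thesis .
qed

lemma coef_mult: "coef (x * y) i j = (\<Sum>k\<in>UNIV. coef x i k * coef y k j)"
proof -
  have i: "\<Phi> (inv \<Phi> x) = x" for x using bij by (simp add: bij_is_surj surj_f_inv_f)
  have "\<Phi> (inv \<Phi> x ** inv \<Phi> y) = x * y" by (simp add: \<Phi>_mult i)
  then have "inv \<Phi> (x * y) = inv \<Phi> x ** inv \<Phi> y"
    using bij by (metis bij_is_inj inv_f_f)
  then show ?thesis by (simp add: coef_def matrix_matrix_mult_def)
qed

lemma coef_star: "coef (star x) i j = star (coef x j i)"
proof -
  have "\<Phi> (matrix_star (inv \<Phi> x)) = star x"
    using bij by (simp add: \<Phi>_star bij_is_surj surj_f_inv_f)
  then have "inv \<Phi> (star x) = matrix_star (inv \<Phi> x)"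
    using bij by (metis bij_is_inj inv_f_f)
  then show ?thesis by (simp add: coef_def matrix_star_def)
qed

definition \<iota> :: "'m \<Rightarrow> 'n" where "\<iota> a = U 1 1 a + U 2 2 a"

lemma two_distinct [simp]: "(1::2) \<noteq> 2" "(2::2) \<noteq> 1"
  by simp_all

lemma \<iota>_add: "\<iota> (a + b) = \<iota> a + \<iota> b"
  and \<iota>_scaleC: "\<iota> (c *\<^sub>C a) = c *\<^sub>C \<iota> a"
  and \<iota>_mult: "\<iota> (a * b) = \<iota> a * \<iota> b"
  and \<iota>_star: "\<iota> (star a) = star (\<iota> a)"
  by (simp_all add: \<iota>_def U_add U_scaleC U_mult U_star star_add scaleC_add_right distrib_left distrib_right)

lemma \<iota>_clinear: "clinear \<iota>"
  by (simp add: clinear_iff \<iota>_add \<iota>_scaleC)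

lemma \<iota>_U: "\<iota> a * U i j b = U i j (a * b)" "U i j b * \<iota> a = U i j (a * b)"
  using exhaust_2[of i] exhaust_2[of j]
  by (auto simp: \<iota>_def distrib_left distrib_right U_mult commute)

lemma \<iota>_central: "\<iota> a * x = x * \<iota> a"
  by (subst (1 2) decompose[of x]) (simp add: sum_2 distrib_left distrib_right \<iota>_U)

lemma \<iota>_one: "\<iota> 1 = 1"
proof -
  have "\<iota> 1 * x = x" for x
    by (subst (1 2) decompose[of x]) (simp add: sum_2 distrib_left \<iota>_U)
  from this[of 1] show ?thesis by simp
qed

text \<open>The isomorphism is only *-algebraic, so the estimate rests on algebra:
  \<open>1 - b * b = k * k\<close> is carried over by \<open>\<iota>\<close>, which exhibits the
  square of \<open>\<iota> b\<close> as one of two commuting squares with sum 1.\<close>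

lemma norm_\<iota>: "norm (\<iota> a) \<le> norm a"
proof -
  have sa: "norm (\<iota> a) \<le> norm a" if a: "star a = a" for a
  proof (cases "a = 0")
    case False
    define b where "b = (1 / norm a) *\<^sub>R a"
    have b: "star b = b" "norm b \<le> 1" using False by (simp_all add: b_def star_scaleR a)
    have "norm (b * b) \<le> 1" using b by (simp add: norm_square_selfadjoint power_le_one)
    with b(1) have "pos (1 - b * b)" by (intro pos_one_minus) (simp_all add: star_mult)
    then obtain k where k: "star k = k" "1 - b * b = k * k" by (auto simp: pos_def)
    then have "1 = b * b + k * k" by (simp add: algebra_simps)
    then have "1 = \<iota> b * \<iota> b + \<iota> k * \<iota> k"
      by (metis \<iota>_add \<iota>_mult \<iota>_one)
    then have "norm (\<iota> b * \<iota> b) \<le> 1"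
      using norm_square_le_sum_squares[of "\<iota> b" "\<iota> k"] b k \<iota>_central[of b "\<iota> k"]
      by (simp flip: \<iota>_star)
    then have "(norm (\<iota> b))\<^sup>2 \<le> 1\<^sup>2"
      using norm_square_selfadjoint[of "\<iota> b"] b(1) by (simp flip: \<iota>_star)
    then have "norm (\<iota> b) \<le> 1" by (rule power2_le_imp_le) simp
    moreover have "\<iota> b = (1 / norm a) *\<^sub>R \<iota> a"
      by (simp only: b_def scaleR_scaleC \<iota>_scaleC)
    ultimately show ?thesis using False by (simp add: field_simps)
  qed (simp add: clinear_zero[OF \<iota>_clinear])
  have "(norm (\<iota> a))\<^sup>2 = norm (\<iota> (star a * a))"
    by (simp add: \<iota>_mult \<iota>_star cstar_identity)
  also have "\<dots> \<le> norm (star a * a)" by (rule sa) (simp add: star_mult star_star)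
  also have "\<dots> = (norm a)\<^sup>2" by (rule cstar_identity)
  finally show ?thesis by (rule power2_le_imp_le) simp
qed

lemma cdual_comp_\<iota>:
  assumes f: "f \<in> cdual"
  shows "(\<lambda>a. f (\<iota> a * x)) \<in> cdual"
proof -
  have "bounded_linear (\<lambda>a. \<iota> a * x)"
  proof (rule bounded_linear_intro[where K="norm x"])
    show "\<iota> (a + b) * x = \<iota> a * x + \<iota> b * x" for a b by (simp add: \<iota>_add distrib_right)
    show "\<iota> (r *\<^sub>R a) * x = r *\<^sub>R (\<iota> a * x)" for r a
      by (simp add: scaleR_scaleC \<iota>_scaleC mult_scaleC_left)
    show "norm (\<iota> a * x) \<le> norm a * norm x" for a
      using norm_mult_ineq[of "\<iota> a" x] mult_right_mono[OF norm_\<iota>[of a], of "norm x"] by simp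
  qed
  then have "bounded_linear (\<lambda>a. f (\<iota> a * x))"
    by (rule bounded_linear_compose[OF cdual_bounded[OF f]])
  moreover have "clinear (\<lambda>a. f (\<iota> a * x))"
    using cdual_clinear[OF f]
    by (simp add: clinear_iff \<iota>_add \<iota>_scaleC distrib_right mult_scaleC_left)
  ultimately show ?thesis by (simp add: cdual_def)
qed

lemma cdual_comp_U: "f \<in> cdual \<Longrightarrow> (\<lambda>a. f (U i j a)) \<in> cdual"
  using cdual_comp_\<iota>[of f "U i j 1"] by (simp add: \<iota>_U)

lemma projection_U:
  assumes "e \<in> projections"
  shows "U i i e \<in> projections" "\<iota> e \<in> projections"
  using assms by (auto simp: projections_def U_mult U_star \<iota>_mult[symmetric] \<iota>_star[symmetric])

text \<open>The three equations say that the self-adjoint scalar matrix with diagonal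
  \<open>s\<close>, \<open>t\<close> and lower left entry \<open>z\<close> is idempotent with trace
  one.\<close>

lemma projection_rank_one:
  assumes e: "e \<in> projections" and st: "(complex_of_real s)\<^sup>2 + z * cnj z = of_real s" 
     "(complex_of_real t)\<^sup>2 + z * cnj z = of_real t" "s + t = 1"
  shows "U 1 1 (of_real s *\<^sub>C e) + U 2 2 (of_real t *\<^sub>C e) + U 1 2 (cnj z *\<^sub>C e) + U 2 1 (z *\<^sub>C e)
    \<in> projections"
proof -
  have ep: "e * e = e" "star e = e" using e by (auto simp: projections_def)
  let ?s = "complex_of_real s" and ?t = "complex_of_real t"
  have "t = 1 - s" using st(3) by simp
  then have t: "?t = 1 - ?s" by simp
  let ?p = "U 1 1 (?s *\<^sub>C e) + U 2 2 (?t *\<^sub>C e) + U 1 2 (cnj z *\<^sub>C e) + U 2 1 (z *\<^sub>C e)"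
  have "star ?p = ?p" by (simp add: star_add U_star star_scaleC ep)
  moreover have "?p * ?p = U 1 1 ((?s\<^sup>2 + z * cnj z) *\<^sub>C e) + U 2 2 ((?t\<^sup>2 + z * cnj z) *\<^sub>C e)
      + U 1 2 (((?s + ?t) * cnj z) *\<^sub>C e) + U 2 1 (((?s + ?t) * z) *\<^sub>C e)"
    by (simp add: distrib_left distrib_right U_mult mult_scaleC_left mult_scaleC_right ep
        scaleC_add_left scaleC_add_right scaleC_scaleC U_add U_scaleC power2_eq_square mult.commute add_ac)
  moreover have "\<dots> = ?p" unfolding st using st(3) by (simp add: t)
  ultimately show ?thesis by (simp add: projections_def)
qed

text \<open>Diagonal units with a projection as coefficient are projections. For the off-diagonal
  ones, the rank one projections with \<open>z = 1/2\<close> and \<open>z = \<i>/2\<close> yield the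
  sum and the difference of the two values. Density of projections in the entries does the
  rest.\<close>

lemma U_zero_if_zero_on_projections:
  assumes f: "f \<in> cdual" "\<And>p. p \<in> projections \<Longrightarrow> f p = 0"
  shows "f (x :: 'n) = 0"
proof -
  note lin = cdual_clinear[OF f(1)]
  have "f (U i j a) = 0" for i j a
  proof (rule functional_zero_if_zero_on_projections[OF cdual_comp_U[OF f(1)]])
    fix e :: 'm assume e: "e \<in> projections"
    have dg: "f (U i i e) = 0" for i by (rule f(2)[OF projection_U(1)[OF e]])
    have off: "cnj z * f (U 1 2 e) + z * f (U 2 1 e) = 0" if "z * cnj z = 1/4" for z
    proof -
      have "U 1 1 (of_real (1/2) *\<^sub>C e) + U 2 2 (of_real (1/2) *\<^sub>C e) + U 1 2 (cnj z *\<^sub>C e) + U 2 1 (z *\<^sub>C e)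
        \<in> projections"
        by (intro projection_rank_one[OF e]) (simp_all add: power2_eq_square that)
      from f(2)[OF this] show ?thesis
        by (simp add: clinear_add[OF lin] U_scaleC cdual_scaleC[OF f(1)] dg)
    qed
    have "f (U 1 2 e) + f (U 2 1 e) = 0" using off[of "1/2"] by (simp add: field_simps)
    moreover have "- f (U 1 2 e) + f (U 2 1 e) = 0"
    proof -
      have "\<i>/2 * (- f (U 1 2 e) + f (U 2 1 e)) = 0" using off[of "\<i>/2"] by (simp add: algebra_simps)
      then show ?thesis by simp
    qed
    ultimately have "f (U 1 2 e) = 0" "f (U 2 1 e) = 0" by (simp_all add: add_eq_0_iff)
    with dg show "f (U i j e) = 0" using exhaust_2[of i] exhaust_2[of j] by auto
  qed
  then show ?thesis
    by (subst decompose[of x]) (simp add: sum_2 clinear_add[OF lin])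
qed

text \<open>Reduces weak* continuity of multiplication by the flip, and thus by off-diagonal matrix
  units, to that of multiplication by a projection.\<close>

lemma flip_eq_projection:
  obtains p where "p \<in> projections" "U 1 2 1 + U 2 1 1 = 2 *\<^sub>C p - 1"
proof
  let ?p = "U 1 1 (of_real (1/2) *\<^sub>C 1) + U 2 2 (of_real (1/2) *\<^sub>C 1)
      + U 1 2 (cnj (1/2) *\<^sub>C 1) + U 2 1 ((1/2) *\<^sub>C 1)"
  have one: "(1::'m) \<in> projections" by (simp add: projections_def)
  show "?p \<in> projections"
    by (rule projection_rank_one[OF one]) (simp_all add: power2_eq_square)
  show "U 1 2 1 + U 2 1 1 = 2 *\<^sub>C ?p - 1"
    by (simp add: scaleC_add_right U_scaleC) (simp add: \<iota>_one[symmetric] \<iota>_def)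
qed

lemma predual_comp_U_left:
  assumes f: "f \<in> Q"
  shows "(\<lambda>x. f (U i j 1 * x)) \<in> Q"
proof -
  have one: "(1::'m) \<in> projections" by (simp add: projections_def)
  note lin = cdual_clinear[OF predual_cdual[OF predual_Q]]
  obtain p where p: "p \<in> projections" and ps: "U 1 2 1 + U 2 1 1 = 2 *\<^sub>C p - 1"
    by (rule flip_eq_projection)
  define s where "s = U 1 2 1 + U 2 1 1"
  have "(\<lambda>x. 2 * f (p * x) + (- 1) * f x) \<in> Q"
    by (intro predual_add[OF predual_Q] predual_scale[OF predual_Q] f
        predual_comp_left_mult[OF predual_Q p])
  moreover have "(\<lambda>x. 2 * f (p * x) + (- 1) * f x) = (\<lambda>x. f (s * x))"
    by (simp add: s_def ps left_diff_distrib mult_scaleC_left clinear_diff[OF lin[OF f]]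
        cdual_scaleC[OF predual_cdual[OF predual_Q f]])
  ultimately have fs: "(\<lambda>x. f (s * x)) \<in> Q" by simp
  show ?thesis
  proof (cases "i = j")
    case True
    then show ?thesis using predual_comp_left_mult[OF predual_Q projection_U(1)[OF one] f] by simp
  next
    case False
    have "s * U j j 1 = U i j 1"
      using False exhaust_2[of i] exhaust_2[of j] by (auto simp: s_def distrib_right U_mult)
    moreover have "(\<lambda>x. f (s * (U j j 1 * x))) \<in> Q"
      by (rule predual_comp_left_mult[OF predual_Q projection_U(1)[OF one] fs])
    ultimately show ?thesis by (simp flip: mult.assoc)
  qed
qed

lemma predual_comp_U_right:
  assumes f: "f \<in> Q"
  shows "(\<lambda>x. f (x * U i j 1)) \<in> Q"
proof -
  have one: "(1::'m) \<in> projections" by (simp add: projections_def)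
  note lin = cdual_clinear[OF predual_cdual[OF predual_Q]]
  obtain p where p: "p \<in> projections" and ps: "U 1 2 1 + U 2 1 1 = 2 *\<^sub>C p - 1"
    by (rule flip_eq_projection)
  define s where "s = U 1 2 1 + U 2 1 1"
  have "(\<lambda>x. 2 * f (x * p) + (- 1) * f x) \<in> Q"
    by (intro predual_add[OF predual_Q] predual_scale[OF predual_Q] f
        predual_comp_right_mult[OF predual_Q p])
  moreover have "(\<lambda>x. 2 * f (x * p) + (- 1) * f x) = (\<lambda>x. f (x * s))"
    by (simp add: s_def ps right_diff_distrib mult_scaleC_right clinear_diff[OF lin[OF f]]
        cdual_scaleC[OF predual_cdual[OF predual_Q f]])
  ultimately have fs: "(\<lambda>x. f (x * s)) \<in> Q" by simp
  show ?thesis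
  proof (cases "i = j")
    case True
    then show ?thesis using predual_comp_right_mult[OF predual_Q projection_U(1)[OF one] f] by simp
  next
    case False
    have "U i i 1 * s = U i j 1"
      using False exhaust_2[of i] exhaust_2[of j] by (auto simp: s_def distrib_left U_mult)
    moreover have "(\<lambda>x. f (x * U i i 1 * s)) \<in> Q"
      by (rule predual_comp_right_mult[OF predual_Q projection_U(1)[OF one] fs])
    ultimately show ?thesis by (simp add: mult.assoc)
  qed
qed

lemma predual_comp_coef:
  assumes f: "f \<in> Q"
  shows "(\<lambda>x. f (U i j (coef x k l))) \<in> Q"
proof -
  \<comment> \<open>Multiplying by matrix units on both sides moves the entry at \<open>k\<close>,
    \<open>l\<close> to the position \<open>i\<close>, \<open>j\<close>.\<close>
  have "U i k 1 * x * U l j 1 = U i j (coef x k l)" for x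
    using exhaust_2[of k] exhaust_2[of l]
    by (subst decompose[of x]) (auto simp: sum_2 distrib_left distrib_right U_mult)
  moreover have "(\<lambda>x. f (U i k 1 * x * U l j 1)) \<in> Q"
    by (rule predual_comp_U_left[OF predual_comp_U_right[OF f]])
  ultimately show ?thesis by simp
qed

end

section \<open>Orthogonal vector fields\<close>

text \<open>The vectors are the values of \<open>F\<close> at \<open>e\<close> times the matrix
  units 11, 22, 12, 21. Up to the factor 25, the hypothesis concerns a rank one projection and its
  complement; the weights 16/25 and 9/25 come from the triangle 3, 4, 5, so that their geometric
  mean 12/25 is rational and they are unequal. Replacing \<open>z\<close> by \<open>- z\<close>
  separates even from odd terms, and varying \<open>z\<close> on the circle separates the
  coefficients.\<close>

lemma orthogonality_identities:
  fixes a b c d :: "'h::complex_hilbert_space"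
  assumes ab: "cinner a b = 0"
    and orth: "\<And>z. z * cnj z = 1 \<Longrightarrow>
      cinner (16 *\<^sub>C a + 9 *\<^sub>C b + 12 *\<^sub>C (cnj z *\<^sub>C c + z *\<^sub>C d))
        (9 *\<^sub>C a + 16 *\<^sub>C b - 12 *\<^sub>C (cnj z *\<^sub>C c + z *\<^sub>C d)) = 0"
  shows "cinner c d = 0" "cinner a a + cinner b b = cinner c c + cinner d d"
    "cinner d b = cinner a c" "cinner c b = cinner a d"
proof -
  define g where "g = (\<lambda>z. cnj z *\<^sub>C c + z *\<^sub>C d)"
  define N where "N = cinner a a + cinner b b"
  have ba: "cinner b a = 0" using cinner_commute[of b a] ab by simp
  have expand: "cinner (16 *\<^sub>C a + 9 *\<^sub>C b + 12 *\<^sub>C v) (9 *\<^sub>C a + 16 *\<^sub>C b - 12 *\<^sub>C v)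
    = 144 * (N - cinner v v) + 12 * (16 * (cinner v b - cinner a v) + 9 * (cinner v a - cinner b v))" for v
    by (simp add: cinner_add_left cinner_add_right cinner_diff cinner_scaleC_left cinner_scaleC_right
        ab ba N_def algebra_simps)
  have E: "144 * (N - cinner (g z) (g z)) + 12 * (16 * (cinner (g z) b - cinner a (g z))
      + 9 * (cinner (g z) a - cinner b (g z))) = 0" if "z * cnj z = 1" for z
    using orth[OF that] expand[of "g z"] by (simp only: g_def)
  have gm: "g (- z) = - g z" for z by (simp add: g_def)
  have even: "cinner (g z) (g z) = N"
    and odd: "16 * (cinner (g z) b - cinner a (g z)) + 9 * (cinner (g z) a - cinner b (g z)) = 0"
    if z: "z * cnj z = 1" for z
  proof -
    have 1: "144 * (N - cinner (g z) (g z)) - 12 * (16 * (cinner (g z) b - cinner a (g z))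
      + 9 * (cinner (g z) a - cinner b (g z))) = 0"
      using E[of "- z"] z by (simp add: gm cinner_minus algebra_simps)
    have *: "x = 0 \<and> y = 0" if "144 * x + 12 * y = 0" "144 * x - 12 * y = 0" for x y :: complex
    proof -
      have "288 * x = (144 * x + 12 * y) + (144 * x - 12 * y)" by simp
      then have "x = 0" using that by simp
      then show ?thesis using that by simp
    qed
    from *[OF E[OF z] 1] show "cinner (g z) (g z) = N"
      "16 * (cinner (g z) b - cinner a (g z)) + 9 * (cinner (g z) a - cinner b (g z)) = 0"
      by simp_all
  qed
  have gg: "cinner (g z) (g z) = (z * cnj z) * (cinner c c + cinner d d)
      + (cnj z)\<^sup>2 * cinner c d + z\<^sup>2 * cinner d c" for z
    by (simp add: g_def cinner_add_left cinner_add_right cinner_scaleC_left cinner_scaleC_right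
        power2_eq_square algebra_simps)
  have 1: "cinner c c + cinner d d + cinner c d + cinner d c = N"
    using even[of 1] gg[of 1] by simp
  have 2: "cinner c c + cinner d d - cinner c d - cinner d c = N"
    using even[of \<i>] gg[of \<i>] by simp
  have "2 * (cinner c c + cinner d d) = 2 * N" using arg_cong2[OF 1 2, of "(+)"] by (simp add: algebra_simps)
  then have "cinner c c + cinner d d = N" by (simp only: mult_cancel_left) simp
  then show N: "cinner a a + cinner b b = cinner c c + cinner d d" by (simp add: N_def)
  then have dc: "cinner d c = - cinner c d" using 1 by (simp add: N_def add_eq_0_iff)
  \<comment> \<open>The points 1 and \<open>\<i>\<close> have real squares and leave
    \<open>cinner c d\<close> undetermined; this point of the circle has a non-real square.\<close>
  define z where "z = Complex (3/5) (4/5)"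
  have z1: "z * cnj z = 1" by (simp add: z_def complex_eq_iff)
  have "((cnj z)\<^sup>2 - z\<^sup>2) * cinner c d = 0"
    using even[OF z1] gg[of z] unfolding z1 by (simp add: dc N_def N algebra_simps)
  moreover have "(cnj z)\<^sup>2 - z\<^sup>2 \<noteq> 0" by (simp add: z_def complex_eq_iff power2_eq_square)
  ultimately show "cinner c d = 0" by simp
  have sym: "cinner (g z) b = cinner a (g z)" if z: "z * cnj z = 1" for z
  proof -
    define X where "X = cinner (g z) b - cinner a (g z)"
    have "cinner (g z) a - cinner b (g z) = - cnj X"
      using cinner_commute[of "g z" a] cinner_commute[of b "g z"] by (simp add: X_def)
    \<comment> \<open>Here the unequal weights matter: comparing moduli gives \<open>X = 0\<close>,
      whereas equal weights would only make \<open>X\<close> real.\<close>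
    then have "16 * X = 9 * cnj X" using odd[OF z] by (simp add: X_def[symmetric])
    then have "16 * cmod X = 9 * cmod X"
      by (metis complex_mod_cnj norm_mult norm_numeral)
    then show ?thesis by (simp add: X_def)
  qed
  have 3: "cinner c b + cinner d b = cinner a c + cinner a d"
    using sym[of 1] by (simp add: g_def cinner_add_left cinner_add_right)
  have "\<i> * (- cinner c b + cinner d b) = \<i> * (cinner a c - cinner a d)"
    using sym[of \<i>]
    by (simp add: g_def cinner_add_left cinner_add_right cinner_scaleC_left cinner_scaleC_right
        cinner_minus cinner_diff algebra_simps)
  then have 4: "- cinner c b + cinner d b = cinner a c - cinner a d" by simp
  have "2 * cinner d b = 2 * cinner a c" "2 * cinner c b = 2 * cinner a d"
    using 3 4 by (simp_all add: algebra_simps complex_eq_iff)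
  then show "cinner d b = cinner a c" "cinner c b = cinner a d" by simp_all
qed

section \<open>Locality over the centre and the shape of the form\<close>

locale matrix_ovf = matrix_wstar P Q \<Phi>
  for P :: "('m::cstar_algebra \<Rightarrow> complex) set"
    and Q :: "('n::cstar_algebra \<Rightarrow> complex) set" and \<Phi> :: "'m^2^2 \<Rightarrow> 'n" +
  fixes F :: "'n \<Rightarrow> 'h::complex_hilbert_space"
  assumes ovf: "wstar_continuous_ovf Q F"
begin

lemma F_clinear: "clinear F"
  and F_orthogonal: "p \<in> projections \<Longrightarrow> q \<in> projections \<Longrightarrow> p * q = 0 \<Longrightarrow> cinner (F p) (F q) = 0"
  using ovf by (auto simp: wstar_continuous_ovf_def)

lemmas F_simps = clinear_add[OF F_clinear] clinear_scaleC[OF F_clinear] clinear_zero[OF F_clinear]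
  clinear_diff[OF F_clinear]

lemma cinner_F_in_Q: "(\<lambda>x. cinner (F x) v) \<in> Q"
proof (rule continuous_clinear_in_predual[OF predual_Q])
  show "clinear (\<lambda>x. cinner (F x) v)"
    unfolding clinear_iff by (simp add: F_simps cinner_add_left cinner_scaleC_left scaleC_complex_def)
  have "continuous_map (initial_topology Q) weak_topology F"
    using ovf by (simp add: wstar_continuous_ovf_def wstar_topology_def)
  moreover have "continuous_map weak_topology euclidean (\<lambda>x :: 'h. cinner x v)"
    unfolding weak_topology_def by (rule in_predual_continuous[OF cinner_left_cdual])
  ultimately have "continuous_map (initial_topology Q) euclidean ((\<lambda>x. cinner x v) \<circ> F)"
    by (rule continuous_map_compose)
  then show "continuous_map (initial_topology Q) euclidean (\<lambda>x. cinner (F x) v)"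
    by (simp add: o_def)
qed

lemma cinner_F_cdual: "(\<lambda>x. cinner (F x) v) \<in> cdual"
  by (rule predual_cdual[OF predual_Q cinner_F_in_Q])

lemma projection_mult_\<iota>:
  assumes "e \<in> projections" "p \<in> projections"
  shows "\<iota> e * p \<in> projections"
proof -
  have e: "\<iota> e * \<iota> e = \<iota> e" "star (\<iota> e) = \<iota> e"
    using projection_U(2)[OF assms(1)] by (auto simp: projections_def)
  have p: "p * p = p" "star p = p" using assms(2) by (auto simp: projections_def)
  have "\<iota> e * p * (\<iota> e * p) = (\<iota> e * \<iota> e) * (p * p)"
    by (metis \<iota>_central mult.assoc)
  moreover have "star (\<iota> e * p) = \<iota> e * p" using \<iota>_central[of e p] by (simp add: star_mult e p)
  ultimately show ?thesis using e p by (simp add: projections_def)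
qed

text \<open>Orthogonality is known for projections and is extended to one variable at a time, each
  partial functional being bounded and zero on projections. Conjugation brings the second variable
  into the linear slot.\<close>

lemma F_\<iota>_orthogonal:
  assumes e: "e \<in> projections"
  shows "cinner (F (\<iota> e * x)) (F (\<iota> (1 - e) * y)) = 0"
proof -
  have half: "cinner (F (\<iota> e * x)) (F (\<iota> (1 - e) * q)) = 0"
    if e: "e \<in> projections" and q: "q \<in> projections" for e q x
  proof (rule U_zero_if_zero_on_projections[where f="\<lambda>x. cinner (F (\<iota> e * x)) (F (\<iota> (1 - e) * q))"])
    show "(\<lambda>x. cinner (F (\<iota> e * x)) (F (\<iota> (1 - e) * q))) \<in> cdual"
      by (rule predual_cdual[OF predual_Q predual_comp_left_mult[OF predual_Q projection_U(2)[OF e] cinner_F_in_Q]])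
    fix p :: 'n assume p: "p \<in> projections"
    have "e * (1 - e) = 0" using e by (simp add: projections_def algebra_simps)
    then have "\<iota> e * p * (\<iota> (1 - e) * q) = 0"
      by (metis \<iota>_central \<iota>_mult mult.assoc mult_zero_left clinear_zero[OF \<iota>_clinear])
    then show "cinner (F (\<iota> e * p)) (F (\<iota> (1 - e) * q)) = 0"
      by (intro F_orthogonal projection_mult_\<iota> projection_complement e p q)
  qed
  have "cinner (F (\<iota> (1 - e) * y)) (F (\<iota> e * x)) = 0"
  proof (rule U_zero_if_zero_on_projections[where f="\<lambda>y. cinner (F (\<iota> (1 - e) * y)) (F (\<iota> e * x))"])
    show "(\<lambda>y. cinner (F (\<iota> (1 - e) * y)) (F (\<iota> e * x))) \<in> cdual"
      by (rule predual_cdual[OF predual_Q predual_comp_left_mult[OF predual_Q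
              projection_U(2)[OF projection_complement[OF e]] cinner_F_in_Q]])
    fix q :: 'n assume "q \<in> projections"
    from half[OF e this, of x] show "cinner (F (\<iota> (1 - e) * q)) (F (\<iota> e * x)) = 0"
      using cinner_commute[of "F (\<iota> (1 - e) * q)"] by simp
  qed
  then show ?thesis using cinner_commute[of "F (\<iota> e * x)"] by simp
qed

lemma F_module: "cinner (F (\<iota> a * x)) (F y) = cinner (F x) (F (\<iota> (star a) * y))"
proof -
  \<comment> \<open>The antilinearity of \<open>star\<close> and that of \<open>cnj\<close> cancel
    in the second term, so that \<open>h\<close> is complex linear.\<close>
  define h where "h = (\<lambda>a. cinner (F (\<iota> a * x)) (F y) - cnj (cinner (F (\<iota> (star a) * y)) (F x)))"
  have "bounded_linear (star :: 'm \<Rightarrow> 'm)"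
    by (rule bounded_linear_intro[where K=1]) (simp_all add: star_add star_scaleR norm_star)
  from bounded_linear_compose[OF cdual_bounded[OF cdual_comp_\<iota>[OF cinner_F_cdual]] this]
  have "bounded_linear h"
    unfolding h_def
    by (intro bounded_linear_sub cdual_bounded[OF cdual_comp_\<iota>[OF cinner_F_cdual]]
        bounded_linear_compose[OF bounded_linear_cnj])
  moreover have "clinear h"
    unfolding clinear_iff h_def
    by (simp add: star_add star_scaleC \<iota>_add \<iota>_scaleC distrib_right mult_scaleC_left F_simps
        cinner_add_left cinner_scaleC_left scaleC_complex_def right_diff_distrib)
  ultimately have "h \<in> cdual" by (simp add: cdual_def)
  moreover have "h e = 0" if e: "e \<in> projections" for e
  proof -
    have se: "star e = e" using e by (simp add: projections_def)
    have split: "y = \<iota> e * y + \<iota> (1 - e) * y" for y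
      by (simp add: \<iota>_one flip: distrib_right \<iota>_add)
    have F_split: "F y = F (\<iota> e * y) + F (\<iota> (1 - e) * y)" for y
      by (simp only: F_simps(1)[symmetric] split[symmetric])
    have "cinner (F (\<iota> e * x)) (F y) = cinner (F (\<iota> e * x)) (F (\<iota> e * y))"
      unfolding F_split[of y] by (simp add: cinner_add_right F_\<iota>_orthogonal[OF e])
    also have "\<dots> = cinner (F x) (F (\<iota> e * y))"
      using F_\<iota>_orthogonal[OF projection_complement[OF e], of x y]
      unfolding F_split[of x] by (simp add: cinner_add_left)
    finally show ?thesis
      using cinner_commute[of "F x" "F (\<iota> e * y)"] by (simp add: h_def se)
  qed
  ultimately have "h a = 0" by (rule functional_zero_if_zero_on_projections)
  then show ?thesis using cinner_commute[of "F x" "F (\<iota> (star a) * y)"] by (simp add: h_def)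
qed

definition \<omega> :: "2 \<Rightarrow> 2 \<Rightarrow> 2 \<Rightarrow> 2 \<Rightarrow> 'm \<Rightarrow> complex" where
  "\<omega> i j k l a = cinner (F (U i j a)) (F (U k l 1))"

lemma \<omega>_cdual: "\<omega> i j k l \<in> cdual"
proof -
  have "(\<lambda>a. cinner (F (U i j a)) (F (U k l 1))) \<in> cdual"
    by (rule cdual_comp_U[OF cinner_F_cdual])
  then show ?thesis by (simp add: \<omega>_def[abs_def])
qed

lemma cinner_F_U: "cinner (F (U i j a)) (F (U k l b)) = \<omega> i j k l (star b * a)"
  using F_module[of "star b" "U i j a" "U k l 1"]
  by (simp add: \<omega>_def \<iota>_U star_star)

lemma \<omega>_projection:
  "e \<in> projections \<Longrightarrow> \<omega> i j k l e = cinner (F (U i j e)) (F (U k l e))"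
  by (simp add: cinner_F_U projections_def)

lemma \<omega>_identities_projection:
  assumes e: "e \<in> projections"
  shows "\<omega> 1 1 2 2 e = 0" "\<omega> 2 2 1 1 e = 0" "\<omega> 1 2 2 1 e = 0" "\<omega> 2 1 1 2 e = 0"
    "\<omega> 1 1 1 1 e + \<omega> 2 2 2 2 e = \<omega> 1 2 1 2 e + \<omega> 2 1 2 1 e"
    "\<omega> 2 1 2 2 e = \<omega> 1 1 1 2 e" "\<omega> 2 2 2 1 e = \<omega> 1 2 1 1 e"
    "\<omega> 1 2 2 2 e = \<omega> 1 1 2 1 e" "\<omega> 2 2 1 2 e = \<omega> 2 1 1 1 e"
proof -
  let ?f = "\<lambda>i j. F (U i j e)"
  have ep: "e * e = e" "star e = e" using e by (auto simp: projections_def)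
  have ab: "cinner (?f 1 1) (?f 2 2) = 0"
    by (rule F_orthogonal[OF projection_U(1)[OF e] projection_U(1)[OF e]]) (simp add: U_mult)
  have orth: "cinner (16 *\<^sub>C ?f 1 1 + 9 *\<^sub>C ?f 2 2 + 12 *\<^sub>C (cnj z *\<^sub>C ?f 1 2 + z *\<^sub>C ?f 2 1))
        (9 *\<^sub>C ?f 1 1 + 16 *\<^sub>C ?f 2 2 - 12 *\<^sub>C (cnj z *\<^sub>C ?f 1 2 + z *\<^sub>C ?f 2 1)) = 0"
    if z: "z * cnj z = 1" for z
  proof -
    \<comment> \<open>The product of these weights is the square of 12/25; with the opposite
      off-diagonal sign, \<open>?q\<close> becomes the complement of \<open>?p\<close> in
      \<open>\<iota> e\<close>.\<close>
    define s t :: real where "s = 16/25" and "t = 9/25"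
    define y where "y = (12/25) * z"
    have yy: "y * cnj y = 144/625" using z by (simp add: y_def)
    let ?p = "U 1 1 (of_real s *\<^sub>C e) + U 2 2 (of_real t *\<^sub>C e) + U 1 2 (cnj y *\<^sub>C e) + U 2 1 (y *\<^sub>C e)"
    let ?q = "U 1 1 (of_real t *\<^sub>C e) + U 2 2 (of_real s *\<^sub>C e) + U 1 2 (cnj (- y) *\<^sub>C e) + U 2 1 ((- y) *\<^sub>C e)"
    have pq: "?p \<in> projections" "?q \<in> projections"
      by (intro projection_rank_one[OF e]; simp add: yy s_def t_def power2_eq_square)+
    have dg: "U i j (of_real s *\<^sub>C e) + U i j (of_real t *\<^sub>C e) = U i j e" for i j
      by (simp add: s_def t_def flip: U_add scaleC_add_left)
    have off: "U i j (c *\<^sub>C e) + U i j (d *\<^sub>C e) = 0" if "c + d = 0" for i j c d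
      using that by (simp flip: U_add scaleC_add_left)
    have off12: "U 1 2 (cnj y *\<^sub>C e) + U 1 2 (cnj (- y) *\<^sub>C e) = 0" by (rule off) simp
    have off21: "U 2 1 (y *\<^sub>C e) + U 2 1 ((- y) *\<^sub>C e) = 0" by (rule off) simp
    have "?p + ?q = (U 1 1 (of_real s *\<^sub>C e) + U 1 1 (of_real t *\<^sub>C e))
        + (U 2 2 (of_real s *\<^sub>C e) + U 2 2 (of_real t *\<^sub>C e))
        + (U 1 2 (cnj y *\<^sub>C e) + U 1 2 (cnj (- y) *\<^sub>C e)) + (U 2 1 (y *\<^sub>C e) + U 2 1 ((- y) *\<^sub>C e))"
      by (simp only: add_ac)
    also have "\<dots> = \<iota> e" 
      by (simp only: dg off12 off21) (simp add: \<iota>_def)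
    finally have "?p + ?q = \<iota> e" .
    then have "?q = \<iota> e - ?p" by (simp add: algebra_simps)
    moreover have "?p * \<iota> e = ?p" by (simp add: distrib_right \<iota>_U mult_scaleC_right ep)
    moreover have "?p * ?p = ?p" using pq(1) by (simp add: projections_def)
    ultimately have "?p * ?q = 0" by (simp only: right_diff_distrib) simp
    from F_orthogonal[OF pq this] have "625 * cinner (F ?p) (F ?q) = 0" by simp
    moreover have "25 *\<^sub>C F ?p = 16 *\<^sub>C ?f 1 1 + 9 *\<^sub>C ?f 2 2 + 12 *\<^sub>C (cnj z *\<^sub>C ?f 1 2 + z *\<^sub>C ?f 2 1)"
      by (simp add: F_simps U_scaleC scaleC_add_right s_def t_def y_def)
    moreover have "25 *\<^sub>C F ?q = 9 *\<^sub>C ?f 1 1 + 16 *\<^sub>C ?f 2 2 - 12 *\<^sub>C (cnj z *\<^sub>C ?f 1 2 + z *\<^sub>C ?f 2 1)"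
      by (simp add: F_simps U_scaleC scaleC_add_right s_def t_def y_def
          clinear_minus[OF U_clinear] clinear_minus[OF F_clinear]
          complex_vector.scale_right_diff_distrib)
    moreover have "cinner (25 *\<^sub>C F ?p) (25 *\<^sub>C F ?q) = 625 * cinner (F ?p) (F ?q)"
      by (simp add: cinner_scaleC_left cinner_scaleC_right)
    ultimately show ?thesis by metis
  qed
  note ids = orthogonality_identities[OF ab orth]
  note sym = cinner_commute[of "?f 2 2" "?f 1 1"] cinner_commute[of "?f 2 1" "?f 1 2"]
    cinner_commute[of "?f 2 2" "?f 2 1"] cinner_commute[of "?f 1 2" "?f 1 1"]
    cinner_commute[of "?f 2 2" "?f 1 2"] cinner_commute[of "?f 2 1" "?f 1 1"]
  show "\<omega> 1 1 2 2 e = 0" "\<omega> 2 2 1 1 e = 0" "\<omega> 1 2 2 1 e = 0" "\<omega> 2 1 1 2 e = 0"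
    "\<omega> 1 1 1 1 e + \<omega> 2 2 2 2 e = \<omega> 1 2 1 2 e + \<omega> 2 1 2 1 e"
    "\<omega> 2 1 2 2 e = \<omega> 1 1 1 2 e" "\<omega> 2 2 2 1 e = \<omega> 1 2 1 1 e"
    "\<omega> 1 2 2 2 e = \<omega> 1 1 2 1 e" "\<omega> 2 2 1 2 e = \<omega> 2 1 1 1 e"
    unfolding \<omega>_projection[OF e] using ab ids sym by simp_all
qed

lemma functionals_eq_if_eq_on_projections:
  assumes "f \<in> cdual" "g \<in> cdual" "\<And>e. e \<in> projections \<Longrightarrow> f e = g e"
  shows "f a = g (a :: 'm)"
proof -
  have "(\<lambda>a. f a - g a) \<in> cdual"
    unfolding cdual_def mem_Collect_eq clinear_iff using assms(1,2)
    by (intro conjI allI bounded_linear_sub cdual_bounded)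
      (simp_all add: clinear_add[OF cdual_clinear] cdual_scaleC scaleC_complex_def right_diff_distrib)
  from functional_zero_if_zero_on_projections[OF this] show ?thesis using assms(3) by simp
qed

lemma cdual_zero: "(\<lambda>_. 0) \<in> cdual"
  by (simp add: cdual_def clinear_iff)

lemma cdual_add: "f \<in> cdual \<Longrightarrow> g \<in> cdual \<Longrightarrow> (\<lambda>x. f x + g x) \<in> cdual"
  unfolding cdual_def mem_Collect_eq clinear_iff
  by (intro conjI allI bounded_linear_add) (simp_all add: scaleC_add_right)

lemma cdual_diff: "f \<in> cdual \<Longrightarrow> g \<in> cdual \<Longrightarrow> (\<lambda>x. f x - g x) \<in> cdual"
  unfolding cdual_def mem_Collect_eq clinear_iff
  by (intro conjI allI bounded_linear_sub) (simp_all add: complex_vector.scale_right_diff_distrib)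

text \<open>The splitting into \<open>A\<close> and \<open>B\<close> is unique only up to a scalar,
  which is fixed here by making the lower right entry of \<open>A\<close> zero. Then
  \<open>\<omega> 1 2 1 2\<close> and \<open>\<omega> 2 2 2 2\<close> are the diagonal of
  \<open>B\<close>, and \<open>\<omega> 1 1 1 1\<close> determines the remaining diagonal entry of
  \<open>A\<close>.\<close>

definition A :: "2 \<Rightarrow> 2 \<Rightarrow> 'm \<Rightarrow> complex" where
  "A l j a = (if l = 1 then if j = 1 then \<omega> 1 1 1 1 a - \<omega> 1 2 1 2 a else \<omega> 1 2 1 1 a
    else if j = 1 then \<omega> 1 1 1 2 a else 0)"

definition B :: "2 \<Rightarrow> 2 \<Rightarrow> 'm \<Rightarrow> complex" where
  "B i k a = (if i = 1 then if k = 1 then \<omega> 1 2 1 2 a else \<omega> 1 1 2 1 a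
    else if k = 1 then \<omega> 2 1 1 1 a else \<omega> 2 2 2 2 a)"

lemma A_cdual: "A l j \<in> cdual"
  unfolding A_def[abs_def]
  by (cases "l = 1"; cases "j = 1") (simp_all add: \<omega>_cdual cdual_diff cdual_zero)

lemma B_cdual: "B i k \<in> cdual"
  unfolding B_def[abs_def] by (cases "i = 1"; cases "k = 1") (simp_all add: \<omega>_cdual)

lemma \<omega>_eq: "\<omega> i j k l a = (if i = k then A l j a else 0) + (if j = l then B i k a else 0)"
proof -
  note eq = functionals_eq_if_eq_on_projections
  note ids = \<omega>_identities_projection
  have "\<omega> 1 1 2 2 a = 0" "\<omega> 2 2 1 1 a = 0" "\<omega> 1 2 2 1 a = 0" "\<omega> 2 1 1 2 a = 0"
    by (rule functional_zero_if_zero_on_projections[OF \<omega>_cdual], rule ids, assumption)+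
  moreover have "\<omega> 1 1 1 1 a + \<omega> 2 2 2 2 a = \<omega> 1 2 1 2 a + \<omega> 2 1 2 1 a"
    by (rule eq[OF cdual_add[OF \<omega>_cdual \<omega>_cdual] cdual_add[OF \<omega>_cdual \<omega>_cdual]]) (rule ids(5))
  moreover have "\<omega> 2 1 2 2 a = \<omega> 1 1 1 2 a" "\<omega> 2 2 2 1 a = \<omega> 1 2 1 1 a"
    "\<omega> 1 2 2 2 a = \<omega> 1 1 2 1 a" "\<omega> 2 2 1 2 a = \<omega> 2 1 1 1 a"
    by (rule eq[OF \<omega>_cdual \<omega>_cdual], rule ids, assumption)+
  ultimately show ?thesis
    using exhaust_2[of i] exhaust_2[of j] exhaust_2[of k] exhaust_2[of l]
    by (auto simp: A_def B_def algebra_simps)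
qed

section \<open>The scalars that make both matrices positive, and their additive choice\<close>

definition \<kappa> :: "'m \<Rightarrow> complex" where "\<kappa> a = cinner (F (\<iota> a)) (F 1)"

definition form :: "(2 \<Rightarrow> 2 \<Rightarrow> 'm \<Rightarrow> complex) \<Rightarrow> 'm \<Rightarrow> (2 \<Rightarrow> complex) \<Rightarrow> complex" where
  "form T a c = (\<Sum>l\<in>UNIV. \<Sum>j\<in>UNIV. cnj (c l) * c j * T l j a)"

definition sqnorm :: "(2 \<Rightarrow> complex) \<Rightarrow> real" where
  "sqnorm c = (\<Sum>l\<in>UNIV. (cmod (c l))\<^sup>2)"

text \<open>The matrices \<open>A\<close> and \<open>B\<close> are determined up to a common multiple of the identity, which is
  subtracted from \<open>A\<close> and added to \<open>B\<close>; \<open>admissible a r\<close> says that the multiple \<open>r\<close> makes both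
  positive at \<open>a\<close>.\<close>

definition admissible :: "'m \<Rightarrow> complex \<Rightarrow> bool" where
  "admissible a r \<longleftrightarrow> (\<forall>c. form A a c - r * of_real (sqnorm c) \<in> \<real>\<^sub>\<ge>\<^sub>0)
    \<and> (\<forall>c. form B a c + r * of_real (sqnorm c) \<in> \<real>\<^sub>\<ge>\<^sub>0)"

lemma sqnorm_eq: "complex_of_real (sqnorm c) = (\<Sum>l\<in>UNIV. cnj (c l) * c l)"
  by (simp add: sqnorm_def sum_2 mult.commute flip: complex_norm_square)

lemma sqnorm_nonneg: "0 \<le> sqnorm c"
  by (simp add: sqnorm_def sum_nonneg)

lemma sqnorm_eq_0D: "sqnorm c = 0 \<Longrightarrow> c l = 0"
  by (simp add: sqnorm_def sum_nonneg_eq_0_iff)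

lemma form_add: "(\<And>l j. T l j \<in> cdual) \<Longrightarrow> form T (a + b) c = form T a c + form T b c"
  by (simp add: form_def sum_2 clinear_add[OF cdual_clinear] algebra_simps)

lemma admissible_add:
  assumes "admissible a r" "admissible b s"
  shows "admissible (a + b) (r + s)"
proof -
  have "form A (a + b) c - (r + s) * of_real (sqnorm c)
      = (form A a c - r * of_real (sqnorm c)) + (form A b c - s * of_real (sqnorm c))"
    "form B (a + b) c + (r + s) * of_real (sqnorm c)
      = (form B a c + r * of_real (sqnorm c)) + (form B b c + s * of_real (sqnorm c))" for c
    by (simp_all add: form_add A_cdual B_cdual algebra_simps)
  then show ?thesis using assms by (simp add: admissible_def nonneg_Reals_add_I)
qed

lemma \<kappa>_projection:
  assumes e: "e \<in> projections"
  shows "\<kappa> e = of_real ((norm (F (\<iota> e)))\<^sup>2)"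
  using F_module[of e "\<iota> e" 1] e
  by (simp add: \<kappa>_def projections_def cinner_self flip: \<iota>_mult)

lemma \<kappa>_cdual: "\<kappa> \<in> cdual"
proof -
  have "(\<lambda>a. cinner (F (\<iota> a * 1)) (F 1)) \<in> cdual" by (rule cdual_comp_\<iota>[OF cinner_F_cdual])
  then show ?thesis by (simp add: \<kappa>_def[abs_def])
qed

text \<open>Turns the scalars \<open>\<kappa> (star h * e)\<close> of
  \<open>admissible_finite\<close> into inner products with the vector \<open>F (\<iota> h)\<close>,
  which thereby is a candidate for \<open>\<eta>\<close>.\<close>

lemma cinner_F_\<iota>: "cinner (F (\<iota> a)) (F (\<iota> b)) = \<kappa> (star b * a)"
  using F_module[of "star b" "\<iota> a" 1] by (simp add: \<kappa>_def \<iota>_mult star_star)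

lemma form_A_real:
  assumes e: "e \<in> projections"
  shows "Im (form A e c) = 0"
proof -
  have "cnj (A l j e) = A j l e" for l j
    using exhaust_2[of l] exhaust_2[of j] cinner_commute[of "F (U 1 2 e)" "F (U 1 1 e)"]
    by (auto simp: A_def \<omega>_projection[OF e] cinner_self)
  then have "cnj (form A e c) = form A e c"
    by (simp add: form_def sum_2 algebra_simps)
  then show ?thesis by (metis Reals_cnj_iff complex_is_Real_iff)
qed

lemma form_sum_nonneg:
  assumes e: "e \<in> projections"
  shows "of_real (sqnorm d) * form A e c + of_real (sqnorm c) * form B e d \<in> \<real>\<^sub>\<ge>\<^sub>0"
proof -
  \<comment> \<open>A rank one matrix times \<open>e\<close>: each of the two Kronecker deltas in
    \<open>\<omega>_eq\<close> turns one pair of sums into \<open>sqnorm d\<close> or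
    \<open>sqnorm c\<close> and leaves the other pair as a form.\<close>
  define x where "x = (\<Sum>i\<in>UNIV. \<Sum>j\<in>UNIV. (cnj (d i) * c j) *\<^sub>C U i j e)"
  have "cinner (F x) (F x) = (\<Sum>i\<in>UNIV. \<Sum>j\<in>UNIV. \<Sum>k\<in>UNIV. \<Sum>l\<in>UNIV.
      (cnj (d i) * c j) * (cnj (cnj (d k) * c l) * \<omega> i j k l e))"
    by (simp add: x_def sum_2 F_simps cinner_add_left cinner_add_right cinner_scaleC_left
        cinner_scaleC_right \<omega>_projection[OF e] algebra_simps)
  also have "\<dots> = of_real (sqnorm d) * form A e c + of_real (sqnorm c) * form B e d"
    by (simp add: \<omega>_eq sum_2 sqnorm_eq form_def algebra_simps)
  finally show ?thesis by (metis cinner_self nonneg_Reals_of_real_iff zero_le_power2)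
qed

text \<open>The scalar is the lowest eigenvalue of \<open>A\<close>, as an infimum of Rayleigh
  quotients; \<open>form_sum_nonneg\<close> says that it is at least minus any Rayleigh quotient of
  \<open>B\<close>. It is at most 0 since the lower right entry of \<open>A\<close> vanishes, and
  minus it is at most the upper left entry of \<open>B\<close>, a squared norm controlled by the
  identity for the diagonal of the form.\<close>

lemma admissible_scalar:
  assumes e: "e \<in> projections"
  obtains r where "admissible e (of_real r)" "\<bar>r\<bar> \<le> (norm (F (\<iota> e)))\<^sup>2"
proof -
  define X where "X = {Re (form A e c) / sqnorm c | c. 0 < sqnorm c}"
  define r where "r = Inf X"
  \<comment> \<open>Evaluated at \<open>c = (1, 1)\<close>, the nonnegative sum is real and so is
    its \<open>A\<close> part, hence also its \<open>B\<close> part.\<close>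
  have real_B: "Im (form B e d) = 0" for d
  proof -
    have "Im (of_real (sqnorm d) * form A e (\<lambda>_. 1) + of_real (sqnorm (\<lambda>_. 1)) * form B e d) = 0"
      using form_sum_nonneg[OF e, of d "\<lambda>_. 1"] by (simp add: complex_nonneg_Reals_iff)
    then show ?thesis using form_A_real[OF e] by (simp add: sqnorm_def sum_2)
  qed
  have low: "- Re (form B e d) / sqnorm d \<le> x" if d: "0 < sqnorm d" and x: "x \<in> X" for d x
  proof -
    obtain c where c: "0 < sqnorm c" "x = Re (form A e c) / sqnorm c" using x by (auto simp: X_def)
    have "0 \<le> sqnorm d * Re (form A e c) + sqnorm c * Re (form B e d)"
      using form_sum_nonneg[OF e, of d c] by (simp add: complex_nonneg_Reals_iff)
    then show ?thesis unfolding c(2) using c(1) d by (simp add: field_simps)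
  qed
  define d1 d2 :: "2 \<Rightarrow> complex" where "d1 = (\<lambda>l. if l = 1 then 1 else 0)"
    and "d2 = (\<lambda>l. if l = 1 then 0 else 1)"
  have d: "sqnorm d1 = 1" "sqnorm d2 = 1" by (simp_all add: d1_def d2_def sqnorm_def sum_2)
  have "form A e d2 = 0" by (simp add: form_def sum_2 d2_def A_def)
  then have X0: "0 \<in> X" using d(2) unfolding X_def by (intro CollectI exI[of _ d2]) simp
  have bdd: "bdd_below X" using low[of d1] d(1) by (auto simp: bdd_below_def)
  have r0: "r \<le> 0" unfolding r_def by (rule cInf_lower[OF X0 bdd])
  have lower: "- Re (form B e d) / sqnorm d \<le> r" if "0 < sqnorm d" for d
    unfolding r_def using low[OF that] X0 by (intro cInf_greatest) auto
  have form_0: "form T e c = 0" if "sqnorm c = 0" for T c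
    using sqnorm_eq_0D[OF that] by (simp add: form_def)
  have "form A e c - of_real r * of_real (sqnorm c) \<in> \<real>\<^sub>\<ge>\<^sub>0" for c
  proof (cases "sqnorm c = 0")
    case False
    then have c: "0 < sqnorm c" using sqnorm_nonneg[of c] by simp
    then have "r \<le> Re (form A e c) / sqnorm c"
      unfolding r_def by (intro cInf_lower[OF _ bdd]) (auto simp: X_def)
    then show ?thesis using c form_A_real[OF e] by (simp add: complex_nonneg_Reals_iff field_simps)
  qed (simp add: form_0)
  moreover have "form B e c + of_real r * of_real (sqnorm c) \<in> \<real>\<^sub>\<ge>\<^sub>0" for c
  proof (cases "sqnorm c = 0")
    case False
    then have c: "0 < sqnorm c" using sqnorm_nonneg[of c] by simp
    then show ?thesis using lower[OF c] real_B by (simp add: complex_nonneg_Reals_iff field_simps)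
  qed (simp add: form_0)
  ultimately have "admissible e (of_real r)" by (simp add: admissible_def)
  moreover have "\<bar>r\<bar> \<le> (norm (F (\<iota> e)))\<^sup>2"
  proof -
    have "form B e d1 = of_real ((norm (F (U 1 2 e)))\<^sup>2)"
      by (simp add: form_def sum_2 d1_def B_def \<omega>_projection[OF e] cinner_self)
    then have "- r \<le> (norm (F (U 1 2 e)))\<^sup>2" using lower[of d1] d(1) by simp
    also have "\<dots> \<le> (norm (F (U 1 2 e)))\<^sup>2 + (norm (F (U 2 1 e)))\<^sup>2" by simp
    also have "\<dots> = (norm (F (U 1 1 e)))\<^sup>2 + (norm (F (U 2 2 e)))\<^sup>2"
      using arg_cong[OF \<omega>_identities_projection(5)[OF e], of Re]
      by (simp add: \<omega>_projection[OF e] cinner_self_Re)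
    also have "\<dots> = (norm (F (\<iota> e)))\<^sup>2"
      using norm_add_orthogonal[of "F (U 1 1 e)" "F (U 2 2 e)"] \<omega>_identities_projection(1)[OF e]
      by (simp add: \<omega>_projection[OF e] \<iota>_def F_simps)
    finally show ?thesis using r0 by simp
  qed
  ultimately show ?thesis by (rule that)
qed

text \<open>Splitting \<open>f\<close> into \<open>f * e\<close> and \<open>f * (1 - e)\<close>
  leads down to the atoms of the algebra generated by \<open>E\<close> inside \<open>f\<close>, with
  one scalar chosen on each; \<open>h\<close> collects them into a step function, and Pythagoras
  adds up the norm bounds. Inserting 1 keeps the statement for the corner itself, which one level up
  is the statement for \<open>e\<close>.\<close>

lemma admissible_finite:
  assumes "finite E" "E \<subseteq> projections" "f \<in> projections"
  shows "\<exists>h. f * h = h \<and> (norm (F (\<iota> h)))\<^sup>2 \<le> (norm (F (\<iota> f)))\<^sup>2 \<and>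
    (\<forall>e\<in>insert 1 E. admissible (f * e) (\<kappa> (star h * (f * e))))"
  using assms
proof (induction E arbitrary: f rule: finite_induct)
  case empty
  obtain r where r: "admissible f (of_real r)" "\<bar>r\<bar> \<le> (norm (F (\<iota> f)))\<^sup>2"
    using admissible_scalar[OF empty(2)] by blast
  define n where "n = (norm (F (\<iota> f)))\<^sup>2"
  \<comment> \<open>The scalar \<open>n\<close> is \<open>\<kappa> f\<close>. If it is zero, the
    bound makes \<open>r\<close> zero as well, and division by zero gives the right value
    \<open>s = 0\<close>.\<close>
  define s where "s = r / n"
  define h where "h = complex_of_real s *\<^sub>C f"
  have f: "f * f = f" "star f = f" using empty(2) by (auto simp: projections_def)
  have s: "\<bar>s\<bar> \<le> 1" "s * n = r"
    using r(2) by (auto simp: s_def n_def[symmetric] divide_le_eq abs_divide)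
  have "norm (F (\<iota> h)) = \<bar>s\<bar> * norm (F (\<iota> f))"
    by (simp add: h_def \<iota>_scaleC F_simps norm_scaleC)
  then have "norm (F (\<iota> h)) \<le> norm (F (\<iota> f))" using s(1) by (simp add: mult_left_le_one_le)
  then have "(norm (F (\<iota> h)))\<^sup>2 \<le> (norm (F (\<iota> f)))\<^sup>2" by (rule power_mono) simp
  moreover have "\<kappa> (star h * f) = of_real r"
    using s(2) by (simp add: h_def star_scaleC f mult_scaleC_left cdual_scaleC[OF \<kappa>_cdual]
        \<kappa>_projection[OF empty(2)] n_def flip: of_real_mult of_real_power)
  moreover have "f * h = h" by (simp add: h_def mult_scaleC_right f)
  ultimately show ?case using r(1) by (intro exI[of _ h]) simp
next
  case (insert e E)
  have e: "e \<in> projections" and E: "E \<subseteq> projections" using insert.prems(1) by auto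
  define p q where "p = f * e" and "q = f * (1 - e)"
  have pq: "p \<in> projections" "q \<in> projections"
    unfolding p_def q_def by (intro projection_mult projection_complement e insert.prems(2))+
  obtain g where g: "p * g = g" "(norm (F (\<iota> g)))\<^sup>2 \<le> (norm (F (\<iota> p)))\<^sup>2"
    "\<And>e. e \<in> insert 1 E \<Longrightarrow> admissible (p * e) (\<kappa> (star g * (p * e)))"
    using insert.IH[OF E pq(1)] by blast
  obtain h where h: "q * h = h" "(norm (F (\<iota> h)))\<^sup>2 \<le> (norm (F (\<iota> q)))\<^sup>2"
    "\<And>e. e \<in> insert 1 E \<Longrightarrow> admissible (q * e) (\<kappa> (star h * (q * e)))"
    using insert.IH[OF E pq(2)] by blast
  have ee: "e * e = e" "star e = e" and ff: "f * f = f" "star f = f"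
    using e insert.prems(2) by (auto simp: projections_def)
  have spq: "star p = p" "star q = q" "p * p = p" "q * q = q" using pq by (auto simp: projections_def)
  have "p * q = f * f * (e * (1 - e))" by (simp add: p_def q_def ac)
  then have p_q: "p * q = 0" using ee by (simp add: right_diff_distrib)
  then have q_p: "q * p = 0" using commute[of p q] by simp
  have f_eq: "f = p + q" by (simp add: p_def q_def right_diff_distrib)
  have sg: "star g * p = star g" "star g * q = 0" and sh: "star h * q = star h" "star h * p = 0"
  proof -
    show 1: "star g * p = star g" using arg_cong[OF g(1), of star] by (simp add: star_mult spq)
    show 2: "star h * q = star h" using arg_cong[OF h(1), of star] by (simp add: star_mult spq)
    show "star g * q = 0" by (subst 1[symmetric]) (simp add: mult.assoc p_q)
    show "star h * p = 0" by (subst 2[symmetric]) (simp add: mult.assoc q_p)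
  qed
  note \<kappa>_add = clinear_add[OF cdual_clinear[OF \<kappa>_cdual]] and \<kappa>_0 = clinear_zero[OF cdual_clinear[OF \<kappa>_cdual]]
  have "f * (g + h) = g + h"
  proof -
    have "q * g = 0" by (subst g(1)[symmetric]) (simp add: q_p flip: mult.assoc)
    moreover have "p * h = 0" by (subst h(1)[symmetric]) (simp add: p_q flip: mult.assoc)
    ultimately show ?thesis by (simp add: f_eq distrib_left distrib_right g(1) h(1))
  qed
  moreover have "(norm (F (\<iota> (g + h))))\<^sup>2 \<le> (norm (F (\<iota> f)))\<^sup>2"
  proof -
    have "star h * g = 0" by (subst g(1)[symmetric]) (simp add: sh flip: mult.assoc)
    then have "cinner (F (\<iota> g)) (F (\<iota> h)) = 0" by (simp add: cinner_F_\<iota> \<kappa>_0)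
    from norm_add_orthogonal[OF this]
    have "(norm (F (\<iota> (g + h))))\<^sup>2 = (norm (F (\<iota> g)))\<^sup>2 + (norm (F (\<iota> h)))\<^sup>2"
      by (simp add: \<iota>_add F_simps)
    moreover have "cinner (F (\<iota> p)) (F (\<iota> q)) = 0" by (simp add: cinner_F_\<iota> spq q_p \<kappa>_0)
    from norm_add_orthogonal[OF this]
    have "(norm (F (\<iota> f)))\<^sup>2 = (norm (F (\<iota> p)))\<^sup>2 + (norm (F (\<iota> q)))\<^sup>2"
      by (simp add: f_eq \<iota>_add F_simps)
    ultimately show ?thesis using g(2) h(2) by linarith
  qed
  moreover have "admissible (f * x) (\<kappa> (star (g + h) * (f * x)))" if x: "x \<in> insert 1 (insert e E)" for x
  proof (cases "x = e")
    case True
    have "f * e = p * 1" by (simp add: p_def)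
    moreover have "\<kappa> (star (g + h) * (p * 1)) = \<kappa> (star g * (p * 1))"
      by (simp add: star_add distrib_right sg sh)
    ultimately show ?thesis unfolding True using g(3)[of 1] by simp
  next
    case False
    then have x': "x \<in> insert 1 E" using x by blast
    have "star (g + h) * (f * x) = star g * (p * x) + star h * (q * x)"
      by (simp add: f_eq star_add distrib_left distrib_right sg sh flip: mult.assoc)
    then show ?thesis
      using admissible_add[OF g(3)[OF x'] h(3)[OF x']] by (simp add: f_eq distrib_right \<kappa>_add)
  qed
  ultimately show ?case by (intro exI[of _ "g + h"]) blast
qed

lemma admissible_closed: "closed {r. admissible a r}"
proof -
  have "closed {r. form A a c - r * of_real (sqnorm c) \<in> \<real>\<^sub>\<ge>\<^sub>0}"
    "closed {r. form B a c + r * of_real (sqnorm c) \<in> \<real>\<^sub>\<ge>\<^sub>0}" for c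
    by (rule continuous_closed_vimage[OF closed_nonneg_Reals_complex, unfolded vimage_def],
        intro continuous_intros)+
  then show ?thesis
    unfolding admissible_def
    by (intro closed_Collect_conj closed_Collect_all)
qed

text \<open>Each projection imposes on \<open>\<eta>\<close> a closed condition that is stable under
  midpoints, and finitely many of them are met by some \<open>F (\<iota> h)\<close> in the ball of
  radius \<open>norm (F 1)\<close>.\<close>

lemma admissible_vector:
  obtains \<eta> where "\<And>e. e \<in> projections \<Longrightarrow> admissible e (cinner (F (\<iota> e)) \<eta>)"
proof -
  define K where "K = (\<lambda>e. {\<eta>. admissible e (cinner (F (\<iota> e)) \<eta>)})"
  show ?thesis
  proof (rule closed_convex_family_has_common_point[of projections K "norm (F 1)"])
    fix e :: 'm
    show "closed (K e)"
      unfolding closed_sequential_limits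
    proof (intro allI impI, elim conjE)
      fix s l assume s: "\<forall>n. s n \<in> K e" "s \<longlonglongrightarrow> l"
      have "cinner (F (\<iota> e)) l \<in> {r. admissible e r}"
        using s(1) by (intro closed_sequentially[OF admissible_closed _ tendsto_cinner_right[OF s(2)]])
          (simp add: K_def)
      then show "l \<in> K e" by (simp add: K_def)
    qed
  next
    fix e x y assume "x \<in> K e" "y \<in> K e"
    then have 1: "admissible e (cinner (F (\<iota> e)) x)" "admissible e (cinner (F (\<iota> e)) y)"
      by (simp_all add: K_def)
    define r where "r = (cinner (F (\<iota> e)) x + cinner (F (\<iota> e)) y) / 2"
    have half: "z / 2 \<in> \<real>\<^sub>\<ge>\<^sub>0" if "z \<in> \<real>\<^sub>\<ge>\<^sub>0" for z :: complex
      using that by (simp add: complex_nonneg_Reals_iff)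
    have "admissible e r"
      unfolding admissible_def
    proof (intro conjI allI)
      fix c
      show "form A e c - r * of_real (sqnorm c) \<in> \<real>\<^sub>\<ge>\<^sub>0"
        using 1 half[OF nonneg_Reals_add_I[of "form A e c - cinner (F (\<iota> e)) x * of_real (sqnorm c)"
            "form A e c - cinner (F (\<iota> e)) y * of_real (sqnorm c)"]]
        by (simp add: admissible_def r_def field_simps)
      show "form B e c + r * of_real (sqnorm c) \<in> \<real>\<^sub>\<ge>\<^sub>0"
        using 1 half[OF nonneg_Reals_add_I[of "form B e c + cinner (F (\<iota> e)) x * of_real (sqnorm c)"
            "form B e c + cinner (F (\<iota> e)) y * of_real (sqnorm c)"]]
        by (simp add: admissible_def r_def field_simps)
    qed
    moreover have "cinner (F (\<iota> e)) ((1/2) *\<^sub>R (x + y)) = r"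
      by (simp add: r_def scaleR_scaleC cinner_scaleC_right cinner_add_right del: scaleR_right_distrib)
    ultimately show "(1/2) *\<^sub>R (x + y) \<in> K e" by (simp add: K_def)
  next
    fix J :: "'m set" assume J: "finite J" "J \<subseteq> projections"
    have "1 \<in> (projections :: 'm set)" by (simp add: projections_def)
    from admissible_finite[OF J this] obtain h where
      h: "(norm (F (\<iota> h)))\<^sup>2 \<le> (norm (F 1))\<^sup>2" "\<And>e. e \<in> J \<Longrightarrow> admissible e (\<kappa> (star h * e))"
      by (auto simp: \<iota>_one)
    have "norm (F (\<iota> h)) \<le> norm (F 1)" using h(1) by (rule power2_le_imp_le) simp
    moreover have "\<forall>e\<in>J. F (\<iota> h) \<in> K e" using h(2) by (simp add: K_def cinner_F_\<iota>)
    ultimately show "\<exists>x. norm x \<le> norm (F 1) \<and> (\<forall>i\<in>J. x \<in> K i)" by blast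
  next
    fix \<eta> assume "\<And>e. e \<in> projections \<Longrightarrow> \<eta> \<in> K e"
    then show thesis by (intro that[of \<eta>]) (simp add: K_def)
  qed
qed

section \<open>Normality, positivity and the final formula\<close>

lemma normal_positive_of_form:
  assumes Q: "\<And>l j. (\<lambda>x. T l j (coef x l j)) \<in> Q" and T: "\<And>l j. T l j \<in> cdual"
    and pos: "\<And>e c. e \<in> projections \<Longrightarrow> form T e c \<in> \<real>\<^sub>\<ge>\<^sub>0"
  shows "(\<lambda>x. \<Sum>l\<in>UNIV. \<Sum>j\<in>UNIV. T l j (coef x l j)) \<in> normal_positive Q"
proof -
  let ?\<phi> = "\<lambda>x. \<Sum>l\<in>UNIV. \<Sum>j\<in>UNIV. T l j (coef x l j)"
  have "?\<phi> \<in> Q" unfolding sum_2 by (intro predual_add[OF predual_Q] Q)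
  then have "clinear ?\<phi>" "continuous_map (wstar_topology Q) euclidean ?\<phi>"
    unfolding wstar_topology_def
    by (rule cdual_clinear[OF predual_cdual[OF predual_Q]], rule in_predual_continuous)
  moreover have "?\<phi> (star x * x) \<in> \<real>\<^sub>\<ge>\<^sub>0" for x
  proof -
    \<comment> \<open>The entries of \<open>star x * x\<close> are sums over the rows of
      \<open>x\<close>, and each row contributes the form at the vector of its entries.\<close>
    have row: "(\<Sum>l\<in>UNIV. \<Sum>j\<in>UNIV. T l j (star (coef x i l) * coef x i j)) \<in> \<real>\<^sub>\<ge>\<^sub>0" for i
      using pos unfolding form_def by (rule positive_form_if_positive_on_projections[OF T])
    have "?\<phi> (star x * x) = (\<Sum>i\<in>UNIV. \<Sum>l\<in>UNIV. \<Sum>j\<in>UNIV. T l j (star (coef x i l) * coef x i j))"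
      by (simp add: sum_2 coef_mult coef_star clinear_add[OF cdual_clinear[OF T]])
    then show ?thesis using row by (simp add: sum_2 nonneg_Reals_add_I)
  qed
  ultimately show ?thesis by (simp add: normal_positive_def)
qed

theorem F_stationary: "stationary Q F"
proof -
  obtain \<eta> where \<eta>: "\<And>e. e \<in> projections \<Longrightarrow> admissible e (cinner (F (\<iota> e)) \<eta>)"
    using admissible_vector by blast
  define \<gamma> where "\<gamma> = (\<lambda>a. cinner (F (\<iota> a)) \<eta>)"
  have "(\<lambda>a. cinner (F (\<iota> a * 1)) \<eta>) \<in> cdual" by (rule cdual_comp_\<iota>[OF cinner_F_cdual])
  then have \<gamma>: "\<gamma> \<in> cdual" by (simp add: \<gamma>_def)
  \<comment> \<open>The choice of \<gamma> as a vector functional pays off: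
    \<open>cinner (F x) \<eta>\<close> belongs to \<open>Q\<close>, and taking entries preserves
    this.\<close>
  have \<gamma>Q: "(\<lambda>x. \<gamma> (coef x l j)) \<in> Q" for l j
    by (simp add: \<gamma>_def \<iota>_def F_simps cinner_add_left)
      (intro predual_add[OF predual_Q] predual_comp_coef[OF cinner_F_in_Q])
  have \<omega>Q: "(\<lambda>x. \<omega> i j k l (coef x p q)) \<in> Q" for i j k l p q
    unfolding \<omega>_def by (rule predual_comp_coef[OF cinner_F_in_Q])
  have Qdiff: "(\<lambda>x. f x - g x) \<in> Q" if "f \<in> Q" "g \<in> Q" for f g
    using predual_add[OF predual_Q that(1) predual_scale[OF predual_Q that(2), of "- 1"]] by simp
  \<comment> \<open>In \<open>\<omega>\<close> the two corrections meet only when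
    \<open>i = k\<close> and \<open>j = l\<close>, where they cancel.\<close>
  define A' where "A' = (\<lambda>l j a. A l j a - (if l = j then \<gamma> a else 0))"
  define B' where "B' = (\<lambda>l j a. B l j a + (if l = j then \<gamma> a else 0))"
  have A'c: "A' l j \<in> cdual" and B'c: "B' l j \<in> cdual" for l j
    using A_cdual B_cdual cdual_diff[OF A_cdual \<gamma>] cdual_add[OF B_cdual \<gamma>]
    by (cases "l = j"; simp add: A'_def B'_def)+
  have AQ: "(\<lambda>x. A l j (coef x p q)) \<in> Q" and BQ: "(\<lambda>x. B l j (coef x p q)) \<in> Q" for l j p q
    by (cases "l = 1"; cases "j = 1"; simp add: A_def B_def \<omega>Q Qdiff predual_zero[OF predual_Q])+
  have A'Q: "(\<lambda>x. A' l j (coef x l j)) \<in> Q" and B'Q: "(\<lambda>x. B' l j (coef x l j)) \<in> Q" for l j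
    using AQ BQ Qdiff[OF AQ \<gamma>Q] predual_add[OF predual_Q BQ \<gamma>Q]
    by (cases "l = j"; simp add: A'_def B'_def)+
  have "form A' e c = form A e c - \<gamma> e * of_real (sqnorm c)"
    "form B' e c = form B e c + \<gamma> e * of_real (sqnorm c)" for e c
    by (simp_all add: form_def A'_def B'_def sqnorm_eq sum_2 algebra_simps)
  then have pos: "form A' e c \<in> \<real>\<^sub>\<ge>\<^sub>0" "form B' e c \<in> \<real>\<^sub>\<ge>\<^sub>0" if "e \<in> projections" for e c
    using \<eta>[OF that] by (simp_all add: admissible_def \<gamma>_def)
  define \<phi> \<psi> where "\<phi> = (\<lambda>x. \<Sum>l\<in>UNIV. \<Sum>j\<in>UNIV. A' l j (coef x l j))"
    and "\<psi> = (\<lambda>x. \<Sum>l\<in>UNIV. \<Sum>j\<in>UNIV. B' l j (coef x l j))"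
  have "\<phi> \<in> normal_positive Q" "\<psi> \<in> normal_positive Q"
    unfolding \<phi>_def \<psi>_def
    by (rule normal_positive_of_form[OF A'Q A'c pos(1)], assumption)
      (rule normal_positive_of_form[OF B'Q B'c pos(2)], assumption)
  moreover have "cinner (F x) (F y) = \<phi> (star y * x) + \<psi> (x * star y)" for x y
  proof -
    have w: "\<omega> i j k l a = (if i = k then A' l j a else 0) + (if j = l then B' i k a else 0)" for i j k l a
      by (auto simp: \<omega>_eq A'_def B'_def)
    have "cinner (F x) (F y) = (\<Sum>i\<in>UNIV. \<Sum>j\<in>UNIV. \<Sum>k\<in>UNIV. \<Sum>l\<in>UNIV.
        \<omega> i j k l (star (coef y k l) * coef x i j))"
      by (subst (1) decompose[of x], subst (1) decompose[of y])
        (simp add: sum_2 F_simps cinner_add_left cinner_add_right cinner_F_U)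
    \<comment> \<open>The terms with \<open>i = k\<close> sum up to the entries of
      \<open>star y * x\<close> and those with \<open>j = l\<close> to the entries of
      \<open>x * star y\<close>; commutativity puts the factors of the latter in order.\<close>
    also have "\<dots> = \<phi> (star y * x) + \<psi> (x * star y)"
      by (simp add: w \<phi>_def \<psi>_def sum_2 coef_mult coef_star clinear_add[OF cdual_clinear[OF A'c]]
          clinear_add[OF cdual_clinear[OF B'c]] commute)
    finally show ?thesis .
  qed
  ultimately show ?thesis unfolding stationary_def by blast
qed

end

theorem theorem4:
  fixes P :: "('m::cstar_algebra \<Rightarrow> complex) set"
    and Q :: "('n::cstar_algebra \<Rightarrow> complex) set"
    and \<Phi> :: "'m^2^2 \<Rightarrow> 'n"
    and F :: "'n \<Rightarrow> 'h::complex_hilbert_space"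
  assumes "is_predual P"
    and "\<forall>a b :: 'm. a * b = b * a"
    and "is_predual Q"
    and "matrix_star_iso \<Phi>"
    and "wstar_continuous_ovf Q F"
  shows "stationary Q F"
proof -
  interpret matrix_ovf P Q \<Phi> F
    using assms by unfold_locales blast+
  show ?thesis by (rule F_stationary)
qed

end
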